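(* Let $\mathbb{D}=\{z\in\mathbb{C}:|z|<1\}$ and let $\mathcal{L}_{\mathbb{D}}$ be the set of limit-periodic complex-valued sequences $\alpha$ on $\mathbb{Z}$ with $\alpha(n)\in\mathbb{D}$ for every $n\in\mathbb{Z}$, with the $\ell^\infty$ metric. For each $0<\tau<1$, let $\mathcal{H}^{\mathrm{CMV}}_\tau$ be the set of $\alpha\in\mathcal{L}_{\mathbb{D}}$ such that the spectrum $\sigma(\mathcal{E}_\alpha)\subseteq\partial\mathbb{D}$ of the CMV operator $\mathcal{E}_\alpha$ is a $\tau$-homogeneous Cantor set. Then $\mathcal{H}^{\mathrm{CMV}}_\tau$ is dense in $\mathcal{L}_{\mathbb{D}}$ for every $0<\tau<1$.
   Context: Given $\alpha:\mathbb{Z}\to\mathbb{D}$, put $\rho(n)=\sqrt{1-|\alpha(n)|^2}$, $a(n)=-\overline{\alpha(n)}\alpha(n-1)$, $b(n)=\overline{\alpha(n)}\rho(n-1)$, $c(n)=-\rho(n)\alpha(n-1)$, $d(n)=\rho(n)\rho(n-1)$. The CMV operator $\mathcal{E}_\alpha$ is the unitary operator on $\ell^2(\mathbb{Z})$ whose matrix in the standard basis has, for each $k\in\mathbb{Z}$: in row $2k$, the entries $b(2k), a(2k), b(2k+1), d(2k+1)$ in columns $2k-1,2k,2k+1,2k+2$ respectively; in row $2k+1$, the entries $d(2k), c(2k), a(2k+1), c(2k+1)$ in columns $2k-1,2k,2k+1,2k+2$ respectively; and all other entries zero. A sequence on $\mathbb{Z}$ is limit-periodic if it is a limit in $\ell^\infty(\mathbb{Z})$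 (uniform limit) of periodic sequences (periodic sequences themselves are included). For $\tau>0$, a closed set $K\subseteq\partial\mathbb{D}$ is $\tau$-homogeneous if there exists $\delta_0>0$ such that $|B_\delta(x)\cap K|\ge\tau\delta$ for every $x\in K$ and every $0<\delta\le\delta_0$, where $|\cdot|$ is arc-length measure on $\partial\mathbb{D}$ (total mass $2\pi$) and $B_\delta(x)$ is the open $\delta$-neighborhood of $x$ with respect to the usual metric on $\mathbb{C}$. A Cantor set is a totally disconnected (nonempty) compact set with no isolated points. *)

theory Defs
  imports "HOL-Analysis.Analysis"
begin

subsection \<open>The Hilbert space of square-summable sequences and spectra of operators on it\<close>

definition ell2 :: "(int \<Rightarrow> complex) set" where
  "ell2 = {f. (\<lambda>n. (cmod (f n))\<^sup>2) summable_on UNIV}"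

definition ell2_norm :: "(int \<Rightarrow> complex) \<Rightarrow> real" where
  "ell2_norm f = sqrt (\<Sum>\<^sub>\<infinity>n. (cmod (f n))\<^sup>2)"

text \<open>Operators are functions on all of \<^typ>\<open>int \<Rightarrow> complex\<close>; only their values on
  \<^const>\<open>ell2\<close> matter.\<close>

definition ell2_bounded_op :: "((int \<Rightarrow> complex) \<Rightarrow> (int \<Rightarrow> complex)) \<Rightarrow> bool" where
  "ell2_bounded_op T \<longleftrightarrow>
     (\<forall>f\<in>ell2. T f \<in> ell2) \<and>
     (\<forall>f\<in>ell2. \<forall>g\<in>ell2. T (\<lambda>n. f n + g n) = (\<lambda>n. T f n + T g n)) \<and>
     (\<forall>c. \<forall>f\<in>ell2. T (\<lambda>n. c * f n) = (\<lambda>n. c * T f n)) \<and>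
     (\<exists>C. \<forall>f\<in>ell2. ell2_norm (T f) \<le> C * ell2_norm f)"

text \<open>The complement of the set of \<open>z\<close> for which \<open>T - z\<close> has a bounded two-sided inverse
  \<open>S\<close> on \<^const>\<open>ell2\<close>.\<close>

definition ell2_spectrum :: "((int \<Rightarrow> complex) \<Rightarrow> (int \<Rightarrow> complex)) \<Rightarrow> complex set" where
  "ell2_spectrum T =
     {z. \<not> (\<exists>S. ell2_bounded_op S \<and>
              (\<forall>f\<in>ell2. S (\<lambda>n. T f n - z * f n) = f) \<and>
              (\<forall>f\<in>ell2. (\<lambda>n. T (S f) n - z * S f n) = f))}"


subsection \<open>CMV operators\<close>

definition cmv_rho :: "(int \<Rightarrow> complex) \<Rightarrow> int \<Rightarrow> real" where
  "cmv_rho \<alpha> n = sqrt (1 - (cmod (\<alpha> n))\<^sup>2)"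

definition cmv_a :: "(int \<Rightarrow> complex) \<Rightarrow> int \<Rightarrow> complex" where
  "cmv_a \<alpha> n = - cnj (\<alpha> n) * \<alpha> (n - 1)"

definition cmv_b :: "(int \<Rightarrow> complex) \<Rightarrow> int \<Rightarrow> complex" where
  "cmv_b \<alpha> n = cnj (\<alpha> n) * complex_of_real (cmv_rho \<alpha> (n - 1))"

definition cmv_c :: "(int \<Rightarrow> complex) \<Rightarrow> int \<Rightarrow> complex" where
  "cmv_c \<alpha> n = - complex_of_real (cmv_rho \<alpha> n) * \<alpha> (n - 1)"

definition cmv_d :: "(int \<Rightarrow> complex) \<Rightarrow> int \<Rightarrow> complex" where
  "cmv_d \<alpha> n = complex_of_real (cmv_rho \<alpha> n) * complex_of_real (cmv_rho \<alpha> (n - 1))"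

text \<open>Entry in row \<open>i\<close> and column \<open>j\<close>. With \<open>i = 2k\<close>, the columns \<open>2k-1, 2k, 2k+1, 2k+2\<close>
  are \<open>i-1, i, i+1, i+2\<close>; with \<open>i = 2k+1\<close> they are \<open>i-2, i-1, i, i+1\<close>.\<close>

definition cmv_matrix :: "(int \<Rightarrow> complex) \<Rightarrow> int \<Rightarrow> int \<Rightarrow> complex" where
  "cmv_matrix \<alpha> i j =
     (if even i then
        (if j = i - 1 then cmv_b \<alpha> i
         else if j = i then cmv_a \<alpha> i
         else if j = i + 1 then cmv_b \<alpha> (i + 1)
         else if j = i + 2 then cmv_d \<alpha> (i + 1)
         else 0)
      else
        (if j = i - 2 then cmv_d \<alpha> (i - 1)
         else if j = i - 1 then cmv_c \<alpha> (i - 1)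
         else if j = i then cmv_a \<alpha> i
         else if j = i + 1 then cmv_c \<alpha> i
         else 0))"

text \<open>The sum has at most four nonzero terms.\<close>

definition cmv_op :: "(int \<Rightarrow> complex) \<Rightarrow> (int \<Rightarrow> complex) \<Rightarrow> (int \<Rightarrow> complex)" where
  "cmv_op \<alpha> f = (\<lambda>i. \<Sum>\<^sub>\<infinity>j. cmv_matrix \<alpha> i j * f j)"

lemma cmv_op_even:
  "cmv_op \<alpha> f (2 * k) =
     cmv_b \<alpha> (2 * k) * f (2 * k - 1) + cmv_a \<alpha> (2 * k) * f (2 * k) +
     cmv_b \<alpha> (2 * k + 1) * f (2 * k + 1) + cmv_d \<alpha> (2 * k + 1) * f (2 * k + 2)"
proof -
  have "cmv_op \<alpha> f (2 * k) =
      (\<Sum>\<^sub>\<infinity>j\<in>{2 * k - 1, 2 * k, 2 * k + 1, 2 * k + 2}. cmv_matrix \<alpha> (2 * k) j * f j)"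
    unfolding cmv_op_def by (rule infsum_cong_neutral) (auto simp: cmv_matrix_def split: if_splits)
  then show ?thesis
    by (simp add: cmv_matrix_def)
qed

lemma cmv_op_odd:
  "cmv_op \<alpha> f (2 * k + 1) =
     cmv_d \<alpha> (2 * k) * f (2 * k - 1) + cmv_c \<alpha> (2 * k) * f (2 * k) +
     cmv_a \<alpha> (2 * k + 1) * f (2 * k + 1) + cmv_c \<alpha> (2 * k + 1) * f (2 * k + 2)"
proof -
  have "cmv_op \<alpha> f (2 * k + 1) =
      (\<Sum>\<^sub>\<infinity>j\<in>{2 * k - 1, 2 * k, 2 * k + 1, 2 * k + 2}. cmv_matrix \<alpha> (2 * k + 1) j * f j)"
    unfolding cmv_op_def by (rule infsum_cong_neutral) (auto simp: cmv_matrix_def split: if_splits)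
  then show ?thesis
    by (simp add: cmv_matrix_def)
qed


subsection \<open>Limit-periodic sequences\<close>

text \<open>Since \<^typ>\<open>int\<close> is discrete, \<^typ>\<open>int \<Rightarrow>\<^sub>C complex\<close> is the space of all bounded
  two-sided complex sequences with the supremum metric.\<close>

definition periodic_seqs :: "(int \<Rightarrow>\<^sub>C complex) set" where
  "periodic_seqs = {\<beta>. \<exists>p>0. \<forall>n. apply_bcontfun \<beta> (n + p) = apply_bcontfun \<beta> n}"

definition limit_periodic_seqs :: "(int \<Rightarrow>\<^sub>C complex) set" where
  "limit_periodic_seqs = closure periodic_seqs"

definition limit_periodic_disk :: "(int \<Rightarrow>\<^sub>C complex) set" where
  "limit_periodic_disk = {\<alpha> \<in> limit_periodic_seqs. \<forall>n. apply_bcontfun \<alpha> n \<in> ball 0 1}"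


subsection \<open>Homogeneous Cantor sets on the unit circle\<close>

definition arc_length :: "complex measure" where
  "arc_length = distr (restrict_space lborel {0..<2 * pi}) borel cis"

lemma emeasure_arc_length:
  assumes "A \<in> sets borel"
  shows "emeasure arc_length A = emeasure lborel {t \<in> {0..<2 * pi}. cis t \<in> A}"
proof -
  have meas: "cis \<in> measurable (restrict_space lborel {0..<2 * pi}) borel"
  proof (rule measurable_restrict_space1)
    have "continuous_on UNIV cis"
      by (intro continuous_intros)
    then show "cis \<in> measurable lborel borel"
      by (simp add: borel_measurable_continuous_onI)
  qed
  have "cis -` A \<inter> {0..<2 * pi} = {t \<in> {0..<2 * pi}. cis t \<in> A}"
    by auto
  then show ?thesis
    unfolding arc_length_def
    by (subst emeasure_distr[OF meas assms], subst emeasure_restrict_space)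
       (auto simp: space_restrict_space)
qed

lemma emeasure_arc_length_UNIV: "emeasure arc_length UNIV = ennreal (2 * pi)"
proof -
  have "{t \<in> {0..<2 * pi}. cis t \<in> UNIV} = {0..<2 * pi}"
    by auto
  then show ?thesis
    using emeasure_arc_length[of UNIV] by simp
qed

definition tau_homogeneous :: "real \<Rightarrow> complex set \<Rightarrow> bool" where
  "tau_homogeneous \<tau> K \<longleftrightarrow>
     closed K \<and> K \<subseteq> sphere 0 1 \<and>
     (\<exists>\<delta>\<^sub>0>0. \<forall>x\<in>K. \<forall>\<delta>. 0 < \<delta> \<and> \<delta> \<le> \<delta>\<^sub>0 \<longrightarrow>
        \<tau> * \<delta> \<le> measure arc_length (ball x \<delta> \<inter> K))"

definition cantor_set :: "'a :: topological_space set \<Rightarrow> bool" where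
  "cantor_set K \<longleftrightarrow>
     K \<noteq> {} \<and> compact K \<and>
     (\<forall>x\<in>K. connected_component_set K x = {x}) \<and>
     \<not> (\<exists>x. x isolated_in K)"

definition homogeneous_cmv :: "real \<Rightarrow> (int \<Rightarrow>\<^sub>C complex) set" where
  "homogeneous_cmv \<tau> =
     {\<alpha> \<in> limit_periodic_disk.
        tau_homogeneous \<tau> (ell2_spectrum (cmv_op (apply_bcontfun \<alpha>))) \<and>
        cantor_set (ell2_spectrum (cmv_op (apply_bcontfun \<alpha>)))}"

end

theory Submission
  imports Defs
begin

text \<open>The spectrum of a periodic CMV operator is \<open>{e\<^sup>i\<^sup>\<theta> : |\<Delta>(\<theta>)| \<le> 2}\<close>, where the discriminant \<open>\<Delta>\<close> is the trace
  of a monodromy matrix in \<open>SU(1,1)\<close>. On \<open>|\<Delta>| \<le> 2\<close> the derivative of \<open>\<Delta>\<close> vanishes only where the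
  monodromy is \<open>\<plusminus>1\<close>, and there \<open>|\<Delta>|\<close> has a strict local maximum. So every band runs from \<open>-2\<close> to
  \<open>2\<close>, and since \<open>\<Delta>\<close> is Lipschitz uniformly in the coefficients, the bands have a length bounded below
  in terms of the period and the supremum of the coefficients only. Viewed with a large multiple \<open>N q\<close> of its period \<open>q\<close>, a periodic
  sequence has monodromy \<open>\<plusminus>1\<close> on a fine set of points of the spectrum, and an arbitrarily small change
  of one coefficient per period turns all of them into gaps. It also removes arbitrarily little arc
  length, while the lower bound for the length of the bands takes care of the small scales; hence
  homogeneity at scales up to a fixed \<open>\<delta>\<^sub>0\<close> deteriorates arbitrarily little. Spectra of unitary operators
  depend continuously on the operator in the Hausdorff distance, and homogeneity with fixed constants
  passes to Hausdorff limits, because arc length is upper semicontinuous. Iterating yields a limit-periodic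
  sequence whose spectrum is homogeneous and has gaps at all scales.\<close>

subsection \<open>The Hilbert space of square-summable sequences\<close>

text \<open>A ball of radius \<delta> about a point of the circle contains arcs of length \<delta>
  on both sides of that point. So a spectrum containing an arc of length \<delta> on one side of
  each of its points is homogeneous with constant 1 up to scale \<delta>, and any \<tau> < 1 leaves
  room for infinitely many losses. The obstacle is that \<open>\<delta>\<^sub>0\<close> has to stay
  fixed while the band lengths shrink with growing periods; between the two scales only the total
  lost arc length is under control, and it must be small compared with the new band length. This
  dictates the order of choices: the enlarged period, then a band length valid for all sequences
  with that period and a given bound, and only then the size of the perturbation. Continuity of the
  spectrum is obtained by elementary means: the spectrum of a unitary \<open>U\<close> is described
  by lower bounds of \<open>U - z\<close>, and the best lower bound is shown to be the distance from
  \<open>z\<close> to a point of the spectrum.\<close>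

lemma ell2_comparison:
  assumes "f \<in> ell2" "\<And>n. cmod (g n) \<le> cmod (f n)"
  shows "g \<in> ell2"
proof -
  have "(\<lambda>n. (cmod (g n))\<^sup>2) summable_on UNIV"
  proof (rule summable_on_comparison_test)
    show "(\<lambda>n. (cmod (f n))\<^sup>2) summable_on UNIV"
      using assms(1) by (simp add: ell2_def)
  qed (use assms(2) in \<open>auto intro: power_mono\<close>)
  then show ?thesis by (simp add: ell2_def)
qed

lemma ell2_add: "f \<in> ell2 \<Longrightarrow> g \<in> ell2 \<Longrightarrow> (\<lambda>n. f n + g n) \<in> ell2"
proof -
  assume "f \<in> ell2" "g \<in> ell2"
  then have s: "(\<lambda>n. 2 * ((cmod (f n))\<^sup>2 + (cmod (g n))\<^sup>2)) summable_on UNIV"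
    unfolding ell2_def by (intro summable_on_cmult_right summable_on_add) auto
  have "(cmod (f n + g n))\<^sup>2 \<le> 2 * ((cmod (f n))\<^sup>2 + (cmod (g n))\<^sup>2)" for n
  proof -
    have "(cmod (f n + g n))\<^sup>2 \<le> (cmod (f n) + cmod (g n))\<^sup>2"
      by (intro power_mono norm_triangle_ineq) auto
    also have "\<dots> \<le> 2 * ((cmod (f n))\<^sup>2 + (cmod (g n))\<^sup>2)"
      using sum_squares_bound[of "cmod (f n)" "cmod (g n)"] by (simp add: power2_sum)
    finally show ?thesis .
  qed
  with s have "(\<lambda>n. (cmod (f n + g n))\<^sup>2) summable_on UNIV"
    by (rule summable_on_comparison_test) auto
  then show ?thesis by (simp add: ell2_def)
qed

lemma ell2_cmult: "f \<in> ell2 \<Longrightarrow> (\<lambda>n. c * f n) \<in> ell2"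
  unfolding ell2_def by (auto simp: norm_mult power_mult_distrib intro: summable_on_cmult_right)

lemma ell2_uminus: "f \<in> ell2 \<Longrightarrow> (\<lambda>n. - f n) \<in> ell2"
  using ell2_cmult[of f "-1"] by simp

lemma ell2_diff: "f \<in> ell2 \<Longrightarrow> g \<in> ell2 \<Longrightarrow> (\<lambda>n. f n - g n) \<in> ell2"
  using ell2_add[OF _ ell2_uminus] by auto

lemma ell2_zero: "(\<lambda>_. 0) \<in> ell2"
  by (simp add: ell2_def)

lemma ell2_shift: "f \<in> ell2 \<Longrightarrow> (\<lambda>n. f (n + k)) \<in> ell2"
  unfolding ell2_def
  using summable_on_reindex_bij_betw[of "\<lambda>n. n + k" UNIV UNIV "\<lambda>n. (cmod (f n))\<^sup>2"]
  by (simp add: bij_plus_right)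

lemma ell2_finite_support:
  assumes "finite {n. f n \<noteq> 0}"
  shows "f \<in> ell2"
  unfolding ell2_def
  by (rule CollectI, rule finite_nonzero_values_imp_summable_on) (use assms in simp)

lemma ell2_inner_summable:
  assumes "f \<in> ell2" "g \<in> ell2"
  shows "(\<lambda>n. f n \<bullet> g n) summable_on UNIV"
proof -
  have "(\<lambda>n. (cmod (f n))\<^sup>2 + (cmod (g n))\<^sup>2) summable_on UNIV"
    using assms unfolding ell2_def by (intro summable_on_add) auto
  then have "(\<lambda>n. norm (f n \<bullet> g n)) summable_on UNIV"
  proof (rule summable_on_comparison_test)
    fix n :: int
    have "\<bar>f n \<bullet> g n\<bar> \<le> cmod (f n) * cmod (g n)"
      by (rule Cauchy_Schwarz_ineq2)
    also have "\<dots> \<le> 2 * cmod (f n) * cmod (g n)" by simp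
    also have "\<dots> \<le> (cmod (f n))\<^sup>2 + (cmod (g n))\<^sup>2"
      by (rule sum_squares_bound)
    finally show "norm (f n \<bullet> g n) \<le> (cmod (f n))\<^sup>2 + (cmod (g n))\<^sup>2" by simp
  qed simp
  then show ?thesis by (rule Infinite_Sum.abs_summable_summable)
qed

text \<open>As a type the space can be an instance of \<open>real_inner\<close> and
  \<open>banach\<close>, which makes polarization and the fixed-point theorem available.\<close>

typedef l2 = ell2 morphisms seq Abs_l2
  using ell2_zero by blast

setup_lifting type_definition_l2

instantiation l2 :: real_inner
begin

lift_definition zero_l2 :: l2 is "\<lambda>_. 0" by (rule ell2_zero)
lift_definition plus_l2 :: "l2 \<Rightarrow> l2 \<Rightarrow> l2" is "\<lambda>f g n. f n + g n" by (rule ell2_add)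
lift_definition minus_l2 :: "l2 \<Rightarrow> l2 \<Rightarrow> l2" is "\<lambda>f g n. f n - g n" by (rule ell2_diff)
lift_definition uminus_l2 :: "l2 \<Rightarrow> l2" is "\<lambda>f n. - f n" by (rule ell2_uminus)
lift_definition scaleR_l2 :: "real \<Rightarrow> l2 \<Rightarrow> l2" is "\<lambda>r f n. of_real r * f n" by (rule ell2_cmult)
text \<open>The inner product under the sum is the real one on the complex plane, so this is the
  real part of the usual Hermitian product.\<close>

definition inner_l2 :: "l2 \<Rightarrow> l2 \<Rightarrow> real" where "inner_l2 f g = (\<Sum>\<^sub>\<infinity>n. seq f n \<bullet> seq g n)"
definition norm_l2 :: "l2 \<Rightarrow> real" where "norm_l2 f = sqrt (f \<bullet> f)"
definition dist_l2 :: "l2 \<Rightarrow> l2 \<Rightarrow> real" where "dist_l2 f g = norm (f - g)"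
definition sgn_l2 :: "l2 \<Rightarrow> l2" where "sgn_l2 f = inverse (norm f) *\<^sub>R f"
definition uniformity_l2 :: "(l2 \<times> l2) filter" where
  "uniformity_l2 = (INF e\<in>{0<..}. principal {(x, y). dist x y < e})"
definition open_l2 :: "l2 set \<Rightarrow> bool" where
  "open_l2 U \<longleftrightarrow> (\<forall>x\<in>U. eventually (\<lambda>(x', y). x' = x \<longrightarrow> y \<in> U) uniformity)"

instance
proof
  fix f g h :: l2 and r s :: real
  show "f + g + h = f + (g + h)" "f + g = g + f" "0 + f = f" "- f + f = 0" "f - g = f + - g"
    "r *\<^sub>R (f + g) = r *\<^sub>R f + r *\<^sub>R g" "(r + s) *\<^sub>R f = r *\<^sub>R f + s *\<^sub>R f"
    "r *\<^sub>R s *\<^sub>R f = (r * s) *\<^sub>R f" "1 *\<^sub>R f = f"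
    by (transfer; simp add: fun_eq_iff algebra_simps)+
  show "f \<bullet> g = g \<bullet> f"
    by (simp add: inner_l2_def inner_commute)
  have s: "(\<lambda>n. seq f n \<bullet> seq g n) summable_on UNIV" for f g
    using seq ell2_inner_summable by blast
  show "(f + g) \<bullet> h = f \<bullet> h + g \<bullet> h"
    by (simp add: inner_l2_def plus_l2.rep_eq inner_add_left infsum_add s)
  show "(r *\<^sub>R f) \<bullet> g = r * (f \<bullet> g)"
  proof -
    have "seq (r *\<^sub>R f) n \<bullet> seq g n = r * (seq f n \<bullet> seq g n)" for n
      by (simp add: scaleR_l2.rep_eq flip: scaleR_conv_of_real)
    then show ?thesis by (simp add: inner_l2_def infsum_cmult_right s)
  qed
  show "0 \<le> f \<bullet> f"
    unfolding inner_l2_def by (intro infsum_nonneg) simp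
  show "f \<bullet> f = 0 \<longleftrightarrow> f = 0"
  proof
    assume 0: "f \<bullet> f = 0"
    have "seq f n \<bullet> seq f n = 0" for n
    proof (rule nonneg_infsum_le_0D[where A = UNIV and f = "\<lambda>n. seq f n \<bullet> seq f n"])
      show "infsum (\<lambda>n. seq f n \<bullet> seq f n) UNIV \<le> 0"
        using 0 unfolding inner_l2_def by linarith
    qed (rule s inner_ge_zero UNIV_I)+
    then have "seq f n = seq 0 n" for n unfolding zero_l2.rep_eq inner_eq_zero_iff .
    then show "f = 0" using seq_inject by blast
  qed (simp add: inner_l2_def zero_l2.rep_eq)
  show "norm f = sqrt (f \<bullet> f)" by (rule norm_l2_def)
qed (simp_all add: dist_l2_def sgn_l2_def uniformity_l2_def open_l2_def)

end

lemmas seq_simps [simp] = zero_l2.rep_eq plus_l2.rep_eq minus_l2.rep_eq uminus_l2.rep_eq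
  scaleR_l2.rep_eq

lemma norm_l2_eq_ell2_norm: "norm f = ell2_norm (seq f)"
  by (simp add: norm_l2_def inner_l2_def ell2_norm_def dot_square_norm)

lemma ell2_norm_eq_norm: "f \<in> ell2 \<Longrightarrow> ell2_norm f = norm (Abs_l2 f)"
  by (simp add: norm_l2_eq_ell2_norm Abs_l2_inverse)

lemma norm_l2_squared: "(norm f)\<^sup>2 = (\<Sum>\<^sub>\<infinity>n. (cmod (seq f n))\<^sup>2)"
  by (simp add: norm_l2_eq_ell2_norm ell2_norm_def infsum_nonneg)

lemma l2_summable: "(\<lambda>n. (cmod (seq f n))\<^sup>2) summable_on UNIV"
  using seq[of f] by (simp add: ell2_def)

lemma l2_eqI: "(\<And>n. seq f n = seq g n) \<Longrightarrow> f = g"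
  by (metis ext seq_inject)

lemma norm_l2_mono: "(\<And>n. cmod (seq f n) \<le> cmod (seq g n)) \<Longrightarrow> norm f \<le> norm g"
  by (rule power2_le_imp_le)
     (auto simp: norm_l2_squared intro!: infsum_mono l2_summable power_mono)

lemma finite_sum_le_norm_l2:
  assumes "finite F" shows "(\<Sum>n\<in>F. (cmod (seq f n))\<^sup>2) \<le> (norm f)\<^sup>2"
  unfolding norm_l2_squared using assms l2_summable by (intro finite_sum_le_infsum) auto

lemma cmod_seq_le_norm: "cmod (seq f n) \<le> norm f"
  using finite_sum_le_norm_l2[of "{n}" f] by (auto intro: power2_le_imp_le)

instance l2 :: complete_space
proof
  fix X :: "nat \<Rightarrow> l2"
  assume C: "Cauchy X"
  have "Cauchy (\<lambda>k. seq (X k) n)" for n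
    unfolding Cauchy_def
  proof (intro allI impI)
    fix e :: real assume "0 < e"
    with C obtain M where "\<forall>k\<ge>M. \<forall>l\<ge>M. dist (X k) (X l) < e" by (auto simp: Cauchy_def)
    moreover have "dist (seq (X k) n) (seq (X l) n) \<le> dist (X k) (X l)" for k l
      using cmod_seq_le_norm[of "X k - X l" n] by (simp add: dist_norm)
    ultimately show "\<exists>M. \<forall>k\<ge>M. \<forall>l\<ge>M. dist (seq (X k) n) (seq (X l) n) < e"
      by (meson le_less_trans)
  qed
  then have "\<exists>g. \<forall>n. (\<lambda>k. seq (X k) n) \<longlonglongrightarrow> g n"
    by (meson Cauchy_convergent convergent_def)
  then obtain g where g: "\<And>n. (\<lambda>k. seq (X k) n) \<longlonglongrightarrow> g n" by blast
  \<comment> \<open>The limit in \<open>l\<close> is taken inside finite sums, where it is termwise;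
    the bound then extends to the full sum because it does not depend on \<open>F\<close>.\<close>
  have fin: "(\<Sum>n\<in>F. (cmod (seq (X k) n - g n))\<^sup>2) \<le> e\<^sup>2"
    if "finite F" "\<And>l. l \<ge> k \<Longrightarrow> dist (X k) (X l) \<le> e" for F k e
  proof (rule tendsto_upperbound)
    show "(\<lambda>l. \<Sum>n\<in>F. (cmod (seq (X k) n - seq (X l) n))\<^sup>2)
        \<longlonglongrightarrow> (\<Sum>n\<in>F. (cmod (seq (X k) n - g n))\<^sup>2)"
      by (intro tendsto_intros g)
    show "\<forall>\<^sub>F l in sequentially. (\<Sum>n\<in>F. (cmod (seq (X k) n - seq (X l) n))\<^sup>2) \<le> e\<^sup>2"
    proof (rule eventually_sequentiallyI)
      fix l assume "l \<ge> k"
      have "(\<Sum>n\<in>F. (cmod (seq (X k) n - seq (X l) n))\<^sup>2) \<le> (norm (X k - X l))\<^sup>2"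
        using finite_sum_le_norm_l2[OF that(1), of "X k - X l"] by simp
      also have "\<dots> \<le> e\<^sup>2"
        using that(2)[OF \<open>l \<ge> k\<close>] by (intro power_mono) (auto simp: dist_norm)
      finally show "(\<Sum>n\<in>F. (cmod (seq (X k) n - seq (X l) n))\<^sup>2) \<le> e\<^sup>2" .
    qed
  qed simp
  have mem: "(\<lambda>n. seq (X k) n - g n) \<in> ell2" if "\<And>l. l \<ge> k \<Longrightarrow> dist (X k) (X l) \<le> e" for k e
    unfolding ell2_def using fin[OF _ that]
    by (auto intro!: nonneg_bdd_above_summable_on bdd_aboveI2)
  have Cle: "\<exists>M. \<forall>k\<ge>M. \<forall>l\<ge>k. dist (X k) (X l) \<le> e" if "0 < e" for e
    using C that unfolding Cauchy_def by (meson less_imp_le order_trans)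
  obtain M where "\<forall>k\<ge>M. \<forall>l\<ge>k. dist (X k) (X l) \<le> 1"
    using Cle[of 1] by auto
  then have "(\<lambda>n. seq (X M) n - g n) \<in> ell2"
    by (intro mem[of M 1]) auto
  then have "(\<lambda>n. seq (X M) n - (seq (X M) n - g n)) \<in> ell2"
    using ell2_diff seq by blast
  then have g_mem: "g \<in> ell2" by simp
  define G where "G = Abs_l2 g"
  have G: "seq G = g" using g_mem by (simp add: G_def Abs_l2_inverse)
  have "X \<longlonglongrightarrow> G"
  proof (rule metric_LIMSEQ_I)
    fix r :: real assume "0 < r"
    then obtain M where M: "\<forall>k\<ge>M. \<forall>l\<ge>k. dist (X k) (X l) \<le> r / 2" using Cle[of "r / 2"] by auto
    have "dist (X k) G < r" if "k \<ge> M" for k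
    proof -
      have "(norm (X k - G))\<^sup>2 \<le> (r / 2)\<^sup>2"
        unfolding norm_l2_squared
      proof (rule infsum_le_finite_sums[OF l2_summable])
        fix F :: "int set" assume "finite F"
        with fin[of F k "r / 2"] M that
        show "(\<Sum>n\<in>F. (cmod (seq (X k - G) n))\<^sup>2) \<le> (r / 2)\<^sup>2" by (simp add: G)
      qed
      then have "norm (X k - G) \<le> r / 2"
        using \<open>0 < r\<close> by (auto intro: power2_le_imp_le)
      then show ?thesis using \<open>0 < r\<close> by (simp add: dist_norm)
    qed
    then show "\<exists>M. \<forall>k\<ge>M. dist (X k) G < r" by blast
  qed
  then show "convergent X" by (auto simp: convergent_def)
qed

text \<open>Complex scalars act on \<^typ>\<open>l2\<close> by hand because \<^class>\<open>real_inner\<close> only provides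
  real ones.\<close>

lift_definition scaleC :: "complex \<Rightarrow> l2 \<Rightarrow> l2" is "\<lambda>c f n. c * f n"
  by (rule ell2_cmult)

declare scaleC.rep_eq [simp]

lemma norm_scaleC [simp]: "norm (scaleC c f) = cmod c * norm f"
proof -
  have "(norm (scaleC c f))\<^sup>2 = (cmod c * norm f)\<^sup>2"
    using l2_summable[of f]
    by (simp add: norm_l2_squared norm_mult power_mult_distrib infsum_cmult_right)
  then show ?thesis by simp
qed

lift_definition shift :: "int \<Rightarrow> l2 \<Rightarrow> l2" is "\<lambda>k f n. f (n + k)"
  by (rule ell2_shift)

declare shift.rep_eq [simp]

lemma norm_shift [simp]: "norm (shift k f) = norm f"
proof -
  have "(norm (shift k f))\<^sup>2 = (norm f)\<^sup>2"
    using infsum_reindex_bij_betw[of "\<lambda>n. n + k" UNIV UNIV "\<lambda>n. (cmod (seq f n))\<^sup>2"]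
    by (simp add: norm_l2_squared bij_plus_right)
  then show ?thesis by simp
qed

text \<open>Shifts are isometries, so the triangle inequality applied to shifts of the sequence of
  moduli suffices. This is how all operators and identities of finite range below are turned into
  norm bounds.\<close>

lemma ell2_dominated_by_shifts:
  fixes g :: "int \<Rightarrow> complex"
  assumes "finite I" "0 \<le> c" and le: "\<And>n. cmod (g n) \<le> c * (\<Sum>i\<in>I. cmod (seq f (n + i)))"
  shows "g \<in> ell2" "ell2_norm g \<le> c * real (card I) * norm f"
proof -
  define a where "a = Abs_l2 (\<lambda>n. complex_of_real (cmod (seq f n)))"
  have "(\<lambda>n. complex_of_real (cmod (seq f n))) \<in> ell2"
    using seq[of f] by (auto intro: ell2_comparison)
  then have a: "seq a n = complex_of_real (cmod (seq f n))" for n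
    by (simp add: a_def Abs_l2_inverse)
  have "norm a = norm f"
    by (intro antisym norm_l2_mono) (simp_all add: a)
  define h where "h = c *\<^sub>R (\<Sum>i\<in>I. shift i a)"
  have "seq (\<Sum>i\<in>I. shift i a) n = (\<Sum>i\<in>I. seq a (n + i))" for n
    using \<open>finite I\<close> by induction auto
  then have "seq h n = complex_of_real (c * (\<Sum>i\<in>I. cmod (seq f (n + i))))" for n
    by (simp add: h_def a)
  then have h: "cmod (seq h n) = c * (\<Sum>i\<in>I. cmod (seq f (n + i)))" for n
    using \<open>0 \<le> c\<close> by (simp only: norm_of_real) (simp add: abs_mult sum_nonneg)
  show g: "g \<in> ell2"
    using le by (intro ell2_comparison[OF seq[of h]]) (simp add: h)
  have "norm (Abs_l2 g) \<le> norm h"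
    by (rule norm_l2_mono) (simp add: Abs_l2_inverse g h le)
  also have "\<dots> \<le> c * (\<Sum>i\<in>I. norm (shift i a))"
    using \<open>0 \<le> c\<close> by (simp add: h_def mult_left_mono norm_sum del: norm_shift)
  also have "\<dots> = c * real (card I) * norm f"
    by (simp add: \<open>norm a = norm f\<close>)
  finally show "ell2_norm g \<le> c * real (card I) * norm f"
    by (simp add: ell2_norm_eq_norm g)
qed

subsection \<open>Spectra of unitary operators\<close>

text \<open>A solution of \<open>A h + B h = g\<close> is a fixed point of the map taking
  \<open>h\<close> to a preimage of \<open>g - B h\<close> under \<open>A\<close>. The lower bound
  of \<open>A\<close> makes this map a contraction with factor \<open>k / m\<close>.\<close>

lemma surj_perturbation:
  fixes A B :: "'a :: banach \<Rightarrow> 'a"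
  assumes A_add: "\<And>f g. A (f + g) = A f + A g" and B_add: "\<And>f g. B (f + g) = B f + B g"
    and below: "\<And>f. m * norm f \<le> norm (A f)" and "surj A"
    and B: "\<And>f. norm (B f) \<le> k * norm f" and "0 \<le> k" "k < m"
  shows "surj (\<lambda>f. A f + B f)"
  unfolding surj_def
proof
  have add_diff: "T (f - g) = T f - T g" if "\<And>f g. T (f + g) = T f + T g" for T :: "'a \<Rightarrow> 'a" and f g
    using that[of "f - g" g] by (simp add: algebra_simps)
  fix g
  define A' where "A' = inv A"
  have A': "A (A' x) = x" for x using \<open>surj A\<close> by (simp add: A'_def surj_f_inv_f)
  have "\<exists>!h. A' (g - B h) = h"
  proof (rule banach_fix_type)
    show "0 \<le> k / m" "k / m < 1" using \<open>0 \<le> k\<close> \<open>k < m\<close> by auto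
    show "\<forall>x y. dist (A' (g - B x)) (A' (g - B y)) \<le> k / m * dist x y"
    proof (intro allI)
      fix x y
      have "m * norm (A' (g - B x) - A' (g - B y)) \<le> norm (B (y - x))"
        using below[of "A' (g - B x) - A' (g - B y)"] by (simp add: add_diff[OF A_add] add_diff[OF B_add] A')
      also have "\<dots> \<le> k * norm (x - y)" using B[of "y - x"] by (simp add: norm_minus_commute)
      finally show "dist (A' (g - B x)) (A' (g - B y)) \<le> k / m * dist x y"
        using \<open>0 \<le> k\<close> \<open>k < m\<close> by (simp add: dist_norm field_simps)
    qed
  qed
  then obtain h where "A' (g - B h) = h" by blast
  then have "A h = g - B h" by (metis A')
  then show "\<exists>h. g = A h + B h" by (intro exI[of _ h]) simp
qed

instance l2 :: banach ..

definition unitary_l2 :: "(l2 \<Rightarrow> l2) \<Rightarrow> bool" where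
  "unitary_l2 U \<longleftrightarrow> (\<forall>f g. U (f + g) = U f + U g) \<and> (\<forall>c f. U (scaleC c f) = scaleC c (U f)) \<and>
     (\<forall>f. norm (U f) = norm f) \<and> surj U"

definition below_by :: "(l2 \<Rightarrow> l2) \<Rightarrow> complex \<Rightarrow> real \<Rightarrow> bool" where
  "below_by U z m \<longleftrightarrow> (\<forall>f. m * norm f \<le> norm (U f - scaleC z f))"

text \<open>This is the approximate point spectrum. For a unitary operator it is the whole spectrum,
  since a lower bound of \<open>U - z\<close> already forces surjectivity; lower bounds are easier
  to perturb than inverses.\<close>

definition l2_spectrum :: "(l2 \<Rightarrow> l2) \<Rightarrow> complex set" where
  "l2_spectrum U = {z. \<not> (\<exists>m>0. below_by U z m)}"

lemma scaleC_add: "scaleC c (f + g) = scaleC c f + scaleC c g"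
  and scaleC_diff: "scaleC c (f - g) = scaleC c f - scaleC c g"
  and scaleC_add_left: "scaleC (b + c) f = scaleC b f + scaleC c f"
  and scaleC_diff_left: "scaleC (b - c) f = scaleC b f - scaleC c f"
  and scaleC_minus_left: "scaleC (- c) f = - scaleC c f"
  and scaleC_scaleC: "scaleC b (scaleC c f) = scaleC (b * c) f"
  and scaleC_of_real: "scaleC (of_real r) f = r *\<^sub>R f"
  and scaleC_one: "scaleC 1 f = f"
  by (rule l2_eqI; simp add: algebra_simps)+

lemma unit_vector_l2: "\<exists>f::l2. norm f = 1"
proof -
  define f where "f = Abs_l2 (\<lambda>n. if n = 0 then 1 else 0)"
  have "(\<lambda>n::int. if n = 0 then 1 else 0 :: complex) \<in> ell2"
    by (rule ell2_finite_support) simp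
  then have "seq f 0 = 1" by (simp add: f_def Abs_l2_inverse)
  then have "f \<noteq> 0" by auto
  then have "norm (f /\<^sub>R norm f) = 1" by simp
  then show ?thesis by blast
qed

context
  fixes U :: "l2 \<Rightarrow> l2"
  assumes U: "unitary_l2 U"
begin

lemma U_add: "U (f + g) = U f + U g" and U_scaleC: "U (scaleC c f) = scaleC c (U f)"
  and U_norm: "norm (U f) = norm f" and U_surj: "surj U"
  using U by (auto simp: unitary_l2_def)

lemma U_diff: "U (f - g) = U f - U g"
  using U_add[of "f - g" g] by (simp add: algebra_simps)

text \<open>Inside the disk \<open>U - z\<close> is a small perturbation of \<open>U\<close>,
  outside it is one of a nonzero scalar. A point with \<open>cmod z \<ge> 1\<close> is reached from
  \<open>w = (1 + s) z\<close> slightly further out: \<open>s\<close> is chosen so that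
  \<open>cmod (w - z) = m / 3\<close>, which is less than the lower bound \<open>m - m / 3\<close>
  left at \<open>w\<close>.\<close>

lemma surj_if_below_by:
  assumes "below_by U z m" "0 < m"
  shows "surj (\<lambda>f. U f - scaleC z f)"
proof (cases "cmod z < 1")
  case True
  have "surj (\<lambda>f. U f + scaleC (- z) f)"
    by (rule surj_perturbation[where m = 1 and k = "cmod z"])
       (use True in \<open>auto simp: U_add U_norm U_surj scaleC_add\<close>)
  then show ?thesis by (simp add: scaleC_minus_left)
next
  case False
  define s where "s = m / (3 * cmod z)"
  have z: "1 \<le> cmod z" "z \<noteq> 0" using False by auto
  have s: "0 < s" "s * cmod z = m / 3" using z assms(2) by (auto simp: s_def)
  define w where "w = of_real (1 + s) * z"
  have w: "cmod w = (1 + s) * cmod z" using s(1) by (simp only: w_def norm_mult norm_of_real)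
  have "cmod z < cmod w" using s(1) z by (simp add: w)
  then have "w \<noteq> 0" by auto
  have "surj (\<lambda>f. scaleC (- w) f + U f)"
  proof (rule surj_perturbation[where m = "cmod w" and k = 1])
    show "surj (scaleC (- w))"
      by (rule surjI[where f = "scaleC (- inverse w)"])
         (simp add: scaleC_scaleC scaleC_one \<open>w \<noteq> 0\<close>)
  qed (use z \<open>cmod z < cmod w\<close> in \<open>auto simp: U_add U_norm scaleC_add\<close>)
  then have surj: "surj (\<lambda>f. U f - scaleC w f)"
    by (simp add: scaleC_minus_left add.commute)
  have wz: "w - z = of_real s * z" by (simp add: w_def algebra_simps)
  have "surj (\<lambda>f. (U f - scaleC w f) + scaleC (w - z) f)"
  proof (rule surj_perturbation[where m = "m - m / 3" and k = "m / 3"])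
    fix f
    have wz_norm: "norm (scaleC (w - z) f) = m / 3 * norm f"
      using s by (simp add: wz norm_mult)
    then show "norm (scaleC (w - z) f) \<le> m / 3 * norm f" by (rule eq_refl)
    have "m * norm f \<le> norm (U f - scaleC z f)"
      using assms(1) by (simp add: below_by_def)
    also have "U f - scaleC z f = (U f - scaleC w f) + scaleC (w - z) f"
      by (simp add: scaleC_diff_left)
    also have "norm \<dots> \<le> norm (U f - scaleC w f) + m / 3 * norm f"
      using norm_triangle_ineq wz_norm by metis
    finally show "(m - m / 3) * norm f \<le> norm (U f - scaleC w f)"
      by (simp add: algebra_simps)
  qed (use surj \<open>0 < m\<close> in \<open>auto simp: U_add scaleC_add\<close>)
  then show ?thesis by (simp add: scaleC_diff_left)
qed

lemma below_by_off_circle: "below_by U z \<bar>1 - cmod z\<bar>"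
  unfolding below_by_def
proof
  fix f :: l2
  have "\<bar>1 - cmod z\<bar> * norm f = \<bar>(1 - cmod z) * norm f\<bar>" by (simp add: abs_mult)
  also have "\<dots> = \<bar>norm (U f) - norm (scaleC z f)\<bar>" by (simp add: U_norm left_diff_distrib)
  also have "\<dots> \<le> norm (U f - scaleC z f)" by (rule norm_triangle_ineq3)
  finally show "\<bar>1 - cmod z\<bar> * norm f \<le> norm (U f - scaleC z f)" .
qed

lemma l2_spectrum_subset_circle: "l2_spectrum U \<subseteq> sphere 0 1"
proof
  fix z assume "z \<in> l2_spectrum U"
  then have "\<not> 0 < \<bar>1 - cmod z\<bar>" using below_by_off_circle[of z] unfolding l2_spectrum_def by blast
  then show "z \<in> sphere 0 1" by simp
qed

lemma inner_preserving:
  fixes V :: "l2 \<Rightarrow> l2"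
  assumes "\<And>f g. V (f + g) = V f + V g" "\<And>f. norm (V f) = norm f"
  shows "V f \<bullet> V g = f \<bullet> g"
  by (simp add: dot_norm assms flip: assms(1))

text \<open>Let \<open>m\<close> be the best lower bound of \<open>U - z\<close>. The form \<open>(U - z)\<^sup>* (U - z) - m\<^sup>2\<close> is positive, so
  it is small on a vector as soon as its quadratic form is, and up to the unitary factor \<open>- z U\<close> it
  equals \<open>(U - w\<^sub>1) (U - w\<^sub>2)\<close>, where \<open>w\<^sub>1\<close>, \<open>w\<^sub>2\<close> are the points of the circle at distance \<open>m\<close>
  from \<open>z\<close>.\<close>

lemma below_by_dist_spectrum:
  assumes z: "cmod z = 1"
  shows "\<exists>w. w \<in> l2_spectrum U \<and> below_by U z (cmod (w - z))"
proof -
  define W where "W f = U f - scaleC z f" for f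
  define m where "m = (INF f\<in>{f. norm f = 1}. norm (W f))"
  have W_le: "norm (W f) \<le> 2 * norm f" for f
    using norm_triangle_ineq4[of "U f" "scaleC z f"] by (simp add: W_def U_norm z)
  have bdd: "bdd_below ((\<lambda>f. norm (W f)) ` {f. norm f = 1})"
    by (rule bdd_belowI2[where m = 0]) simp
  have ne: "{f::l2. norm f = 1} \<noteq> {}" using unit_vector_l2 by blast
  have m0: "0 \<le> m"
    unfolding m_def by (rule cINF_greatest[OF ne]) simp
  have m_le: "m \<le> norm (W f)" if "norm f = 1" for f
    unfolding m_def by (rule cINF_lower[OF bdd]) (use that in simp)
  have m2: "m \<le> 2"
    using unit_vector_l2 m_le W_le by (metis mult.right_neutral order_trans)
  have W_scaleR: "W (r *\<^sub>R f) = r *\<^sub>R W f" for r f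
    by (simp add: W_def U_scaleC scaleC_scaleC scaleC_diff mult.commute flip: scaleC_of_real)
  have W_add: "W (f + g) = W f + W g" for f g by (simp add: W_def U_add scaleC_add)
  have mW: "m * norm f \<le> norm (W f)" for f
  proof (cases "f = 0")
    case False
    then have "m \<le> norm (W (f /\<^sub>R norm f))" by (intro m_le) simp
    also have "\<dots> = norm (W f) / norm f" by (simp add: W_scaleR divide_inverse mult.commute)
    finally show ?thesis using False by (simp add: field_simps)
  qed simp
  define U' where "U' = inv U"
  have UU': "U (U' f) = f" for f using U_surj by (simp add: U'_def surj_f_inv_f)
  \<comment> \<open>The inverse \<open>U'\<close> is the adjoint of \<open>U\<close>, so this is the
    positive operator of the form above, expanded with \<open>cmod z = 1\<close>.\<close>
  define C where "C f = (2 - m\<^sup>2) *\<^sub>R f - scaleC (cnj z) (U f) - scaleC z (U' f)" for f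
  have zz: "z * cnj z = 1" using z by (simp add: complex_norm_square[symmetric])
  have form: "C f \<bullet> g = W f \<bullet> W g - m\<^sup>2 * (f \<bullet> g)" for f g
  proof -
    have sc: "scaleC z f \<bullet> scaleC z g = f \<bullet> g" for f g
      by (rule inner_preserving) (simp_all add: scaleC_add z)
    have 1: "U f \<bullet> U g = f \<bullet> g" for f g
      by (rule inner_preserving) (simp_all add: U_add U_norm)
    have 2: "U f \<bullet> scaleC z g = scaleC (cnj z) (U f) \<bullet> g"
      using sc[of "scaleC (cnj z) (U f)" g] by (simp add: scaleC_scaleC zz scaleC_one)
    have 3: "scaleC z f \<bullet> U g = scaleC z (U' f) \<bullet> g"
      using 1[of "scaleC z (U' f)" g] by (simp add: U_scaleC UU')
    show ?thesis
      by (simp add: W_def C_def inner_diff_left inner_diff_right sc 1 2 3 algebra_simps)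
  qed
  have C_small: "(norm (C f))\<^sup>2 \<le> 4 * ((norm (W f))\<^sup>2 - m\<^sup>2 * (norm f)\<^sup>2)" for f
  proof -
    \<comment> \<open>Positivity is tested on a gradient step. Since the form of \<open>C\<close> is
      at most 4 times the squared norm, the step length 1/4 is optimal and yields the Cauchy-Schwarz
      bound of \<open>C f\<close> by its quadratic form, with factor 4.\<close>
    define g where "g = f - (1 / 4) *\<^sub>R C f"
    have Wg: "W g = W f - (1 / 4) *\<^sub>R W (C f)"
      using W_add[of g "(1 / 4) *\<^sub>R C f"] by (simp add: g_def W_scaleR)
    have "(m * norm g)\<^sup>2 \<le> (norm (W g))\<^sup>2" using mW m0 by (intro power_mono) auto
    then have "0 \<le> W g \<bullet> W g - m\<^sup>2 * (g \<bullet> g)"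
      by (simp add: power_mult_distrib power2_norm_eq_inner)
    also have "\<dots> = (W f \<bullet> W f - m\<^sup>2 * (f \<bullet> f)) - 1 / 2 * (W f \<bullet> W (C f) - m\<^sup>2 * (f \<bullet> C f))
        + 1 / 16 * (W (C f) \<bullet> W (C f) - m\<^sup>2 * (C f \<bullet> C f))"
      unfolding Wg by (simp add: g_def inner_diff_left inner_diff_right inner_commute algebra_simps)
    also have "W f \<bullet> W (C f) - m\<^sup>2 * (f \<bullet> C f) = (norm (C f))\<^sup>2"
      by (simp add: form[symmetric] power2_norm_eq_inner)
    also have "W (C f) \<bullet> W (C f) - m\<^sup>2 * (C f \<bullet> C f) \<le> 4 * (norm (C f))\<^sup>2"
    proof -
      have "(norm (W (C f)))\<^sup>2 \<le> (2 * norm (C f))\<^sup>2" by (intro power_mono W_le) simp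
      then have "W (C f) \<bullet> W (C f) \<le> 4 * (norm (C f))\<^sup>2"
        by (simp add: power2_norm_eq_inner power_mult_distrib)
      moreover have "0 \<le> m\<^sup>2 * (C f \<bullet> C f)" by simp
      ultimately show ?thesis by linarith
    qed
    finally show ?thesis by (simp add: power2_norm_eq_inner)
  qed
  \<comment> \<open>The cosine of the angle subtended by a chord of length \<open>m\<close> of the
    unit circle, from \<open>m\<^sup>2 = 2 - 2 * c\<close>.\<close>
  define c where "c = 1 - m\<^sup>2 / 2"
  have "m\<^sup>2 \<le> 4" using power_mono[OF m2 m0, of 2] by simp
  then have c: "c\<^sup>2 \<le> 1" unfolding abs_square_le_1 by (auto simp: c_def abs_le_iff)
  define s where "s = sqrt (1 - c\<^sup>2)"
  have cs: "c\<^sup>2 + s\<^sup>2 = 1" using c by (simp add: s_def)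
  have dist_m: "cmod (z * Complex c t - z) = m" if "t\<^sup>2 = s\<^sup>2" for t
  proof -
    have "z * Complex c t - z = z * Complex (c - 1) t"
      by (simp add: complex_eq_iff algebra_simps)
    then have "(cmod (z * Complex c t - z))\<^sup>2 = (c - 1)\<^sup>2 + t\<^sup>2"
      by (simp add: norm_mult z cmod_power2)
    also have "\<dots> = m\<^sup>2" using cs that by (simp add: c_def power2_eq_square algebra_simps)
    finally show ?thesis using m0 by simp
  qed
  define w1 w2 where "w1 = z * Complex c s" and "w2 = z * Complex c (- s)"
  have "w1 + w2 = of_real (2 * c) * z"
    by (simp add: w1_def w2_def complex_eq_iff algebra_simps)
  moreover have "w1 * w2 = z * z * of_real (c\<^sup>2 + s\<^sup>2)"
    by (simp add: w1_def w2_def complex_eq_iff algebra_simps power2_eq_square)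
  ultimately have w: "w1 + w2 = of_real (2 - m\<^sup>2) * z" "w1 * w2 = z * z"
    unfolding cs by (simp_all add: c_def)
  have factor: "U (U f - scaleC w2 f) - scaleC w1 (U f - scaleC w2 f) = scaleC (- z) (U (C f))" for f
  proof -
    have UC: "U (C f) = scaleC (of_real (2 - m\<^sup>2)) (U f) - scaleC (cnj z) (U (U f)) - scaleC z f"
      unfolding C_def by (simp only: scaleC_of_real[symmetric] U_diff U_scaleC UU')
    have "U (U f - scaleC w2 f) - scaleC w1 (U f - scaleC w2 f)
        = U (U f) - scaleC (w1 + w2) (U f) + scaleC (w1 * w2) f"
      by (simp add: U_diff U_scaleC scaleC_diff scaleC_add_left scaleC_scaleC algebra_simps)
    also have "\<dots> = U (U f) - scaleC (of_real (2 - m\<^sup>2) * z) (U f) + scaleC (z * z) f"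
      by (simp only: w)
    also have "\<dots> = scaleC (z * cnj z) (U (U f)) - scaleC (of_real (2 - m\<^sup>2) * z) (U f) + scaleC (z * z) f"
      by (simp only: zz scaleC_one)
    also have "\<dots> = scaleC (- z) (U (C f))"
      unfolding UC by (rule l2_eqI) (simp add: algebra_simps)
    finally show ?thesis .
  qed
  have "w1 \<in> l2_spectrum U \<or> w2 \<in> l2_spectrum U"
  proof (rule ccontr)
    assume "\<not> ?thesis"
    then obtain m1 m2 where m12: "0 < m1" "0 < m2" "below_by U w1 m1" "below_by U w2 m2"
      by (auto simp: l2_spectrum_def)
    have C_ge: "m1 * m2 \<le> norm (C f)" if "norm f = 1" for f
    proof -
      have "m1 * (m2 * norm f) \<le> m1 * norm (U f - scaleC w2 f)"
        using m12 by (intro mult_left_mono) (auto simp: below_by_def)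
      also have "\<dots> \<le> norm (scaleC (- z) (U (C f)))"
        using m12(3) unfolding below_by_def factor[symmetric] by blast
      finally show ?thesis by (simp add: U_norm z that)
    qed
    \<comment> \<open>With this choice \<open>C_small\<close> gives less than \<open>4 * e\<close>,
      half of the squared lower bound for \<open>C f\<close>.\<close>
    define e where "e = (m1 * m2)\<^sup>2 / 8"
    have "e > 0" using m12 by (simp add: e_def)
    have "m < sqrt (m\<^sup>2 + e)" using m0 \<open>e > 0\<close> by (intro real_less_rsqrt) simp
    then obtain f where f: "norm f = 1" "norm (W f) < sqrt (m\<^sup>2 + e)"
      using cINF_less_iff[OF ne bdd] by (auto simp: m_def)
    have "(norm (W f))\<^sup>2 < (sqrt (m\<^sup>2 + e))\<^sup>2"
      using f(2) by (intro power_strict_mono) auto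
    then have "(norm (W f))\<^sup>2 < m\<^sup>2 + e" using \<open>e > 0\<close> by simp
    then have "(norm (C f))\<^sup>2 < 4 * e"
      using C_small[of f] f(1) by simp
    moreover have "(m1 * m2)\<^sup>2 \<le> (norm (C f))\<^sup>2"
      using C_ge[OF f(1)] m12 by (intro power_mono) auto
    ultimately show False
      using zero_le_power2[of "norm (C f)"] unfolding e_def by linarith
  qed
  moreover have "cmod (w1 - z) = m" "cmod (w2 - z) = m"
    unfolding w1_def w2_def by (rule dist_m, simp)+
  moreover have "below_by U z m" using mW by (simp add: below_by_def W_def)
  ultimately show ?thesis by metis
qed

lemma l2_spectrum_nonempty: "l2_spectrum U \<noteq> {}"
  using below_by_dist_spectrum[of 1] by auto

end

text \<open>The lower bound of \<open>V - z\<close> is the distance to a point \<open>w\<close> of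
  the spectrum of \<open>V\<close>. If that distance exceeded \<open>d\<close>, a positive lower
  bound would survive the passage to \<open>U\<close>. Applied in both directions this is continuity
  in the Hausdorff distance.\<close>

lemma l2_spectrum_perturbation:
  assumes U: "unitary_l2 U" and V: "unitary_l2 V"
    and d: "\<And>f. norm (U f - V f) \<le> d * norm f" and z: "z \<in> l2_spectrum U"
  shows "\<exists>w\<in>l2_spectrum V. cmod (w - z) \<le> d"
proof (rule ccontr)
  assume far: "\<not> ?thesis"
  have "cmod z = 1" using l2_spectrum_subset_circle[OF U] z by auto
  then obtain w where w: "w \<in> l2_spectrum V" "below_by V z (cmod (w - z))"
    using below_by_dist_spectrum[OF V] by blast
  have "below_by U z (cmod (w - z) - d)"
    unfolding below_by_def
  proof
    fix f
    have "cmod (w - z) * norm f \<le> norm (V f - scaleC z f)" using w(2) by (simp add: below_by_def)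
    also have "V f - scaleC z f = (U f - scaleC z f) - (U f - V f)" by simp
    also have "norm \<dots> \<le> norm (U f - scaleC z f) + d * norm f"
      using norm_triangle_ineq4 d by (meson add_left_mono order_trans)
    finally show "(cmod (w - z) - d) * norm f \<le> norm (U f - scaleC z f)"
      by (simp add: algebra_simps)
  qed
  moreover have "0 < cmod (w - z) - d" using far w(1) by force
  ultimately show False using z by (auto simp: l2_spectrum_def)
qed

lemma closed_l2_spectrum: "closed (l2_spectrum U)"
  unfolding closed_def open_dist
proof (intro ballI)
  fix z assume "z \<in> - l2_spectrum U"
  then obtain m where m: "0 < m" "below_by U z m" by (auto simp: l2_spectrum_def)
  have "w \<in> - l2_spectrum U" if "dist w z < m" for w
  proof -
    have "below_by U w (m - cmod (w - z))"
      unfolding below_by_def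
    proof
      fix f
      have "m * norm f \<le> norm (U f - scaleC z f)" using m(2) by (simp add: below_by_def)
      also have "U f - scaleC z f = (U f - scaleC w f) + scaleC (w - z) f"
        by (simp add: scaleC_diff_left)
      also have "norm \<dots> \<le> norm (U f - scaleC w f) + cmod (w - z) * norm f"
        by (metis norm_scaleC norm_triangle_ineq)
      finally show "(m - cmod (w - z)) * norm f \<le> norm (U f - scaleC w f)"
        by (simp add: algebra_simps)
    qed
    moreover have "0 < m - cmod (w - z)" using that by (simp add: dist_norm)
    ultimately show ?thesis unfolding l2_spectrum_def by blast
  qed
  then show "\<exists>e>0. \<forall>w. dist w z < e \<longrightarrow> w \<in> - l2_spectrum U" using m(1) by blast
qed

text \<open>A bounded inverse gives a lower bound; conversely a lower bound gives injectivity, by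
  \<open>surj_if_below_by\<close> also surjectivity, and it bounds the inverse by
  \<open>1 / m\<close>.\<close>

lemma ell2_spectrum_eq_l2_spectrum:
  assumes U: "unitary_l2 U" and T: "\<And>f. seq (U f) = T (seq f)"
  shows "ell2_spectrum T = l2_spectrum U"
proof -
  define W where "W z f = U f - scaleC z f" for z f
  have W: "seq (W z f) = (\<lambda>n. T (seq f) n - z * seq f n)" for z f
    by (simp add: W_def T fun_eq_iff)
  have "(\<exists>S. ell2_bounded_op S \<and> (\<forall>f\<in>ell2. S (\<lambda>n. T f n - z * f n) = f) \<and>
      (\<forall>f\<in>ell2. (\<lambda>n. T (S f) n - z * S f n) = f)) \<longleftrightarrow> (\<exists>m>0. below_by U z m)" (is "?L \<longleftrightarrow> ?R") for z
  proof
    assume ?L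
    then obtain S C where S: "\<forall>f\<in>ell2. S (\<lambda>n. T f n - z * f n) = f"
      and C: "\<forall>f\<in>ell2. ell2_norm (S f) \<le> C * ell2_norm f"
      by (auto simp: ell2_bounded_op_def)
    \<comment> \<open>The bound \<open>C\<close> carries no sign information;
      \<open>\<bar>C\<bar> + 1\<close> is positive and may be divided by.\<close>
    have "norm f \<le> (\<bar>C\<bar> + 1) * norm (W z f)" for f
    proof -
      have "norm f \<le> C * norm (W z f)"
        using S[rule_format, of "seq f"] C[rule_format, of "seq (W z f)"]
        by (simp add: norm_l2_eq_ell2_norm W seq flip: W)
      also have "\<dots> \<le> (\<bar>C\<bar> + 1) * norm (W z f)" by (intro mult_right_mono) auto
      finally show ?thesis .
    qed
    then have "below_by U z (1 / (\<bar>C\<bar> + 1))"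
      by (auto simp: below_by_def W_def field_simps)
    then show ?R by (intro exI[of _ "1 / (\<bar>C\<bar> + 1)"]) (auto simp: add_nonneg_pos)
  next
    assume ?R
    then obtain m where m: "0 < m" "below_by U z m" by blast
    have W_add: "W z (f + g) = W z f + W z g" for f g
      by (simp add: W_def U_add[OF U] scaleC_add)
    have W_scale: "W z (scaleC c f) = scaleC c (W z f)" for c f
      by (simp add: W_def U_scaleC[OF U] scaleC_diff scaleC_scaleC mult.commute)
    have below: "m * norm f \<le> norm (W z f)" for f using m(2) by (simp add: below_by_def W_def)
    have "inj (W z)"
    proof (rule injI)
      fix f g assume "W z f = W z g"
      then have "W z (f - g) = 0" using W_add[of "f - g" g] by simp
      then have "norm (f - g) \<le> 0" using below[of "f - g"] m(1) by (simp add: mult_le_0_iff)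
      then show "f = g" by simp
    qed
    moreover have "surj (W z)"
      using surj_if_below_by[OF U m(2,1)] by (simp add: W_def)
    ultimately have W_inv: "W z (inv (W z) f) = f" "inv (W z) (W z f) = f" for f
      by (simp_all add: surj_f_inv_f)
    define S where "S f = seq (inv (W z) (Abs_l2 f))" for f
    have S_seq: "S (seq f) = seq (inv (W z) f)" for f by (simp add: S_def seq_inverse)
    have inv_add: "inv (W z) (f + g) = inv (W z) f + inv (W z) g" for f g
      by (metis W_add W_inv)
    have inv_scale: "inv (W z) (scaleC c f) = scaleC c (inv (W z) f)" for c f
      by (metis W_scale W_inv)
    have ell2_seq: "(\<forall>f\<in>ell2. P f) \<longleftrightarrow> (\<forall>f. P (seq f))" for P
      by (metis Abs_l2_inverse seq)
    have "ell2_bounded_op S"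
      unfolding ell2_bounded_op_def ell2_seq
    proof (intro conjI allI)
      fix f g c
      show "S (seq f) \<in> ell2" by (simp add: S_def seq)
      show "S (\<lambda>n. seq f n + seq g n) = (\<lambda>n. S (seq f) n + S (seq g) n)"
        using inv_add[of f g] by (simp add: S_seq flip: plus_l2.rep_eq)
      show "S (\<lambda>n. c * seq f n) = (\<lambda>n. c * S (seq f) n)"
        using inv_scale[of c f] by (simp add: S_seq flip: scaleC.rep_eq)
      show "\<exists>C. \<forall>f. ell2_norm (S (seq f)) \<le> C * ell2_norm (seq f)"
      proof (intro exI allI)
        fix f
        show "ell2_norm (S (seq f)) \<le> 1 / m * ell2_norm (seq f)"
          using below[of "inv (W z) f"] m(1)
          by (simp add: S_seq W_inv field_simps flip: norm_l2_eq_ell2_norm)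
      qed
    qed
    moreover have "\<forall>f\<in>ell2. S (\<lambda>n. T f n - z * f n) = f"
      unfolding ell2_seq by (simp add: S_seq W_inv flip: W)
    moreover have "\<forall>f\<in>ell2. (\<lambda>n. T (S f) n - z * S f n) = f"
      unfolding ell2_seq by (simp add: S_seq W_inv flip: W)
    ultimately show ?L by blast
  qed
  then show ?thesis by (simp add: ell2_spectrum_def l2_spectrum_def)
qed

subsection \<open>CMV operators are unitary\<close>

text \<open>The direct sum of the blocks \<open>((cnj (\<alpha> n), \<rho> n), (\<rho> n, - \<alpha> n))\<close> acting on the coordinates
  \<open>n\<close>, \<open>n + 1\<close> with \<open>n\<close> of the parity of \<open>e\<close>.\<close>

definition theta :: "int \<Rightarrow> (int \<Rightarrow> complex) \<Rightarrow> (int \<Rightarrow> complex) \<Rightarrow> (int \<Rightarrow> complex)" where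
  "theta e \<alpha> f n =
     (if even (n - e) then cnj (\<alpha> n) * f n + of_real (cmv_rho \<alpha> n) * f (n + 1)
      else of_real (cmv_rho \<alpha> (n - 1)) * f (n - 1) - \<alpha> (n - 1) * f n)"

text \<open>The factorization of an extended CMV matrix into two block-diagonal unitaries, one
  pairing the sites \<open>2k, 2k+1\<close>, the other \<open>2k-1, 2k\<close>. From here on only
  the factors are used.\<close>

lemma cmv_op_eq_theta: "cmv_op \<alpha> f = theta 0 \<alpha> (theta 1 \<alpha> f)"
proof
  fix n
  consider k :: int where "n = 2 * k" | k :: int where "n = 2 * k + 1" by (meson evenE oddE)
  then show "cmv_op \<alpha> f n = theta 0 \<alpha> (theta 1 \<alpha> f) n"
  proof cases
    case 1
    have "even (2 * k + 1 - 1)" "odd (2 * k - 1)" by simp_all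
    then show ?thesis
      unfolding 1 cmv_op_even
      by (simp add: theta_def cmv_a_def cmv_b_def cmv_d_def algebra_simps)
  next
    case 2
    show ?thesis
      unfolding 2 cmv_op_odd
      by (simp add: theta_def cmv_a_def cmv_c_def cmv_d_def algebra_simps)
  qed
qed

definition in_disk :: "(int \<Rightarrow> complex) \<Rightarrow> bool" where
  "in_disk \<alpha> \<longleftrightarrow> (\<forall>n. cmod (\<alpha> n) < 1)"

lemma cmv_rho_squared:
  assumes "in_disk \<alpha>" shows "(cmv_rho \<alpha> n)\<^sup>2 = 1 - (cmod (\<alpha> n))\<^sup>2"
proof -
  have "cmod (\<alpha> n) < 1" using assms by (auto simp: in_disk_def)
  then have "(cmod (\<alpha> n))\<^sup>2 \<le> 1" by (simp add: abs_square_le_1)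
  then show ?thesis by (simp add: cmv_rho_def)
qed

lemma cmv_rho_pos: "in_disk \<alpha> \<Longrightarrow> 0 < cmv_rho \<alpha> n"
  using abs_square_less_1[of "cmod (\<alpha> n)"] by (simp add: cmv_rho_def in_disk_def)

lemma cmv_rho_le_1: "in_disk \<alpha> \<Longrightarrow> cmv_rho \<alpha> n \<le> 1"
  by (simp add: cmv_rho_def)

text \<open>The factor \<open>1 *\<close> matches the shape that
  \<open>ell2_dominated_by_shifts\<close> expects.\<close>

lemma theta_le:
  assumes "in_disk \<alpha>"
  shows "cmod (theta e \<alpha> f n) \<le> 1 * (\<Sum>i\<in>{-1, 0, 1}. cmod (f (n + i)))"
proof -
  have "cmod (cnj (\<alpha> n) * f n) \<le> cmod (f n)" "cmod (\<alpha> (n - 1) * f n) \<le> cmod (f n)"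
    using assms by (simp_all add: norm_mult in_disk_def less_imp_le mult_left_le_one_le)
  moreover have "cmod (of_real (cmv_rho \<alpha> m) * x) \<le> cmod x" for m x
    using cmv_rho_le_1[OF assms, of m] cmv_rho_pos[OF assms, of m]
    by (simp add: norm_mult mult_left_le_one_le)
  ultimately have
    "cmod (cnj (\<alpha> n) * f n + of_real (cmv_rho \<alpha> n) * f (n + 1)) \<le> cmod (f n) + cmod (f (n + 1))"
    "cmod (of_real (cmv_rho \<alpha> (n - 1)) * f (n - 1) - \<alpha> (n - 1) * f n) \<le> cmod (f (n - 1)) + cmod (f n)"
    by (meson add_mono norm_triangle_le norm_triangle_le_diff)+
  moreover have "0 \<le> cmod (f (n - 1))" "0 \<le> cmod (f (n + 1))" by simp_all
  moreover have "1 * (\<Sum>i\<in>{-1, 0, 1}. cmod (f (n + i))) = cmod (f (n - 1)) + cmod (f n) + cmod (f (n + 1))"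
    by simp
  ultimately show ?thesis
    unfolding theta_def by (cases "even (n - e)"; simp only: if_True if_False; linarith)
qed

lemma theta_ell2: "in_disk \<alpha> \<Longrightarrow> f \<in> ell2 \<Longrightarrow> theta e \<alpha> f \<in> ell2"
  using ell2_dominated_by_shifts(1)[of "{-1, 0, 1}" 1 "theta e \<alpha> f" "Abs_l2 f"] theta_le
  by (simp add: Abs_l2_inverse)

text \<open>Groups the sites into the pairs on which \<open>theta e\<close> acts, so that norm
  preservation of each block can be summed.\<close>

lemma infsum_pairs:
  fixes h :: "int \<Rightarrow> real"
  assumes h: "h summable_on UNIV"
  shows "infsum h UNIV = (\<Sum>\<^sub>\<infinity>n\<in>{n. even (n - e)}. h n + h (n + 1))"
proof -
  have s: "h summable_on A" for A using h by (rule summable_on_subset) simp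
  have bij: "bij_betw (\<lambda>n. n + 1) {n. even (n - e)} {n. odd (n - e)}"
    by (rule bij_betwI[where g = "\<lambda>n. n - 1"]) auto
  have "infsum h UNIV = infsum h {n. even (n - e)} + infsum h {n. odd (n - e)}"
    by (subst infsum_Un_disjoint[symmetric]) (auto intro: s arg_cong[where f = "infsum h"])
  also have "infsum h {n. odd (n - e)} = (\<Sum>\<^sub>\<infinity>n\<in>{n. even (n - e)}. h (n + 1))"
    by (rule infsum_reindex_bij_betw[OF bij, symmetric])
  also have "infsum h {n. even (n - e)} + \<dots> = (\<Sum>\<^sub>\<infinity>n\<in>{n. even (n - e)}. h n + h (n + 1))"
    by (rule infsum_add[symmetric])
       (use s summable_on_reindex_bij_betw[OF bij, of h] in auto)
  finally show ?thesis .
qed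

lemma theta_norm:
  assumes "in_disk \<alpha>" "f \<in> ell2"
  shows "ell2_norm (theta e \<alpha> f) = ell2_norm f"
proof -
  have pair: "(cmod (theta e \<alpha> f n))\<^sup>2 + (cmod (theta e \<alpha> f (n + 1)))\<^sup>2 = (cmod (f n))\<^sup>2 + (cmod (f (n + 1)))\<^sup>2"
    if "even (n - e)" for n
  proof -
    define x y a r where "x = f n" and "y = f (n + 1)" and "a = \<alpha> n" and "r = cmv_rho \<alpha> n"
    have "odd (n + 1 - e)" using that by (simp add: algebra_simps)
    then have "theta e \<alpha> f n = cnj a * x + of_real r * y" "theta e \<alpha> f (n + 1) = of_real r * x - a * y"
      using that by (simp_all add: theta_def x_def y_def a_def r_def)
    moreover have "r\<^sup>2 = 1 - (Re a)\<^sup>2 - (Im a)\<^sup>2"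
      using cmv_rho_squared[OF assms(1)] by (simp add: r_def a_def cmod_power2)
    then have "(cmod (cnj a * x + of_real r * y))\<^sup>2 + (cmod (of_real r * x - a * y))\<^sup>2 = (cmod x)\<^sup>2 + (cmod y)\<^sup>2"
      unfolding cmod_power2 by simp algebra
    ultimately show ?thesis by (simp add: x_def y_def)
  qed
  have "(\<Sum>\<^sub>\<infinity>n. (cmod (theta e \<alpha> f n))\<^sup>2) = (\<Sum>\<^sub>\<infinity>n. (cmod (f n))\<^sup>2)"
    using theta_ell2[OF assms, of e] assms(2)
    by (auto simp: infsum_pairs[of _ e] ell2_def pair intro!: infsum_cong)
  then show ?thesis by (simp add: ell2_norm_def)
qed

text \<open>Each block is a symmetric unitary matrix, hence its inverse is its entrywise conjugate,
  which is the block of the conjugated coefficient.\<close>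

lemma theta_inverse:
  assumes "in_disk \<alpha>"
  shows "theta e \<alpha> (theta e (\<lambda>n. cnj (\<alpha> n)) f) = f"
proof
  fix n
  have r: "of_real (cmv_rho \<alpha> n) * of_real (cmv_rho \<alpha> n) = 1 - \<alpha> n * cnj (\<alpha> n)" for n
    using cmv_rho_squared[OF assms, of n]
    by (simp add: complex_norm_square[symmetric] power2_eq_square[symmetric] flip: of_real_power)
  have [simp]: "cmv_rho (\<lambda>n. cnj (\<alpha> n)) m = cmv_rho \<alpha> m" for m by (simp add: cmv_rho_def)
  show "theta e \<alpha> (theta e (\<lambda>n. cnj (\<alpha> n)) f) n = f n"
  proof (cases "even (n - e)")
    case True
    then have "odd (n + 1 - e)" by (simp add: algebra_simps)
    with True have "theta e \<alpha> (theta e (\<lambda>n. cnj (\<alpha> n)) f) n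
      = (\<alpha> n * cnj (\<alpha> n) + of_real (cmv_rho \<alpha> n) * of_real (cmv_rho \<alpha> n)) * f n"
      by (simp add: theta_def algebra_simps)
    then show ?thesis by (simp add: r)
  next
    case False
    then have "even (n - 1 - e)" by (simp add: algebra_simps)
    with False have "theta e \<alpha> (theta e (\<lambda>n. cnj (\<alpha> n)) f) n
      = (\<alpha> (n - 1) * cnj (\<alpha> (n - 1)) + of_real (cmv_rho \<alpha> (n - 1)) * of_real (cmv_rho \<alpha> (n - 1))) * f n"
      by (simp add: theta_def algebra_simps)
    then show ?thesis by (simp add: r)
  qed
qed

definition theta_l2 :: "int \<Rightarrow> (int \<Rightarrow> complex) \<Rightarrow> l2 \<Rightarrow> l2" where
  "theta_l2 e \<alpha> f = Abs_l2 (theta e \<alpha> (seq f))"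

lemma seq_theta_l2: "in_disk \<alpha> \<Longrightarrow> seq (theta_l2 e \<alpha> f) = theta e \<alpha> (seq f)"
  by (simp add: theta_l2_def Abs_l2_inverse theta_ell2 seq)

lemma in_disk_cnj: "in_disk \<alpha> \<Longrightarrow> in_disk (\<lambda>n. cnj (\<alpha> n))"
  by (simp add: in_disk_def)

lemma unitary_theta_l2:
  assumes "in_disk \<alpha>" shows "unitary_l2 (theta_l2 e \<alpha>)"
  unfolding unitary_l2_def
proof (intro conjI allI)
  show "theta_l2 e \<alpha> (f + g) = theta_l2 e \<alpha> f + theta_l2 e \<alpha> g" for f g
    by (rule l2_eqI) (simp add: seq_theta_l2 assms, simp add: theta_def algebra_simps)
  show "theta_l2 e \<alpha> (scaleC c f) = scaleC c (theta_l2 e \<alpha> f)" for c f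
    by (rule l2_eqI) (simp add: seq_theta_l2 assms, simp add: theta_def algebra_simps)
  show "norm (theta_l2 e \<alpha> f) = norm f" for f
    by (simp add: norm_l2_eq_ell2_norm seq_theta_l2 assms theta_norm seq)
  have "theta_l2 e \<alpha> (theta_l2 e (\<lambda>n. cnj (\<alpha> n)) f) = f" for f
    by (rule l2_eqI) (simp add: seq_theta_l2 assms in_disk_cnj theta_inverse)
  then show "surj (theta_l2 e \<alpha>)" by (rule surjI)
qed

definition cmv_l2 :: "(int \<Rightarrow> complex) \<Rightarrow> l2 \<Rightarrow> l2" where
  "cmv_l2 \<alpha> f = theta_l2 0 \<alpha> (theta_l2 1 \<alpha> f)"

lemma unitary_cmv_l2: "in_disk \<alpha> \<Longrightarrow> unitary_l2 (cmv_l2 \<alpha>)"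
  using unitary_theta_l2[of \<alpha> 0] unitary_theta_l2[of \<alpha> 1]
  by (auto simp: unitary_l2_def cmv_l2_def surj_def) metis

lemma seq_cmv_l2: "in_disk \<alpha> \<Longrightarrow> seq (cmv_l2 \<alpha> f) = cmv_op \<alpha> (seq f)"
  by (simp add: cmv_l2_def cmv_op_eq_theta seq_theta_l2)

lemma ell2_spectrum_cmv: "in_disk \<alpha> \<Longrightarrow> ell2_spectrum (cmv_op \<alpha>) = l2_spectrum (cmv_l2 \<alpha>)"
  by (rule ell2_spectrum_eq_l2_spectrum[OF unitary_cmv_l2 seq_cmv_l2])

abbreviation cmv_spectrum :: "(int \<Rightarrow> complex) \<Rightarrow> complex set" where
  "cmv_spectrum \<alpha> \<equiv> ell2_spectrum (cmv_op \<alpha>)"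

lemma cmv_spectrum_subset_circle: "in_disk \<alpha> \<Longrightarrow> cmv_spectrum \<alpha> \<subseteq> sphere 0 1"
  and cmv_spectrum_nonempty: "in_disk \<alpha> \<Longrightarrow> cmv_spectrum \<alpha> \<noteq> {}"
  and closed_cmv_spectrum: "in_disk \<alpha> \<Longrightarrow> closed (cmv_spectrum \<alpha>)"
  using l2_spectrum_subset_circle l2_spectrum_nonempty closed_l2_spectrum unitary_cmv_l2
  by (simp_all add: ell2_spectrum_cmv)

section \<open>Dependence of the spectrum on the coefficients\<close>

lemma in_diskI: "(\<And>n. cmod (\<alpha> n) \<le> r) \<Longrightarrow> r < 1 \<Longrightarrow> in_disk \<alpha>"
  unfolding in_disk_def by (meson le_less_trans)

lemma cmv_rho_ge:
  assumes "\<And>n. cmod (\<alpha> n) \<le> r"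
  shows "sqrt (1 - r\<^sup>2) \<le> cmv_rho \<alpha> n"
  using assms unfolding cmv_rho_def by (auto intro!: power_mono)

text \<open>The difference of the squares of the two \<open>cmv_rho\<close> values is a difference
  of squared moduli. Dividing by the sum of the two values costs
  \<open>1 / sqrt (1 - r\<^sup>2)\<close>; here the coefficients must stay away from the unit
  circle.\<close>

lemma cmv_rho_lipschitz:
  assumes r: "r < 1" and \<alpha>: "\<And>n. cmod (\<alpha> n) \<le> r" and \<beta>: "\<And>n. cmod (\<beta> n) \<le> r"
    and d: "\<And>n. cmod (\<alpha> n - \<beta> n) \<le> d"
  shows "\<bar>cmv_rho \<alpha> n - cmv_rho \<beta> n\<bar> \<le> d / sqrt (1 - r\<^sup>2)"
proof -
  have "0 \<le> r" using order_trans[OF norm_ge_zero \<alpha>] .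
  then have R: "0 < sqrt (1 - r\<^sup>2)" using r by (simp add: abs_square_less_1)
  have D: "in_disk \<alpha>" "in_disk \<beta>" using \<alpha> \<beta> r by (auto intro: in_diskI)
  have ge: "sqrt (1 - r\<^sup>2) \<le> cmv_rho \<alpha> n" "sqrt (1 - r\<^sup>2) \<le> cmv_rho \<beta> n"
    using cmv_rho_ge \<alpha> \<beta> by auto
  have "0 \<le> d" using order_trans[OF norm_ge_zero d] .
  have "(cmv_rho \<alpha> n - cmv_rho \<beta> n) * (cmv_rho \<alpha> n + cmv_rho \<beta> n)
      = (cmod (\<beta> n) - cmod (\<alpha> n)) * (cmod (\<beta> n) + cmod (\<alpha> n))"
    using cmv_rho_squared[OF D(1), of n] cmv_rho_squared[OF D(2), of n]
    by (simp add: power2_eq_square algebra_simps)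
  then have "\<bar>(cmv_rho \<alpha> n - cmv_rho \<beta> n) * (cmv_rho \<alpha> n + cmv_rho \<beta> n)\<bar>
      = \<bar>(cmod (\<beta> n) - cmod (\<alpha> n)) * (cmod (\<beta> n) + cmod (\<alpha> n))\<bar>"
    by (rule arg_cong)
  moreover have "\<bar>cmv_rho \<alpha> n + cmv_rho \<beta> n\<bar> = cmv_rho \<alpha> n + cmv_rho \<beta> n"
    "\<bar>cmod (\<beta> n) + cmod (\<alpha> n)\<bar> = cmod (\<beta> n) + cmod (\<alpha> n)"
    using cmv_rho_pos[OF D(1), of n] cmv_rho_pos[OF D(2), of n] by simp_all
  ultimately have "\<bar>cmv_rho \<alpha> n - cmv_rho \<beta> n\<bar> * (cmv_rho \<alpha> n + cmv_rho \<beta> n)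
      = \<bar>cmod (\<beta> n) - cmod (\<alpha> n)\<bar> * (cmod (\<beta> n) + cmod (\<alpha> n))"
    unfolding abs_mult by simp
  also have "\<dots> \<le> d * 2"
  proof (intro mult_mono)
    have "\<bar>cmod (\<beta> n) - cmod (\<alpha> n)\<bar> \<le> cmod (\<beta> n - \<alpha> n)" by (rule norm_triangle_ineq3)
    then show "\<bar>cmod (\<beta> n) - cmod (\<alpha> n)\<bar> \<le> d" using d[of n] by (simp add: norm_minus_commute)
    show "cmod (\<beta> n) + cmod (\<alpha> n) \<le> 2" using \<alpha>[of n] \<beta>[of n] r by linarith
  qed (use \<open>0 \<le> d\<close> in auto)
  finally have "\<bar>cmv_rho \<alpha> n - cmv_rho \<beta> n\<bar> * (cmv_rho \<alpha> n + cmv_rho \<beta> n) \<le> d * 2" .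
  moreover have "\<bar>cmv_rho \<alpha> n - cmv_rho \<beta> n\<bar> * (2 * sqrt (1 - r\<^sup>2))
      \<le> \<bar>cmv_rho \<alpha> n - cmv_rho \<beta> n\<bar> * (cmv_rho \<alpha> n + cmv_rho \<beta> n)"
    using ge by (intro mult_left_mono) auto
  ultimately have "\<bar>cmv_rho \<alpha> n - cmv_rho \<beta> n\<bar> * (2 * sqrt (1 - r\<^sup>2)) \<le> d * 2" by linarith
  then show ?thesis using R by (simp add: pos_le_divide_eq)
qed

text \<open>The factor 3 counts the neighbours \<open>-1, 0, 1\<close> in the domination by
  shifts.\<close>

lemma theta_l2_perturbation:
  assumes r: "r < 1" and \<alpha>: "\<And>n. cmod (\<alpha> n) \<le> r" and \<beta>: "\<And>n. cmod (\<beta> n) \<le> r"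
    and d: "\<And>n. cmod (\<alpha> n - \<beta> n) \<le> d"
  shows "norm (theta_l2 e \<alpha> f - theta_l2 e \<beta> f) \<le> 3 * (d + d / sqrt (1 - r\<^sup>2)) * norm f"
proof -
  define K where "K = d + d / sqrt (1 - r\<^sup>2)"
  have D: "in_disk \<alpha>" "in_disk \<beta>" using \<alpha> \<beta> r by (auto intro: in_diskI)
  have "0 \<le> d" using order_trans[OF norm_ge_zero d] .
  have r': "\<bar>cmv_rho \<alpha> m - cmv_rho \<beta> m\<bar> \<le> d / sqrt (1 - r\<^sup>2)" for m
    by (rule cmv_rho_lipschitz[OF r \<alpha> \<beta> d])
  then have 0: "0 \<le> d / sqrt (1 - r\<^sup>2)" by (meson abs_ge_zero order_trans)
  have K: "d \<le> K" "\<And>m. \<bar>cmv_rho \<alpha> m - cmv_rho \<beta> m\<bar> \<le> K" "0 \<le> K"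
    using \<open>0 \<le> d\<close> 0 r' unfolding K_def by (auto intro: add_increasing)
  let ?g = "theta_l2 e \<alpha> f - theta_l2 e \<beta> f"
  have "ell2_norm (seq ?g) \<le> K * real (card {-1, 0, 1 :: int}) * norm f"
  proof (rule ell2_dominated_by_shifts(2))
    fix n
    have a: "cmod (cnj (\<alpha> n - \<beta> n) * x) \<le> K * cmod x" "cmod ((\<alpha> (n - 1) - \<beta> (n - 1)) * x) \<le> K * cmod x" for x
      using d K(1) unfolding norm_mult complex_mod_cnj by (meson mult_right_mono norm_ge_zero order_trans)+
    have b: "cmod (of_real (cmv_rho \<alpha> m - cmv_rho \<beta> m) * x) \<le> K * cmod x" for m x
      using K(2) unfolding norm_mult norm_of_real by (intro mult_right_mono) auto
    show "cmod (seq ?g n) \<le> K * (\<Sum>i\<in>{-1, 0, 1}. cmod (seq f (n + i)))"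
    proof (cases "even (n - e)")
      case True
      have "seq ?g n = cnj (\<alpha> n - \<beta> n) * seq f n + of_real (cmv_rho \<alpha> n - cmv_rho \<beta> n) * seq f (n + 1)"
        using True by (simp add: seq_theta_l2 D theta_def algebra_simps)
      then have "cmod (seq ?g n) \<le> K * cmod (seq f n) + K * cmod (seq f (n + 1))"
        using a(1) b by (metis (no_types) add_mono norm_triangle_le)
      moreover have "0 \<le> K * cmod (seq f (n - 1))" using K(3) by simp
      ultimately show ?thesis by (simp add: distrib_left)
    next
      case False
      have "seq ?g n = of_real (cmv_rho \<alpha> (n - 1) - cmv_rho \<beta> (n - 1)) * seq f (n - 1)
          - (\<alpha> (n - 1) - \<beta> (n - 1)) * seq f n"
        using False by (simp add: seq_theta_l2 D theta_def algebra_simps)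
      then have "cmod (seq ?g n) \<le> K * cmod (seq f (n - 1)) + K * cmod (seq f n)"
        using a(2) b by (metis (no_types) add_mono norm_triangle_le_diff)
      moreover have "0 \<le> K * cmod (seq f (n + 1))" using K(3) by simp
      ultimately show ?thesis by (simp add: distrib_left)
    qed
  qed (use K in auto)
  then show ?thesis by (simp add: norm_l2_eq_ell2_norm K_def mult.commute mult.left_commute)
qed

text \<open>The constant depends on \<open>r\<close> alone and is obtained before the sequences, so
  tolerances for the spectrum can be converted into tolerances for coefficients not yet
  chosen.\<close>

lemma cmv_spectrum_perturbation:
  assumes "r < 1"
  obtains C where "0 < C"
    and "\<And>\<alpha> \<beta> d z. (\<And>n. cmod (\<alpha> n) \<le> r) \<Longrightarrow> (\<And>n. cmod (\<beta> n) \<le> r) \<Longrightarrow>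
      (\<And>n. cmod (\<alpha> n - \<beta> n) \<le> d) \<Longrightarrow> z \<in> cmv_spectrum \<alpha> \<Longrightarrow> \<exists>w\<in>cmv_spectrum \<beta>. cmod (w - z) \<le> C * d"
proof -
  define R where "R = 1 / sqrt (1 - r\<^sup>2)"
  \<comment> \<open>Telescoping over the two factors of the operator doubles the 3 of
    \<open>theta_l2_perturbation\<close>.\<close>
  define C where "C = 6 * (1 + \<bar>R\<bar>)"
  have *: "\<exists>w\<in>cmv_spectrum \<beta>. cmod (w - z) \<le> C * d"
    if \<alpha>: "\<And>n. cmod (\<alpha> n) \<le> r" and \<beta>: "\<And>n. cmod (\<beta> n) \<le> r"
      and d: "\<And>n. cmod (\<alpha> n - \<beta> n) \<le> d" and z: "z \<in> cmv_spectrum \<alpha>" for \<alpha> \<beta> d z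
  proof -
    have D: "in_disk \<alpha>" "in_disk \<beta>" using \<alpha> \<beta> assms by (auto intro: in_diskI)
    note U = unitary_theta_l2[OF D(1)] unitary_theta_l2[OF D(2)]
    have "0 \<le> d" using order_trans[OF norm_ge_zero d] .
    have d_le: "d + d / sqrt (1 - r\<^sup>2) \<le> d * (1 + \<bar>R\<bar>)"
      using \<open>0 \<le> d\<close> by (simp add: R_def algebra_simps divide_right_mono flip: abs_mult)
         (simp add: divide_inverse mult_left_mono abs_if)
    have *: "norm (theta_l2 e \<alpha> f - theta_l2 e \<beta> f) \<le> 3 * (d * (1 + \<bar>R\<bar>)) * norm f" for e f
      using theta_l2_perturbation[OF assms \<alpha> \<beta> d, where e = e and f = f] d_le
      by (meson mult_left_mono mult_right_mono norm_ge_zero order_trans zero_le_numeral)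
    have "norm (cmv_l2 \<alpha> f - cmv_l2 \<beta> f) \<le> C * d * norm f" for f
    proof -
      have "cmv_l2 \<alpha> f - cmv_l2 \<beta> f = theta_l2 0 \<alpha> (theta_l2 1 \<alpha> f - theta_l2 1 \<beta> f)
          + (theta_l2 0 \<alpha> (theta_l2 1 \<beta> f) - theta_l2 0 \<beta> (theta_l2 1 \<beta> f))"
        by (simp add: cmv_l2_def U_diff[OF U(1)])
      also have "norm \<dots> \<le> 3 * (d * (1 + \<bar>R\<bar>)) * norm f + 3 * (d * (1 + \<bar>R\<bar>)) * norm f"
        using *[of 1 f] *[of 0 "theta_l2 1 \<beta> f"]
        by (intro norm_triangle_le add_mono) (simp_all add: U_norm[OF U(1)] U_norm[OF U(2)])
      finally show ?thesis by (simp add: C_def algebra_simps)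
    qed
    with l2_spectrum_perturbation[OF unitary_cmv_l2[OF D(1)] unitary_cmv_l2[OF D(2)]] z
    show ?thesis by (simp add: ell2_spectrum_cmv D)
  qed
  have "0 < C" by (simp add: C_def)
  then show thesis using * by (rule that)
qed

subsection \<open>Transfer matrices\<close>

text \<open>The pair \<open>(a, b)\<close> stands for the matrix \<open>((a, b), (cnj b, cnj a))\<close>, which is in \<open>SU(1,1)\<close>
  iff \<open>|a|\<^sup>2 - |b|\<^sup>2 = 1\<close>.\<close>

type_synonym mat = "complex \<times> complex"

definition mul :: "mat \<Rightarrow> mat \<Rightarrow> mat" where
  "mul S T = (fst S * fst T + snd S * cnj (snd T), fst S * snd T + snd S * cnj (fst T))"

definition act :: "mat \<Rightarrow> complex \<times> complex \<Rightarrow> complex \<times> complex" where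
  "act T v = (fst T * fst v + snd T * snd v, cnj (snd T) * fst v + cnj (fst T) * snd v)"

text \<open>The adjugate of the encoded matrix, hence its inverse on SU(1,1).\<close>

definition adj :: "mat \<Rightarrow> mat" where
  "adj T = (cnj (fst T), - snd T)"

definition su11 :: "mat \<Rightarrow> bool" where
  "su11 T \<longleftrightarrow> fst T * cnj (fst T) - snd T * cnj (snd T) = 1"

text \<open>Used for vectors and for encoded matrices alike; it is submultiplicative under both
  \<open>act\<close> and \<open>mul\<close>.\<close>

definition nrm :: "complex \<times> complex \<Rightarrow> real" where
  "nrm v = cmod (fst v) + cmod (snd v)"

section \<open>Algebra of encoded matrices\<close>

lemma mul_assoc: "mul (mul R S) T = mul R (mul S T)"
  by (simp add: mul_def algebra_simps)

lemma mul_one [simp]: "mul (1, 0) T = T" "mul T (1, 0) = T"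
  by (simp_all add: mul_def)

lemma act_mul: "act (mul S T) v = act S (act T v)"
  by (simp add: act_def mul_def algebra_simps)

lemma act_one [simp]: "act (1, 0) v = v"
  by (simp add: act_def)

lemma act_diff: "act T (v - w) = act T v - act T w"
  by (simp add: act_def prod_eq_iff algebra_simps)

lemma su11_one [simp]: "su11 (1, 0)"
  by (simp add: su11_def)

lemma su11_mul: "su11 S \<Longrightarrow> su11 T \<Longrightarrow> su11 (mul S T)"
proof -
  assume "su11 S" "su11 T"
  then have "(fst S * cnj (fst S) - snd S * cnj (snd S)) * (fst T * cnj (fst T) - snd T * cnj (snd T)) = 1"
    by (simp add: su11_def)
  then show ?thesis by (simp add: su11_def mul_def algebra_simps)
qed

lemma su11_adj: "su11 T \<Longrightarrow> su11 (adj T)"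
  by (simp add: su11_def adj_def mult.commute)

lemma mul_adj: "su11 T \<Longrightarrow> mul T (adj T) = (1, 0)" "su11 T \<Longrightarrow> mul (adj T) T = (1, 0)"
  by (simp_all add: su11_def adj_def mul_def mult.commute)

lemma Re_trace_commute: "Re (fst (mul S T)) = Re (fst (mul T S))"
  by (simp add: mul_def)

text \<open>Cayley-Hamilton: a matrix plus its adjugate is the trace times the identity, and the
  trace of the encoded matrix is \<open>2 * Re (fst T)\<close>.\<close>

lemma act_plus_act_adj: "act T v + act (adj T) v = (of_real (2 * Re (fst T)) * fst v, of_real (2 * Re (fst T)) * snd v)"
  by (simp add: act_def adj_def prod_eq_iff flip: distrib_right complex_add_cnj)
     (simp add: complex_eq_iff algebra_simps)

lemma nrm_nonneg: "0 \<le> nrm v"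
  by (simp add: nrm_def)

lemma nrm_triangle: "nrm (v + w) \<le> nrm v + nrm w"
  using norm_triangle_ineq[of "fst v" "fst w"] norm_triangle_ineq[of "snd v" "snd w"] by (simp add: nrm_def)

lemma nrm_triangle_diff: "nrm (v - w) \<le> nrm v + nrm w"
  using norm_triangle_ineq4[of "fst v" "fst w"] norm_triangle_ineq4[of "snd v" "snd w"] by (simp add: nrm_def)

lemma nrm_act_le: "nrm (act T v) \<le> nrm T * nrm v"
proof -
  have "cmod (fst T * fst v + snd T * snd v) \<le> cmod (fst T) * cmod (fst v) + cmod (snd T) * cmod (snd v)"
    "cmod (cnj (snd T) * fst v + cnj (fst T) * snd v) \<le> cmod (snd T) * cmod (fst v) + cmod (fst T) * cmod (snd v)"
    by (metis complex_mod_cnj norm_mult norm_triangle_ineq)+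
  then show ?thesis by (simp add: nrm_def act_def algebra_simps)
qed

lemma nrm_mul_le: "nrm (mul S T) \<le> nrm S * nrm T"
proof -
  have "cmod (fst S * fst T + snd S * cnj (snd T)) \<le> cmod (fst S) * cmod (fst T) + cmod (snd S) * cmod (snd T)"
    "cmod (fst S * snd T + snd S * cnj (fst T)) \<le> cmod (fst S) * cmod (snd T) + cmod (snd S) * cmod (fst T)"
    by (metis complex_mod_cnj norm_mult norm_triangle_ineq)+
  then show ?thesis by (simp add: nrm_def mul_def algebra_simps)
qed

lemma nrm_adj [simp]: "nrm (adj T) = nrm T"
  by (simp add: nrm_def adj_def)

text \<open>Up to the order of coordinates, \<open>refl_mat\<close> and \<open>rot_mat\<close> are
  the Gesztesy-Zinchenko transfer matrices, obtained by solving one block of \<open>theta 1\<close>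
  and one block of \<open>theta 0\<close>. The state is \<open>(u, v)\<close> at odd and
  \<open>(v, u)\<close> at even sites; this alternation makes the determinants 1 instead of
  -1.\<close>

definition refl_mat :: "(int \<Rightarrow> complex) \<Rightarrow> int \<Rightarrow> mat" where
  "refl_mat \<alpha> n = (1 / of_real (cmv_rho \<alpha> n), - \<alpha> n / of_real (cmv_rho \<alpha> n))"

definition rot_mat :: "(int \<Rightarrow> complex) \<Rightarrow> real \<Rightarrow> int \<Rightarrow> mat" where
  "rot_mat \<alpha> \<theta> n = (cis (- \<theta>) / of_real (cmv_rho \<alpha> n), - \<alpha> n / of_real (cmv_rho \<alpha> n))"

text \<open>One step advances from site \<open>2k-1\<close> to \<open>2k+1\<close>. A period of
  \<open>2 * q\<close> sites therefore corresponds to \<open>q\<close> steps.\<close>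

definition step_mat :: "(int \<Rightarrow> complex) \<Rightarrow> real \<Rightarrow> int \<Rightarrow> mat" where
  "step_mat \<alpha> \<theta> k = mul (rot_mat \<alpha> \<theta> (2 * k)) (refl_mat \<alpha> (2 * k - 1))"

primrec transfer_mat :: "(int \<Rightarrow> complex) \<Rightarrow> real \<Rightarrow> int \<Rightarrow> nat \<Rightarrow> mat" where
  "transfer_mat \<alpha> \<theta> k 0 = (1, 0)"
| "transfer_mat \<alpha> \<theta> k (Suc n) = mul (step_mat \<alpha> \<theta> (k + int n)) (transfer_mat \<alpha> \<theta> k n)"

lemma rho_sq:
  assumes "in_disk \<alpha>"
  shows "of_real (cmv_rho \<alpha> n) * of_real (cmv_rho \<alpha> n) = 1 - \<alpha> n * cnj (\<alpha> n)"
  using cmv_rho_squared[OF assms, of n]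
  by (simp add: complex_norm_square[symmetric] power2_eq_square[symmetric] flip: of_real_power)

lemma rho_nz: "in_disk \<alpha> \<Longrightarrow> complex_of_real (cmv_rho \<alpha> n) \<noteq> 0"
  using cmv_rho_pos[of \<alpha> n] by simp

lemma su11_divide:
  assumes "in_disk \<alpha>" "x * cnj x = 1"
  shows "su11 (x / of_real (cmv_rho \<alpha> n), - \<alpha> n / of_real (cmv_rho \<alpha> n))"
proof -
  define a r where "a = \<alpha> n" and "r = complex_of_real (cmv_rho \<alpha> n)"
  have r: "r \<noteq> 0" "cnj r = r" "1 - a * cnj a = r * r"
    using rho_nz[OF assms(1)] rho_sq[OF assms(1)] by (simp_all add: r_def a_def)
  have "su11 (x / r, - a / r) \<longleftrightarrow> (x * cnj x - a * cnj a) / (r * r) = 1"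
    by (simp add: su11_def r(2) diff_divide_distrib)
  also have "\<dots>" using r(1) by (simp add: assms(2) r(3))
  finally show ?thesis by (simp add: a_def r_def)
qed

lemma su11_refl_mat: "in_disk \<alpha> \<Longrightarrow> su11 (refl_mat \<alpha> n)"
  using su11_divide[of \<alpha> 1 n] by (simp add: refl_mat_def)

lemma su11_rot_mat: "in_disk \<alpha> \<Longrightarrow> su11 (rot_mat \<alpha> \<theta> n)"
  using su11_divide[of \<alpha> "cis (- \<theta>)" n] by (simp add: rot_mat_def cis_cnj cis_mult)

lemma su11_step_mat: "in_disk \<alpha> \<Longrightarrow> su11 (step_mat \<alpha> \<theta> k)"
  by (simp add: step_mat_def su11_mul su11_refl_mat su11_rot_mat)

lemma su11_transfer_mat: "in_disk \<alpha> \<Longrightarrow> su11 (transfer_mat \<alpha> \<theta> k n)"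
  by (induction n) (simp_all add: su11_mul su11_step_mat)

lemma transfer_mat_add:
  "transfer_mat \<alpha> \<theta> k (m + n) = mul (transfer_mat \<alpha> \<theta> (k + int m) n) (transfer_mat \<alpha> \<theta> k m)"
  by (induction n) (simp_all add: mul_assoc algebra_simps)

text \<open>Each factor has two entries of modulus at most \<open>1 / sqrt (1 - r\<^sup>2)\<close>.
  The resulting constant serves as the growth rate per step in all later estimates.\<close>

lemma nrm_rot_refl_mat_le:
  assumes r: "\<And>n. cmod (\<alpha> n) \<le> r" "r < 1"
  shows "nrm (rot_mat \<alpha> \<theta> m) * nrm (refl_mat \<alpha> n) \<le> 4 / (1 - r\<^sup>2)"
proof -
  have "0 \<le> r" using order_trans[OF norm_ge_zero r(1)] .
  then have R: "0 < sqrt (1 - r\<^sup>2)" using r(2) by (simp add: abs_square_less_1)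
  have D: "in_disk \<alpha>" using r by (rule in_diskI)
  have a: "cmod (x / of_real (cmv_rho \<alpha> n)) \<le> 1 / sqrt (1 - r\<^sup>2)" if "cmod x \<le> 1" for x n
    using cmv_rho_ge[of \<alpha> r n, OF r(1)] R that cmv_rho_pos[OF D, of n]
    by (simp add: norm_divide frac_le)
  have \<alpha>: "cmod (- \<alpha> n) \<le> 1" for n using r(1)[of n] r(2) by simp
  have "nrm (refl_mat \<alpha> n) \<le> 2 / sqrt (1 - r\<^sup>2)" "nrm (rot_mat \<alpha> \<theta> n) \<le> 2 / sqrt (1 - r\<^sup>2)" for n
    using a[of 1 n] a[of "cis (- \<theta>)" n] a[OF \<alpha>, of n n] by (simp_all add: nrm_def refl_mat_def rot_mat_def)
  then have "nrm (rot_mat \<alpha> \<theta> m) * nrm (refl_mat \<alpha> n) \<le> 2 / sqrt (1 - r\<^sup>2) * (2 / sqrt (1 - r\<^sup>2))"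
    using R by (intro mult_mono) (auto simp: nrm_nonneg)
  also have "\<dots> = 4 / (1 - r\<^sup>2)" using R by (simp add: real_sqrt_mult_self)
  finally show ?thesis .
qed

lemma nrm_step_mat_le:
  assumes "\<And>n. cmod (\<alpha> n) \<le> r" "r < 1"
  shows "nrm (step_mat \<alpha> \<theta> k) \<le> 4 / (1 - r\<^sup>2)"
  unfolding step_mat_def
  by (intro order_trans[OF nrm_mul_le] nrm_rot_refl_mat_le assms)

lemma step_mat_const_ge_1:
  fixes r :: real
  assumes "0 \<le> r" "r < 1"
  shows "1 \<le> 4 / (1 - r\<^sup>2)"
proof -
  have "r\<^sup>2 < 1" "0 \<le> r\<^sup>2" using assms by (auto simp: abs_square_less_1)
  then show ?thesis by (simp add: field_simps)
qed

lemma nrm_transfer_mat_le: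
  assumes r: "\<And>n. cmod (\<alpha> n) \<le> r" "r < 1"
  shows "nrm (transfer_mat \<alpha> \<theta> k n) \<le> (4 / (1 - r\<^sup>2)) ^ n"
proof (induction n)
  case 0
  then show ?case by (simp add: nrm_def)
next
  case (Suc n)
  note step = nrm_step_mat_le[of \<alpha> r, OF r]
  have "nrm (transfer_mat \<alpha> \<theta> k (Suc n)) \<le> nrm (step_mat \<alpha> \<theta> (k + int n)) * nrm (transfer_mat \<alpha> \<theta> k n)"
    by (simp add: nrm_mul_le)
  also have "\<dots> \<le> 4 / (1 - r\<^sup>2) * (4 / (1 - r\<^sup>2)) ^ n"
    by (intro mult_mono Suc step nrm_nonneg order_trans[OF nrm_nonneg step])
  finally show ?case by simp
qed

text \<open>With \<open>v = theta 1 \<alpha> u\<close> the equation \<open>cmv_op \<alpha> u = z u + g\<close> splits into two first-order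
  systems, \<open>v = theta 1 \<alpha> u\<close> and \<open>theta 0 \<alpha> v = z u + g\<close>.\<close>

lemma theta_solve:
  assumes "in_disk \<alpha>"
  shows "(theta 1 \<alpha> u (2 * k), u (2 * k)) = act (refl_mat \<alpha> (2 * k - 1)) (u (2 * k - 1), theta 1 \<alpha> u (2 * k - 1))"
proof -
  define x y a r where "x = u (2 * k - 1)" and "y = u (2 * k)" and "a = \<alpha> (2 * k - 1)"
    and "r = complex_of_real (cmv_rho \<alpha> (2 * k - 1))"
  have r: "r \<noteq> 0" "r * r = 1 - a * cnj a" "cnj r = r"
    using rho_nz[OF assms] rho_sq[OF assms] by (simp_all add: r_def a_def)
  have v: "theta 1 \<alpha> u (2 * k - 1) = cnj a * x + r * y" "theta 1 \<alpha> u (2 * k) = r * x - a * y"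
    by (simp_all add: theta_def x_def y_def a_def r_def)
  have "(1 / r) * x + (- a / r) * (cnj a * x + r * y) = (1 - a * cnj a) * x / r - a * y"
    using r(1) by (simp add: field_simps)
  also have "\<dots> = r * x - a * y"
    unfolding r(2)[symmetric] using r(1) by simp
  finally have "r * x - a * y = (1 / r) * x + (- a / r) * (cnj a * x + r * y)" by (rule sym)
  moreover have "y = cnj (- a / r) * x + cnj (1 / r) * (cnj a * x + r * y)"
    using r(1) r(3) by (simp add: field_simps)
  ultimately show ?thesis
    unfolding v act_def refl_mat_def
    by (simp add: x_def[symmetric] y_def[symmetric] a_def[symmetric] r_def[symmetric])
qed

lemma theta_solve_rot:
  assumes "in_disk \<alpha>" and g: "\<And>n. theta 0 \<alpha> v n = cis \<theta> * u n + g n"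
  shows "(u (2 * k + 1), v (2 * k + 1)) = act (rot_mat \<alpha> \<theta> (2 * k)) (v (2 * k), u (2 * k))
    + (cis (- \<theta>) * (- \<alpha> (2 * k) * g (2 * k) / of_real (cmv_rho \<alpha> (2 * k)) - g (2 * k + 1)),
       g (2 * k) / of_real (cmv_rho \<alpha> (2 * k)))"
proof -
  define p q s t a r z where "p = v (2 * k)" and "q = v (2 * k + 1)" and "s = u (2 * k)" and "t = u (2 * k + 1)"
    and "a = \<alpha> (2 * k)" and "r = complex_of_real (cmv_rho \<alpha> (2 * k))" and "z = cis \<theta>"
  define g0 g1 where "g0 = g (2 * k)" and "g1 = g (2 * k + 1)"
  have r: "r \<noteq> 0" "r * r = 1 - a * cnj a" "cnj r = r"
    using rho_nz[OF assms(1)] rho_sq[OF assms(1)] by (simp_all add: r_def a_def)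
  have z: "cis (- \<theta>) = cnj z" "cnj z * z = 1" by (simp_all add: z_def cis_cnj cis_mult)
  have "cnj a * p + r * q = z * s + g0" "r * p - a * q = z * t + g1"
    using g[of "2 * k"] g[of "2 * k + 1"]
    by (simp_all add: theta_def p_def q_def s_def t_def a_def r_def z_def g0_def g1_def)
  then have q: "q = (z * s + g0 - cnj a * p) / r" and zt: "z * t = r * p - a * q - g1"
    using r(1) by (simp_all add: field_simps)
  have "r * p - a * q = ((r * r + a * cnj a) * p - a * z * s - a * g0) / r"
    unfolding q using r(1) by (simp add: field_simps)
  also have "\<dots> = (p - a * z * s - a * g0) / r" by (simp add: r(2))
  finally have "z * t = (p - a * z * s - a * g0) / r - g1" using zt by simp
  then have "cnj z * z * t = cnj z * ((p - a * z * s - a * g0) / r - g1)" by (simp add: mult.assoc)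
  then have "t = cnj z * ((p - a * z * s - a * g0) / r - g1)" by (simp add: z)
  also have "\<dots> = cnj z / r * p + (- a / r) * ((cnj z * z) * s) + cnj z * (- a * g0 / r - g1)"
    by (simp add: diff_divide_distrib add_divide_distrib algebra_simps)
  finally have t: "t = cnj z / r * p + (- a / r) * s + cnj z * (- a * g0 / r - g1)" by (simp add: z)
  have "q = cnj (- a / r) * p + cnj (cnj z / r) * s + g0 / r"
    unfolding q using r(1) r(3) by (simp add: field_simps)
  with t show ?thesis
    unfolding act_def rot_mat_def z
    by (simp add: p_def[symmetric] q_def[symmetric] s_def[symmetric] t_def[symmetric] a_def[symmetric]
        r_def[symmetric] g0_def[symmetric] g1_def[symmetric])
qed

lemma step_equation:
  assumes "in_disk \<alpha>" and g: "\<And>n. cmv_op \<alpha> u n = cis \<theta> * u n + g n"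
  defines "\<psi> \<equiv> \<lambda>k. (u (2 * k - 1), theta 1 \<alpha> u (2 * k - 1))"
  shows "\<psi> (k + 1) = act (step_mat \<alpha> \<theta> k) (\<psi> k)
    + (cis (- \<theta>) * (- \<alpha> (2 * k) * g (2 * k) / of_real (cmv_rho \<alpha> (2 * k)) - g (2 * k + 1)),
       g (2 * k) / of_real (cmv_rho \<alpha> (2 * k)))"
proof -
  have "\<psi> (k + 1) = (u (2 * k + 1), theta 1 \<alpha> u (2 * k + 1))"
    by (simp add: \<psi>_def algebra_simps)
  then show ?thesis
    using theta_solve_rot[OF assms(1), of "theta 1 \<alpha> u" \<theta> u g k] g
    by (simp add: step_mat_def act_mul \<psi>_def theta_solve[OF assms(1), symmetric] cmv_op_eq_theta)
qed

text \<open>Discrete variation of constants. A local error is propagated by at most \<open>n\<close>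
  steps, each expanding by at most \<open>K\<close>; since \<open>1 \<le> K\<close>, the power
  \<open>K ^ n\<close> covers all of them.\<close>

lemma transfer_error:
  assumes err: "\<And>k. nrm (\<psi> (k + 1) - act (step_mat \<alpha> \<theta> k) (\<psi> k)) \<le> e k"
    and K: "\<And>k. nrm (step_mat \<alpha> \<theta> k) \<le> K" "1 \<le> K"
  shows "nrm (\<psi> (k + int n) - act (transfer_mat \<alpha> \<theta> k n) (\<psi> k)) \<le> K ^ n * (\<Sum>i<n. e (k + int i))"
proof (induction n)
  case 0
  then show ?case by (simp add: nrm_def)
next
  case (Suc n)
  have e0: "0 \<le> e k" for k using order_trans[OF nrm_nonneg err] .
  let ?B = "step_mat \<alpha> \<theta> (k + int n)" and ?T = "transfer_mat \<alpha> \<theta> k n"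
  have "\<psi> (k + int (Suc n)) - act (transfer_mat \<alpha> \<theta> k (Suc n)) (\<psi> k)
      = (\<psi> (k + int n + 1) - act ?B (\<psi> (k + int n))) + act ?B (\<psi> (k + int n) - act ?T (\<psi> k))"
    by (simp add: act_mul act_diff algebra_simps)
  also have "nrm \<dots> \<le> e (k + int n) + K * (K ^ n * (\<Sum>i<n. e (k + int i)))"
    using Suc K
    by (intro order_trans[OF nrm_triangle] add_mono err order_trans[OF nrm_act_le] mult_mono nrm_nonneg) auto
  also have "\<dots> \<le> K ^ Suc n * e (k + int n) + K ^ Suc n * (\<Sum>i<n. e (k + int i))"
    using mult_right_mono[OF one_le_power[OF K(2), of "Suc n"] e0[of "k + int n"]] by simp
  finally show ?case by (simp add: algebra_simps)
qed

lemma step_mat_periodic: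
  assumes "\<And>n. \<alpha> (n + 2 * int q) = \<alpha> n"
  shows "step_mat \<alpha> \<theta> (k + int q) = step_mat \<alpha> \<theta> k"
proof -
  have "\<alpha> (2 * (k + int q)) = \<alpha> (2 * k)" "\<alpha> (2 * (k + int q) - 1) = \<alpha> (2 * k - 1)"
    using assms[of "2 * k"] assms[of "2 * k - 1"] by (simp_all add: algebra_simps)
  then show ?thesis by (simp add: step_mat_def rot_mat_def refl_mat_def cmv_rho_def)
qed

lemma transfer_mat_periodic:
  assumes "\<And>n. \<alpha> (n + 2 * int q) = \<alpha> n"
  shows "transfer_mat \<alpha> \<theta> (k + int q) n = transfer_mat \<alpha> \<theta> k n"
proof (induction n)
  case (Suc n)
  have "step_mat \<alpha> \<theta> (k + int q + int n) = step_mat \<alpha> \<theta> (k + int n)"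
    using step_mat_periodic[of \<alpha> q \<theta> "k + int n", OF assms] by (simp add: algebra_simps)
  with Suc show ?case by simp
qed simp

text \<open>Half of the discriminant, so that its critical levels are 1 and -1.\<close>

definition half_trace :: "(int \<Rightarrow> complex) \<Rightarrow> nat \<Rightarrow> real \<Rightarrow> real" where
  "half_trace \<alpha> q \<theta> = Re (fst (transfer_mat \<alpha> \<theta> 0 q))"

text \<open>Moving the base point by one step conjugates the monodromy by that step.\<close>

lemma Re_trace_transfer_mat:
  assumes "in_disk \<alpha>" and per: "\<And>n. \<alpha> (n + 2 * int q) = \<alpha> n"
  shows "Re (fst (transfer_mat \<alpha> \<theta> k q)) = half_trace \<alpha> q \<theta>"
proof -
  have step: "Re (fst (transfer_mat \<alpha> \<theta> (k + 1) q)) = Re (fst (transfer_mat \<alpha> \<theta> k q))" for k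
  proof -
    let ?B = "step_mat \<alpha> \<theta> k"
    have B: "su11 ?B" by (rule su11_step_mat[OF assms(1)])
    have "mul (transfer_mat \<alpha> \<theta> (k + 1) q) ?B = mul ?B (transfer_mat \<alpha> \<theta> k q)"
      using transfer_mat_add[of \<alpha> \<theta> k 1 q] transfer_mat_add[of \<alpha> \<theta> k q 1] step_mat_periodic[of \<alpha> q \<theta> k, OF per]
      by (simp add: add.commute)
    then have "mul (mul (transfer_mat \<alpha> \<theta> (k + 1) q) ?B) (adj ?B) = mul (mul ?B (transfer_mat \<alpha> \<theta> k q)) (adj ?B)"
      by simp
    then have "transfer_mat \<alpha> \<theta> (k + 1) q = mul ?B (mul (transfer_mat \<alpha> \<theta> k q) (adj ?B))"
      by (simp add: mul_assoc mul_adj[OF B])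
    then have "Re (fst (transfer_mat \<alpha> \<theta> (k + 1) q)) = Re (fst (mul (mul (transfer_mat \<alpha> \<theta> k q) (adj ?B)) ?B))"
      by (simp add: Re_trace_commute)
    then show ?thesis by (simp add: mul_assoc mul_adj[OF B])
  qed
  show ?thesis
  proof (induction k rule: int_induct[where k = 0])
    case base
    then show ?case by (simp add: half_trace_def)
  next
    case (step1 i)
    then show ?case using step by simp
  next
    case (step2 i)
    then show ?case using step[of "i - 1"] by simp
  qed
qed

subsection \<open>The spectrum of a periodic CMV operator\<close>

lemma periodic_multiple:
  fixes f :: "int \<Rightarrow> 'a"
  assumes "\<And>n. f (n + p) = f n"
  shows "f (n + p * j) = f n"
proof (induction j rule: int_induct[where k = 0])
  case (step1 j)
  then show ?case using assms[of "n + p * j"] by (simp add: algebra_simps)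
next
  case (step2 j)
  then show ?case using assms[of "n + p * (j - 1)"] by (simp add: algebra_simps)
qed simp

text \<open>The error of each step involves two neighbouring sites. Collecting \<open>q\<close> of
  them into one window of shifts gives the form required by
  \<open>ell2_dominated_by_shifts\<close>.\<close>

lemma sum_pairs_le:
  fixes h :: "int \<Rightarrow> real"
  assumes h: "\<And>n. 0 \<le> h n" and a: "n + a \<le> m" and b: "m + 2 * int q \<le> n + b + 1"
  shows "(\<Sum>i<q. h (m + 2 * int i) + h (m + 2 * int i + 1)) \<le> (\<Sum>i\<in>{a..b}. h (n + i))"
proof -
  have "(\<Sum>i<q. h (m + 2 * int i) + h (m + 2 * int i + 1)) = sum h {m..<m + 2 * int q}"
  proof (induction q)
    case (Suc q)
    have "{m..<m + 2 * int (Suc q)} = {m..<m + 2 * int q} \<union> {m + 2 * int q, m + 2 * int q + 1}" by auto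
    then have "sum h {m..<m + 2 * int (Suc q)}
        = sum h {m..<m + 2 * int q} + sum h {m + 2 * int q, m + 2 * int q + 1}"
      by (simp only:) (rule sum.union_disjoint, auto)
    then show ?case using Suc by simp
  qed simp
  also have "\<dots> \<le> sum h {n + a..n + b}"
    using a b h by (intro sum_mono2) auto
  also have "\<dots> = (\<Sum>i\<in>{a..b}. h (n + i))"
    by (rule sum.reindex_bij_witness[of _ "\<lambda>i. n + i" "\<lambda>i. i - n"]) auto
  finally show ?thesis .
qed

text \<open>Crude on purpose: replacing the square root by \<open>1 - r\<^sup>2\<close> expresses
  the bound through the constant of the step matrices.\<close>

lemma inverse_rho_le:
  assumes "\<And>n. cmod (\<alpha> n) \<le> r" "r < 1"
  shows "1 / cmv_rho \<alpha> n \<le> (4 / (1 - r\<^sup>2)) / 4"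
proof -
  have "0 \<le> r" using order_trans[OF norm_ge_zero assms(1)] .
  then have R: "0 < 1 - r\<^sup>2" "1 - r\<^sup>2 \<le> 1" using assms(2) by (auto simp: abs_square_less_1)
  have "1 - r\<^sup>2 \<le> sqrt (1 - r\<^sup>2)"
    by (rule real_le_rsqrt) (use R in \<open>simp add: power2_eq_square mult_left_le\<close>)
  also have "\<dots> \<le> cmv_rho \<alpha> n" by (rule cmv_rho_ge) (rule assms(1))
  finally have "1 / cmv_rho \<alpha> n \<le> 1 / (1 - r\<^sup>2)" using R by (intro frac_le) auto
  moreover have "4 / x / 4 = 1 / x" for x :: real by simp
  ultimately show ?thesis by metis
qed

text \<open>A solution \<open>u\<close> of \<open>(E - z) u = g\<close> satisfies \<open>u (n + 2 q) + u (n - 2 q) = \<Delta> u n\<close> up to a local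
  expression in \<open>g\<close>, because the monodromy \<open>T\<close> satisfies \<open>T + T\<^sup>-\<^sup>1 = \<Delta>\<close> (Cayley--Hamilton). As the
  shifts are isometric, \<open>|\<Delta>| > 2\<close> makes \<open>E - z\<close> bounded below.\<close>

lemma discriminant_identity:
  assumes r: "\<And>n. cmod (\<alpha> n) \<le> r" "r < 1" and per: "\<And>n. \<alpha> (n + 2 * int q) = \<alpha> n"
  shows "\<exists>M\<ge>0. \<forall>u g n. (\<forall>n. cmv_op \<alpha> u n = cis \<theta> * u n + g n) \<longrightarrow>
    cmod (u (n + 2 * int q) + u (n - 2 * int q) - of_real (2 * half_trace \<alpha> q \<theta>) * u n)
      \<le> M * (\<Sum>i\<in>{- 2 * int q - 1..2 * int q}. cmod (g (n + i)))"
proof -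
  define K where "K = 4 / (1 - r\<^sup>2)"
  have "0 \<le> r" using order_trans[OF norm_ge_zero r(1)] .
  then have K1: "1 \<le> K" unfolding K_def using r(2) by (rule step_mat_const_ge_1)
  have D: "in_disk \<alpha>" using r by (rule in_diskI)
  have rho: "1 / cmv_rho \<alpha> n \<le> K / 4" for n
    using inverse_rho_le[of \<alpha> r, OF r] by (simp add: K_def)
  have div_rho: "cmod (x / of_real (cmv_rho \<alpha> n)) \<le> cmod x * (K / 4)" for x n
    using mult_left_mono[OF rho, of "cmod x" n] cmv_rho_pos[OF D, of n] by (simp add: norm_divide)
  have \<alpha>1: "cmod (\<alpha> n) \<le> 1" for n using r(1)[of n] r(2) by simp
  define h where "h = half_trace \<alpha> q \<theta>"
  \<comment> \<open>The summands are the error of the period to the right and that of the period to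
    the left, the latter transported by the inverse monodromy. The leading \<open>K\<close> pays for
    passing from odd to even sites.\<close>
  define M where "M = K * (K ^ q * K + K ^ q * (K ^ q * K))"
  have "0 \<le> M" using K1 by (simp add: M_def)
  moreover have "cmod (u (n + 2 * int q) + u (n - 2 * int q) - of_real (2 * h) * u n)
      \<le> M * (\<Sum>i\<in>{- 2 * int q - 1..2 * int q}. cmod (g (n + i)))" (is "_ \<le> M * ?S n")
    if g: "\<And>n. cmv_op \<alpha> u n = cis \<theta> * u n + g n" for u g n
  proof -
    define \<psi> where "\<psi> = (\<lambda>k. (u (2 * k - 1), theta 1 \<alpha> u (2 * k - 1)))"
    define e where "e k = K * (cmod (g (2 * k)) + cmod (g (2 * k + 1)))" for k
    have err: "nrm (\<psi> (k + 1) - act (step_mat \<alpha> \<theta> k) (\<psi> k)) \<le> e k" for k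
    proof -
      define g0 \<rho>0 where "g0 = g (2 * k)" and "\<rho>0 = complex_of_real (cmv_rho \<alpha> (2 * k))"
      have \<rho>0: "cmod (x / \<rho>0) \<le> cmod x * (K / 4)" for x unfolding \<rho>0_def by (rule div_rho)
      have "cmod (- \<alpha> (2 * k) * g0) \<le> cmod g0"
        using \<alpha>1 by (simp add: norm_mult mult_left_le_one_le)
      then have "cmod (- \<alpha> (2 * k) * g0) * (K / 4) \<le> cmod g0 * (K / 4)"
        using K1 by (intro mult_right_mono) auto
      then have 1: "cmod (- \<alpha> (2 * k) * g0 / \<rho>0) \<le> cmod g0 * (K / 4)"
        using \<rho>0[of "- \<alpha> (2 * k) * g0"] by linarith
      have st: "\<psi> (k + 1) = act (step_mat \<alpha> \<theta> k) (\<psi> k)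
          + (cis (- \<theta>) * (- \<alpha> (2 * k) * g0 / \<rho>0 - g (2 * k + 1)), g0 / \<rho>0)"
        unfolding \<psi>_def g0_def \<rho>0_def by (rule step_equation[OF D g])
      have "nrm (\<psi> (k + 1) - act (step_mat \<alpha> \<theta> k) (\<psi> k))
        = cmod (- \<alpha> (2 * k) * g0 / \<rho>0 - g (2 * k + 1)) + cmod (g0 / \<rho>0)"
        by (simp add: st nrm_def norm_mult)
      also have "\<dots> \<le> (cmod g0 * (K / 4) + cmod (g (2 * k + 1))) + cmod g0 * (K / 4)"
        using 1 \<rho>0[of g0] by (intro add_mono norm_triangle_le_diff) auto
      also have "\<dots> \<le> K * (cmod g0 + cmod (g (2 * k + 1)))"
      proof -
        have "0 \<le> K * cmod g0" using K1 by simp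
        then show ?thesis
          using mult_right_mono[OF K1, of "cmod (g (2 * k + 1))"] by (simp add: algebra_simps)
      qed
      finally show ?thesis by (simp add: e_def g0_def)
    qed
    have step: "nrm (step_mat \<alpha> \<theta> k) \<le> K" for k
      unfolding K_def by (rule nrm_step_mat_le) (use r in auto)
    note te = transfer_error[of \<psi> \<alpha> \<theta> e K, OF err step K1]
    have sum_e: "(\<Sum>i<q. e (j + int i)) \<le> K * ?S n"
      if "n - 2 * int q - 1 \<le> 2 * j" "2 * j \<le> n + 1" for j n
    proof -
      have "(\<Sum>i<q. e (j + int i)) = K * (\<Sum>i<q. cmod (g (2 * j + 2 * int i)) + cmod (g (2 * j + 2 * int i + 1)))"
        by (simp add: e_def sum_distrib_left algebra_simps)
      also have "\<dots> \<le> K * ?S n"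
        using K1 that by (intro mult_left_mono sum_pairs_le) auto
      finally show ?thesis .
    qed
    define \<phi> where "\<phi> k = \<psi> (k + int q) + \<psi> (k - int q) - (of_real (2 * h) * fst (\<psi> k), of_real (2 * h) * snd (\<psi> k))" for k
    have \<phi>: "nrm (\<phi> k) \<le> (K ^ q * K + K ^ q * (K ^ q * K)) * ?S n" if "n = 2 * k - 1 \<or> n = 2 * k" for k n
    proof -
      let ?T = "transfer_mat \<alpha> \<theta> k q"
      have T: "transfer_mat \<alpha> \<theta> (k - int q) q = ?T"
        using transfer_mat_periodic[of \<alpha> q \<theta> "k - int q" q, OF per] by simp
      have su: "su11 ?T" by (rule su11_transfer_mat[OF D])
      have cay: "act ?T (\<psi> k) + act (adj ?T) (\<psi> k) = (of_real (2 * h) * fst (\<psi> k), of_real (2 * h) * snd (\<psi> k))"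
        unfolding act_plus_act_adj Re_trace_transfer_mat[of \<alpha> q \<theta> k, OF D per] h_def by (rule refl)
      have inv: "act (adj ?T) (act ?T (\<psi> (k - int q))) = \<psi> (k - int q)"
        unfolding act_mul[symmetric] mul_adj[OF su] by simp
      have "\<phi> k = (\<psi> (k + int q) - act ?T (\<psi> k)) - act (adj ?T) (\<psi> k - act ?T (\<psi> (k - int q)))"
        unfolding \<phi>_def act_diff inv cay[symmetric] by simp
      also have "nrm \<dots> \<le> nrm (\<psi> (k + int q) - act ?T (\<psi> k))
          + nrm ?T * nrm (\<psi> (k - int q + int q) - act (transfer_mat \<alpha> \<theta> (k - int q) q) (\<psi> (k - int q)))"
        unfolding T using nrm_act_le[of "adj ?T" "\<psi> k - act ?T (\<psi> (k - int q))"]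
        by (intro order_trans[OF nrm_triangle_diff]) auto
      also have "\<dots> \<le> K ^ q * (K * ?S n) + K ^ q * (K ^ q * (K * ?S n))"
      proof (intro add_mono mult_mono nrm_nonneg)
        show "nrm (\<psi> (k + int q) - act ?T (\<psi> k)) \<le> K ^ q * (K * ?S n)"
          using K1 that by (intro order_trans[OF te] mult_left_mono sum_e) auto
        show "nrm (\<psi> (k - int q + int q) - act (transfer_mat \<alpha> \<theta> (k - int q) q) (\<psi> (k - int q))) \<le> K ^ q * (K * ?S n)"
          using K1 that by (intro order_trans[OF te] mult_left_mono sum_e) auto
        show "nrm ?T \<le> K ^ q" unfolding K_def by (rule nrm_transfer_mat_le) (use r in auto)
      qed (use K1 in auto)
      finally show ?thesis by (simp add: algebra_simps)
    qed
    have S0: "0 \<le> ?S n" by (intro sum_nonneg) simp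
    \<comment> \<open>The state \<open>\<psi>\<close> shows \<open>u\<close> at odd sites only. At
      an even site \<open>u\<close> is read off after one \<open>refl_mat\<close>, which is the same
      at \<open>k\<close>, \<open>k + q\<close> and \<open>k - q\<close> by periodicity.\<close>
    define k where "k = (n + 1) div 2"
    have "n = 2 * k - 1 \<or> n = 2 * k" unfolding k_def by presburger
    then show ?thesis
    proof
      assume 1: "n = 2 * k - 1"
      have "u (n + 2 * int q) + u (n - 2 * int q) - of_real (2 * h) * u n = fst (\<phi> k)"
        by (simp add: \<phi>_def \<psi>_def 1 algebra_simps)
      then have "cmod (u (n + 2 * int q) + u (n - 2 * int q) - of_real (2 * h) * u n) \<le> nrm (\<phi> k)"
        by (simp add: nrm_def)
      also have "\<dots> \<le> 1 * ((K ^ q * K + K ^ q * (K ^ q * K)) * ?S n)" using \<phi>[of n k] 1 by simp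
      also have "\<dots> \<le> K * ((K ^ q * K + K ^ q * (K ^ q * K)) * ?S n)"
        using K1 S0 by (intro mult_right_mono) auto
      finally show ?thesis by (simp add: M_def mult.assoc)
    next
      assume 2: "n = 2 * k"
      have refl_per: "refl_mat \<alpha> (2 * (k + int q) - 1) = refl_mat \<alpha> (2 * k - 1)"
        "refl_mat \<alpha> (2 * (k - int q) - 1) = refl_mat \<alpha> (2 * k - 1)"
        using per[of "2 * k - 1"] per[of "2 * (k - int q) - 1"]
        by (simp_all add: refl_mat_def cmv_rho_def algebra_simps)
      have u: "u (2 * k) = snd (act (refl_mat \<alpha> (2 * k - 1)) (\<psi> k))" for k
        using theta_solve[OF D, of u k] by (simp add: \<psi>_def prod_eq_iff)
      have "u (n + 2 * int q) + u (n - 2 * int q) - of_real (2 * h) * u n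
          = u (2 * (k + int q)) + u (2 * (k - int q)) - of_real (2 * h) * u (2 * k)"
        by (simp add: 2 algebra_simps)
      also have "\<dots> = snd (act (refl_mat \<alpha> (2 * k - 1)) (\<phi> k))"
        unfolding u refl_per by (simp add: \<phi>_def act_def algebra_simps)
      finally have "cmod (u (n + 2 * int q) + u (n - 2 * int q) - of_real (2 * h) * u n)
          \<le> nrm (act (refl_mat \<alpha> (2 * k - 1)) (\<phi> k))" by (simp add: nrm_def)
      also have "\<dots> \<le> nrm (refl_mat \<alpha> (2 * k - 1)) * nrm (\<phi> k)" by (rule nrm_act_le)
      also have "\<dots> \<le> K * ((K ^ q * K + K ^ q * (K ^ q * K)) * ?S n)"
      proof (intro mult_mono nrm_nonneg)
        have "cmod (- \<alpha> (2 * k - 1)) * (K / 4) \<le> 1 * (K / 4)"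
          using \<alpha>1 K1 by (intro mult_right_mono) auto
        then have "cmod (- \<alpha> (2 * k - 1) / of_real (cmv_rho \<alpha> (2 * k - 1))) \<le> K / 4"
          using div_rho[of "- \<alpha> (2 * k - 1)" "2 * k - 1"] by linarith
        moreover have "cmod (1 / of_real (cmv_rho \<alpha> (2 * k - 1))) \<le> K / 4"
          using div_rho[of 1 "2 * k - 1"] by simp
        ultimately show "nrm (refl_mat \<alpha> (2 * k - 1)) \<le> K"
          using K1 unfolding nrm_def refl_mat_def fst_conv snd_conv by linarith
        show "nrm (\<phi> k) \<le> (K ^ q * K + K ^ q * (K ^ q * K)) * ?S n" using \<phi>[of n k] 2 by simp
      qed (use K1 in auto)
      finally show ?thesis by (simp add: M_def mult.assoc)
    qed
  qed
  ultimately show ?thesis unfolding h_def by blast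
qed

lemma not_in_cmv_spectrum_if_hyperbolic:
  assumes r: "\<And>n. cmod (\<alpha> n) \<le> r" "r < 1" and per: "\<And>n. \<alpha> (n + 2 * int q) = \<alpha> n"
    and h: "1 < \<bar>half_trace \<alpha> q \<theta>\<bar>"
  shows "cis \<theta> \<notin> cmv_spectrum \<alpha>"
proof -
  have D: "in_disk \<alpha>" using r by (rule in_diskI)
  let ?h = "half_trace \<alpha> q \<theta>" and ?I = "{- 2 * int q - 1..2 * int q}"
  obtain M where "0 \<le> M" and M: "\<And>u g n. (\<And>n. cmv_op \<alpha> u n = cis \<theta> * u n + g n) \<Longrightarrow>
    cmod (u (n + 2 * int q) + u (n - 2 * int q) - of_real (2 * ?h) * u n)
      \<le> M * (\<Sum>i\<in>?I. cmod (g (n + i)))"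
    using discriminant_identity[of \<alpha> r q \<theta>, OF r per] by blast
  define C where "C = M * real (card ?I) + 1"
  have "0 < C" using \<open>0 \<le> M\<close> by (simp add: C_def add_nonneg_pos)
  have "(2 * \<bar>?h\<bar> - 2) * norm f \<le> C * norm (cmv_l2 \<alpha> f - scaleC (cis \<theta>) f)" for f
  proof -
    define g where "g = cmv_l2 \<alpha> f - scaleC (cis \<theta>) f"
    define G where "G = shift (2 * int q) f + shift (- 2 * int q) f - (2 * ?h) *\<^sub>R f"
    have "cmv_op \<alpha> (seq f) n = cis \<theta> * seq f n + seq g n" for n
      by (simp add: g_def seq_cmv_l2 D)
    then have "cmod (seq G n) \<le> M * (\<Sum>i\<in>?I. cmod (seq g (n + i)))" for n
      using M[of "seq f" "seq g" n] by (simp add: G_def)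
    then have "norm G \<le> M * real (card ?I) * norm g"
      unfolding norm_l2_eq_ell2_norm[of G]
      by (intro ell2_dominated_by_shifts(2)) (use \<open>0 \<le> M\<close> in auto)
    also have "\<dots> \<le> C * norm g" by (simp add: C_def mult_right_mono)
    finally have G: "norm G \<le> C * norm g" .
    have "2 * \<bar>?h\<bar> * norm f = norm ((shift (2 * int q) f + shift (- 2 * int q) f) - G)"
      by (simp add: G_def abs_mult)
    also have "\<dots> \<le> (norm f + norm f) + norm G"
      by (intro norm_triangle_le_diff add_mono norm_triangle_le) simp_all
    finally show ?thesis using G by (simp add: g_def algebra_simps)
  qed
  then have "below_by (cmv_l2 \<alpha>) (cis \<theta>) ((2 * \<bar>?h\<bar> - 2) / C)"
    using \<open>0 < C\<close> by (simp add: below_by_def field_simps)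
  moreover have "0 < (2 * \<bar>?h\<bar> - 2) / C" using h \<open>0 < C\<close> by simp
  ultimately show ?thesis unfolding ell2_spectrum_cmv[OF D] l2_spectrum_def by blast
qed

text \<open>The characteristic polynomial \<open>l\<^sup>2 - 2 * Re a * l + 1\<close> has its roots
  on the unit circle when \<open>\<bar>Re a\<bar> \<le> 1\<close>. The vector
  \<open>(b, l - a)\<close> belongs to such a root but may vanish for \<open>b = 0\<close>, where
  the matrix is diagonal.\<close>

lemma unimodular_eigenvector:
  assumes T: "su11 T" and h: "\<bar>Re (fst T)\<bar> \<le> 1"
  shows "\<exists>\<phi> v. v \<noteq> (0, 0) \<and> act T v = (cis \<phi> * fst v, cis \<phi> * snd v)"
proof -
  obtain a b where ab: "T = (a, b)" by (cases T)
  have det: "a * cnj a - b * cnj b = 1" using T by (simp add: su11_def ab)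
  define l where "l = (if b = 0 then a else Complex (Re a) (sqrt (1 - (Re a)\<^sup>2)))"
  define v where "v = (if b = 0 then (1, 0) else (b, l - a))"
  have "(Re a)\<^sup>2 \<le> 1" using h by (simp add: ab abs_square_le_1)
  have "(Re l)\<^sup>2 + (Im l)\<^sup>2 = 1"
  proof (cases "b = 0")
    case True
    then show ?thesis using det by (simp add: l_def complex_eq_iff power2_eq_square)
  next
    case False
    then show ?thesis using \<open>(Re a)\<^sup>2 \<le> 1\<close> by (simp add: l_def)
  qed
  then have "(cmod l)\<^sup>2 = 1" by (simp add: cmod_power2)
  then have "cmod l = 1" by (simp add: abs_square_eq_1)
  then obtain \<phi> where \<phi>: "l = cis \<phi>" by (metis complex_norm_eq_1_exp cis_conv_exp mult.commute)
  have "act T v = (l * fst v, l * snd v)"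
  proof (cases "b = 0")
    case True
    then show ?thesis by (simp add: ab act_def v_def l_def)
  next
    case False
    have "l * l - l * (a + cnj a) + 1 = 0"
    proof -
      define s where "s = sqrt (1 - (Re a)\<^sup>2)"
      have "s * s = 1 - Re a * Re a"
        using \<open>(Re a)\<^sup>2 \<le> 1\<close> by (simp add: s_def power2_eq_square)
      moreover have "l = Complex (Re a) s" using False by (simp add: l_def s_def)
      ultimately show ?thesis by (simp add: complex_eq_iff)
    qed
    then have "cnj b * b + cnj a * (l - a) = l * (l - a)" using det by algebra
    with False show ?thesis by (simp add: ab act_def v_def algebra_simps)
  qed
  moreover have "v \<noteq> (0, 0)" by (simp add: v_def)
  ultimately show ?thesis unfolding \<phi> by blast
qed

text \<open>Floquet solution: starting from an eigenvector of the monodromy with unimodular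
  eigenvalue, each period multiplies the solution by a phase.\<close>

lemma bounded_solution_if_elliptic:
  assumes r: "\<And>n. cmod (\<alpha> n) \<le> r" "r < 1" and per: "\<And>n. \<alpha> (n + 2 * int q) = \<alpha> n" and q: "0 < q"
    and h: "\<bar>half_trace \<alpha> q \<theta>\<bar> \<le> 1"
  shows "\<exists>u n\<^sub>0. (\<forall>n. cmv_op \<alpha> u n = cis \<theta> * u n) \<and> (\<forall>n. cmod (u (n + 2 * int q)) = cmod (u n)) \<and> u n\<^sub>0 \<noteq> 0"
proof -
  have D: "in_disk \<alpha>" using r by (rule in_diskI)
  define T where "T = transfer_mat \<alpha> \<theta> 0"
  have "su11 (T q)" by (simp add: T_def su11_transfer_mat D)
  moreover have "\<bar>Re (fst (T q))\<bar> \<le> 1" using h by (simp add: T_def half_trace_def)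
  ultimately obtain \<phi> v where v: "v \<noteq> (0, 0)" "act (T q) v = (cis \<phi> * fst v, cis \<phi> * snd v)"
    using unimodular_eigenvector by blast
  define sc where "sc j w = (cis (\<phi> * of_int j) * fst w, cis (\<phi> * of_int j) * snd w)" for j :: int and w :: "complex \<times> complex"
  have act_sc: "act S (sc j w) = sc j (act S w)" for S j w
    by (simp add: sc_def act_def algebra_simps)
  \<comment> \<open>Full periods contribute a phase and the remainder a transfer matrix; as
    \<open>div\<close> and \<open>mod\<close> take floors, negative \<open>k\<close> is included and
    transfer matrices to the left are avoided.\<close>
  define \<psi> where "\<psi> k = sc (k div int q) (act (T (nat (k mod int q))) v)" for k
  have B_per: "step_mat \<alpha> \<theta> (int i + int q * j) = step_mat \<alpha> \<theta> (int i)" for i j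
    by (rule periodic_multiple[where f = "step_mat \<alpha> \<theta>"]) (rule step_mat_periodic[of \<alpha> q, OF per])
  have \<psi>: "\<psi> (k + 1) = act (step_mat \<alpha> \<theta> k) (\<psi> k)" for k
  proof -
    define j i where "j = k div int q" and "i = nat (k mod int q)"
    have k: "k = int i + int q * j" and i: "i < q" using q by (simp_all add: j_def i_def nat_less_iff)
    have B: "step_mat \<alpha> \<theta> k = step_mat \<alpha> \<theta> (int i)" by (subst k) (rule B_per)
    have "act (step_mat \<alpha> \<theta> k) (\<psi> k) = sc j (act (T (Suc i)) v)"
      unfolding \<psi>_def j_def[symmetric] i_def[symmetric] act_sc B by (simp add: T_def act_mul)
    also have "\<dots> = \<psi> (k + 1)"
    proof (cases "Suc i < q")
      case True
      have k1: "k + 1 = int (Suc i) + int q * j" by (simp add: k)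
      have "(k + 1) div int q = j" "(k + 1) mod int q = int (Suc i)"
        unfolding k1 using True q by (simp_all only: div_mult_self2 mod_mult_self2) simp_all
      then show ?thesis by (simp only: \<psi>_def nat_int)
    next
      case False
      then have "Suc i = q" using i by simp
      then have k1: "k + 1 = int q * (j + 1)" by (simp add: k algebra_simps)
      have "(k + 1) div int q = j + 1" "(k + 1) mod int q = 0"
        unfolding k1 using q by simp_all
      then have "\<psi> (k + 1) = sc (j + 1) v" by (simp add: \<psi>_def T_def)
      also have "\<dots> = sc j (act (T q) v)"
        by (simp add: sc_def v(2) algebra_simps cis_mult[symmetric])
      finally show ?thesis using \<open>Suc i = q\<close> by simp
    qed
    finally show ?thesis by simp
  qed
  have \<psi>_per: "\<psi> (k + int q) = sc 1 (\<psi> k)" for k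
    using q by (simp add: \<psi>_def sc_def algebra_simps cis_mult[symmetric])
  \<comment> \<open>The state at even sites, with the components of \<open>u\<close> and
    \<open>z\<close> in reversed order.\<close>
  define w where "w k = act (refl_mat \<alpha> (2 * k - 1)) (\<psi> k)" for k
  define u where "u n = (if odd n then fst (\<psi> ((n + 1) div 2)) else snd (w (n div 2)))" for n
  define z where "z n = (if odd n then snd (\<psi> ((n + 1) div 2)) else fst (w (n div 2)))" for n
  have odd_even: "u (2 * k - 1) = fst (\<psi> k)" "z (2 * k - 1) = snd (\<psi> k)" "u (2 * k) = snd (w k)" "z (2 * k) = fst (w k)" for k
    by (simp_all add: u_def z_def)
  have odd_next: "u (2 * k + 1) = fst (\<psi> (k + 1))" "z (2 * k + 1) = snd (\<psi> (k + 1))" for k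
    using odd_even(1,2)[of "k + 1"] by (simp_all add: algebra_simps)
  have theta1: "theta 1 \<alpha> u n = z n" for n
  proof -
    define k x y where "k = (n + 1) div 2" and "x = fst (\<psi> k)" and "y = snd (\<psi> k)"
    define a \<rho> where "a = \<alpha> (2 * k - 1)" and "\<rho> = complex_of_real (cmv_rho \<alpha> (2 * k - 1))"
    have \<rho>: "\<rho> \<noteq> 0" "\<rho> * \<rho> = 1 - a * cnj a" "cnj \<rho> = \<rho>"
      using rho_nz[OF D] rho_sq[OF D] by (simp_all add: \<rho>_def a_def)
    have w: "fst (w k) = (x - a * y) / \<rho>" "snd (w k) = (y - cnj a * x) / \<rho>"
      using \<rho> by (simp_all add: w_def act_def refl_mat_def x_def y_def a_def \<rho>_def diff_divide_distrib)
    have "n = 2 * k - 1 \<or> n = 2 * k" unfolding k_def by presburger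
    then show ?thesis
    proof
      assume n: "n = 2 * k - 1"
      have "theta 1 \<alpha> u n = cnj a * x + \<rho> * ((y - cnj a * x) / \<rho>)"
        by (simp add: n theta_def odd_even w a_def[symmetric] \<rho>_def[symmetric] x_def)
      also have "\<dots> = y" using \<rho>(1) by simp
      finally show ?thesis by (simp add: n odd_even y_def)
    next
      assume n: "n = 2 * k"
      have "theta 1 \<alpha> u n = \<rho> * x - a * ((y - cnj a * x) / \<rho>)"
        by (simp add: n theta_def odd_even w a_def[symmetric] \<rho>_def[symmetric] x_def)
      also have "\<dots> = ((\<rho> * \<rho> + a * cnj a) * x - a * y) / \<rho>" using \<rho>(1) by (simp add: field_simps)
      also have "\<dots> = (x - a * y) / \<rho>" by (simp add: \<rho>(2))
      finally show ?thesis by (simp add: n odd_even w)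
    qed
  qed
  have theta0: "theta 0 \<alpha> z n = cis \<theta> * u n" for n
  proof -
    define k where "k = n div 2"
    define x y where "x = fst (w k)" and "y = snd (w k)"
    define a \<rho> c where "a = \<alpha> (2 * k)" and "\<rho> = complex_of_real (cmv_rho \<alpha> (2 * k))" and "c = cis \<theta>"
    have \<rho>: "\<rho> \<noteq> 0" "\<rho> * \<rho> = 1 - a * cnj a" "cnj \<rho> = \<rho>"
      using rho_nz[OF D] rho_sq[OF D] by (simp_all add: \<rho>_def a_def)
    have c: "cis (- \<theta>) = cnj c" "c * cnj c = 1" by (simp_all add: c_def cis_cnj cis_mult)
    have "\<psi> (k + 1) = act (rot_mat \<alpha> \<theta> (2 * k)) (w k)"
      by (simp add: \<psi> step_mat_def act_mul w_def)
    then have p: "fst (\<psi> (k + 1)) = (cnj c * x - a * y) / \<rho>" "snd (\<psi> (k + 1)) = (c * y - cnj a * x) / \<rho>"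
      using \<rho> c(1) by (simp_all add: act_def rot_mat_def x_def y_def a_def \<rho>_def diff_divide_distrib)
    have "n = 2 * k \<or> n = 2 * k + 1" unfolding k_def by presburger
    then show ?thesis
    proof
      assume n: "n = 2 * k"
      have "theta 0 \<alpha> z n = cnj a * x + \<rho> * ((c * y - cnj a * x) / \<rho>)"
        by (simp add: n theta_def odd_even odd_next p a_def[symmetric] \<rho>_def[symmetric] x_def)
      also have "\<dots> = c * y" using \<rho>(1) by simp
      finally show ?thesis by (simp add: n odd_even y_def c_def)
    next
      assume n: "n = 2 * k + 1"
      have "theta 0 \<alpha> z n = \<rho> * x - a * ((c * y - cnj a * x) / \<rho>)"
        by (simp add: n theta_def odd_even odd_next p a_def[symmetric] \<rho>_def[symmetric] x_def)
      also have "\<dots> = ((\<rho> * \<rho> + a * cnj a) * x - c * a * y) / \<rho>" using \<rho>(1) by (simp add: field_simps)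
      also have "\<dots> = (c * cnj c * x - c * a * y) / \<rho>" by (simp add: \<rho>(2) c(2))
      also have "\<dots> = c * ((cnj c * x - a * y) / \<rho>)" by (simp add: algebra_simps)
      finally show ?thesis by (simp add: n odd_next p c_def)
    qed
  qed
  have "cmv_op \<alpha> u n = cis \<theta> * u n" for n
  proof -
    have "theta 1 \<alpha> u = z" using theta1 by auto
    then show ?thesis by (simp add: cmv_op_eq_theta theta0)
  qed
  moreover have "cmod (u (n + 2 * int q)) = cmod (u n)" for n
  proof -
    have "refl_mat \<alpha> (2 * (k + int q) - 1) = refl_mat \<alpha> (2 * k - 1)" for k
      using per[of "2 * k - 1"] by (simp add: refl_mat_def cmv_rho_def algebra_simps)
    then have w: "w (k + int q) = sc 1 (w k)" for k by (simp add: w_def \<psi>_per act_sc)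
    have "(n + 2 * int q + 1) div 2 = (n + 1) div 2 + int q" "(n + 2 * int q) div 2 = n div 2 + int q"
      by simp_all
    then show ?thesis by (simp add: u_def \<psi>_per w) (simp add: sc_def norm_mult)
  qed
  moreover have "\<exists>n\<^sub>0. u n\<^sub>0 \<noteq> 0"
  proof (rule ccontr)
    assume "\<not> ?thesis"
    then have u0: "u = (\<lambda>_. 0)" by auto
    have "z n = 0" for n by (simp add: theta1[symmetric] u0 theta_def)
    then have "\<psi> 0 = (0, 0)" using odd_even(1,2)[of 0] u0 by (simp add: prod_eq_iff)
    then show False using v(1) by (simp add: \<psi>_def T_def sc_def prod_eq_iff)
  qed
  ultimately show ?thesis by blast
qed

section \<open>Truncated Floquet solutions\<close>

lemma cmv_op_local:
  assumes "\<And>i. i \<in> {-2..2} \<Longrightarrow> f (n + i) = f' (n + i)"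
  shows "cmv_op \<alpha> f n = cmv_op \<alpha> f' n"
proof -
  have "f (n - 2) = f' (n - 2)" "f (n - 1) = f' (n - 1)" "f n = f' n" "f (n + 1) = f' (n + 1)" "f (n + 2) = f' (n + 2)"
    using assms[of "-2"] assms[of "-1"] assms[of 0] assms[of 1] assms[of 2] by simp_all
  then show ?thesis by (simp add: cmv_op_eq_theta theta_def algebra_simps)
qed

lemma cmv_op_bound:
  assumes "in_disk \<alpha>" "\<And>n. cmod (f n) \<le> M"
  shows "cmod (cmv_op \<alpha> f n) \<le> 9 * M"
proof -
  have *: "cmod (theta e \<alpha> g n) \<le> 3 * L" if "\<And>n. cmod (g n) \<le> L" for e g n L
  proof -
    have "cmod (theta e \<alpha> g n) \<le> 1 * (\<Sum>i\<in>{-1, 0, 1}. cmod (g (n + i)))" by (rule theta_le[OF assms(1)])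
    also have "\<dots> \<le> 1 * (\<Sum>i\<in>{-1, 0, 1 :: int}. L)" using that by (intro mult_left_mono sum_mono) auto
    finally show ?thesis by simp
  qed
  show ?thesis
    using *[of "theta 1 \<alpha> f" "3 * M" 0 n] *[of f M 1] assms(2) by (simp add: cmv_op_eq_theta)
qed

lemma norm_l2_finite_support:
  assumes "finite A" "\<And>n. n \<notin> A \<Longrightarrow> seq f n = 0" "\<And>n. cmod (seq f n) \<le> B"
  shows "(norm f)\<^sup>2 \<le> real (card A) * B\<^sup>2"
proof -
  have "(norm f)\<^sup>2 = (\<Sum>n\<in>A. (cmod (seq f n))\<^sup>2)"
    unfolding norm_l2_squared using assms(1,2)
    by (subst infsum_cong_neutral[where T = A and g = "\<lambda>n. (cmod (seq f n))\<^sup>2"]) auto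
  also have "\<dots> \<le> (\<Sum>n\<in>A. B\<^sup>2)" using assms(3) by (intro sum_mono power_mono) auto
  finally show ?thesis by simp
qed

text \<open>Weyl's criterion: the Floquet solution cut off to \<open>N\<close> periods is an
  approximate eigenvector, since the residual lives near the two ends and stays bounded while the
  squared norm grows like \<open>N\<close>.\<close>

lemma in_cmv_spectrum_if_elliptic:
  assumes r: "\<And>n. cmod (\<alpha> n) \<le> r" "r < 1" and per: "\<And>n. \<alpha> (n + 2 * int q) = \<alpha> n" and q: "0 < q"
    and h: "\<bar>half_trace \<alpha> q \<theta>\<bar> \<le> 1"
  shows "cis \<theta> \<in> cmv_spectrum \<alpha>"
proof -
  have D: "in_disk \<alpha>" using r by (rule in_diskI)
  obtain u n\<^sub>0 where u: "\<And>n. cmv_op \<alpha> u n = cis \<theta> * u n" and u_per: "\<And>n. cmod (u (n + 2 * int q)) = cmod (u n)"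
    and u0: "u n\<^sub>0 \<noteq> 0"
    using bounded_solution_if_elliptic[of \<alpha> r q \<theta>, OF r per q h] by blast
  have u_per_j: "cmod (u (n + 2 * int q * j)) = cmod (u n)" for n j
    by (rule periodic_multiple[where f = "\<lambda>n. cmod (u n)"]) (rule u_per)
  define M where "M = Max ((\<lambda>n. cmod (u n)) ` {0..<2 * int q})"
  have M: "cmod (u n) \<le> M" for n
  proof -
    have "cmod (u n) = cmod (u (n mod (2 * int q)))"
      using u_per_j[of "n mod (2 * int q)" "n div (2 * int q)"] by simp
    also have "\<dots> \<le> M" unfolding M_def using q by (intro Max_ge) auto
    finally show ?thesis .
  qed
  show ?thesis
  proof (rule ccontr)
    assume "cis \<theta> \<notin> cmv_spectrum \<alpha>"
    then obtain m where m: "0 < m" "below_by (cmv_l2 \<alpha>) (cis \<theta>) m"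
      by (auto simp: ell2_spectrum_cmv D l2_spectrum_def)
    \<comment> \<open>At most 10 sites carry the residual, each with modulus at most
      \<open>10 * M\<close>, whence 1000.\<close>
    have bound: "m\<^sup>2 * (real N * (cmod (u n\<^sub>0))\<^sup>2) \<le> 1000 * M\<^sup>2" for N :: nat
    proof -
      define a b where "a = n\<^sub>0" and "b = n\<^sub>0 + 2 * int q * int N"
      define f where "f = Abs_l2 (\<lambda>n. if a \<le> n \<and> n < b then u n else 0)"
      have "(\<lambda>n. if a \<le> n \<and> n < b then u n else 0) \<in> ell2"
        by (rule ell2_finite_support, rule finite_subset[of _ "{a..<b}"]) auto
      then have f: "seq f = (\<lambda>n. if a \<le> n \<and> n < b then u n else 0)" by (simp add: f_def Abs_l2_inverse)
      define g where "g = cmv_l2 \<alpha> f - scaleC (cis \<theta>) f"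
      have g: "seq g n = cmv_op \<alpha> (seq f) n - cis \<theta> * seq f n" for n by (simp add: g_def seq_cmv_l2 D)
      have M0: "0 \<le> M" using order_trans[OF norm_ge_zero M] .
      have f_le: "cmod (seq f n) \<le> M" for n using M M0 by (simp add: f)
      define A where "A = {a - 2..a + 2} \<union> {b - 2..b + 2}"
      have "card A \<le> card {a - 2..a + 2} + card {b - 2..b + 2}" unfolding A_def by (rule card_Un_le)
      then have A: "card A \<le> 10" "finite A" by (simp_all add: A_def)
      have g_supp: "seq g n = 0" if "n \<notin> A" for n
      proof -
        have "(n < a - 2 \<or> a + 2 < n) \<and> (n < b - 2 \<or> b + 2 < n)" using that by (auto simp: A_def)
        then consider "n + 2 < a \<or> b \<le> n - 2" | "a \<le> n - 2 \<and> n + 2 < b" by linarith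
        then show ?thesis
        proof cases
          case 1
          have "cmv_op \<alpha> (seq f) n = cmv_op \<alpha> (\<lambda>_. 0) n"
            by (rule cmv_op_local) (use 1 in \<open>auto simp: f\<close>)
          then show ?thesis using 1 by (auto simp: g f cmv_op_eq_theta theta_def)
        next
          case 2
          have "cmv_op \<alpha> (seq f) n = cmv_op \<alpha> u n"
            by (rule cmv_op_local) (use 2 in \<open>auto simp: f\<close>)
          then show ?thesis using 2 by (simp add: g u f)
        qed
      qed
      have g_le: "cmod (seq g n) \<le> 10 * M" for n
      proof -
        have "cmod (seq g n) \<le> 9 * M + M"
          unfolding g using f_le[of n]
          by (intro norm_triangle_le_diff add_mono cmv_op_bound D f_le) (simp_all add: norm_mult)
        then show ?thesis by simp
      qed
      have "(norm g)\<^sup>2 \<le> real (card A) * (10 * M)\<^sup>2"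
        by (rule norm_l2_finite_support) (use A g_supp g_le in auto)
      also have "\<dots> \<le> 10 * (10 * M)\<^sup>2" using A by (intro mult_right_mono) auto
      finally have g_norm: "(norm g)\<^sup>2 \<le> 1000 * M\<^sup>2" by (simp add: power_mult_distrib)
      \<comment> \<open>The translates of \<open>n\<^sub>0\<close> by whole periods all carry the
        same modulus and give the linear growth of the squared norm.\<close>
      define I where "I = (\<lambda>j. n\<^sub>0 + 2 * int q * int j) ` {..<N}"
      have inj: "inj_on (\<lambda>j. n\<^sub>0 + 2 * int q * int j) {..<N}" using q by (auto simp: inj_on_def)
      have "real N * (cmod (u n\<^sub>0))\<^sup>2 = (\<Sum>n\<in>I. (cmod (seq f n))\<^sup>2)"
      proof -
        have "a \<le> n\<^sub>0 + 2 * int q * int j \<and> n\<^sub>0 + 2 * int q * int j < b" if "j < N" for j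
          using that q by (simp add: a_def b_def)
        then show ?thesis
          unfolding I_def by (subst sum.reindex[OF inj]) (simp add: f u_per_j)
      qed
      also have "\<dots> \<le> (norm f)\<^sup>2" by (rule finite_sum_le_norm_l2) (simp add: I_def)
      finally have "m\<^sup>2 * (real N * (cmod (u n\<^sub>0))\<^sup>2) \<le> m\<^sup>2 * (norm f)\<^sup>2" by (rule mult_left_mono) simp
      also have "\<dots> \<le> (norm g)\<^sup>2"
        using m by (auto simp: below_by_def g_def power_mult_distrib[symmetric] intro!: power_mono)
      finally show ?thesis using g_norm by linarith
    qed
    have pos: "0 < m\<^sup>2 * (cmod (u n\<^sub>0))\<^sup>2" using m(1) u0 by simp
    obtain N :: nat where "1000 * M\<^sup>2 < real N * (m\<^sup>2 * (cmod (u n\<^sub>0))\<^sup>2)"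
      using reals_Archimedean3[OF pos] by blast
    then show False using bound[of N] by (simp add: mult.left_commute)
  qed
qed

theorem cmv_spectrum_periodic:
  assumes "\<And>n. cmod (\<alpha> n) \<le> r" "r < 1" and "\<And>n. \<alpha> (n + 2 * int q) = \<alpha> n" and "0 < q"
  shows "cis \<theta> \<in> cmv_spectrum \<alpha> \<longleftrightarrow> \<bar>half_trace \<alpha> q \<theta>\<bar> \<le> 1"
  using in_cmv_spectrum_if_elliptic[of \<alpha> r q \<theta>] not_in_cmv_spectrum_if_hyperbolic[of \<alpha> r q \<theta>] assms
  by (meson not_less)

subsection \<open>Monotonicity of the discriminant\<close>

definition jform :: "complex \<times> complex \<Rightarrow> complex \<times> complex \<Rightarrow> complex" where
  "jform v w = cnj (fst v) * fst w - cnj (snd v) * snd w"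

lemma jform_add: "jform v (w + w') = jform v w + jform v w'"
  by (simp add: jform_def algebra_simps)

lemma jform_act:
  assumes "su11 T" shows "jform (act T v) (act T w) = jform v w"
proof -
  have "jform (act T v) (act T w) = (fst T * cnj (fst T) - snd T * cnj (snd T)) * jform v w"
    by (simp add: jform_def act_def algebra_simps)
  then show ?thesis using assms by (simp add: su11_def)
qed

text \<open>As \<theta> is real, differentiation commutes with conjugation, so the derivative is
  again described by the first row of the matrix.\<close>

definition rot_mat_deriv :: "(int \<Rightarrow> complex) \<Rightarrow> real \<Rightarrow> int \<Rightarrow> mat" where
  "rot_mat_deriv \<alpha> \<theta> n = (- \<i> * cis (- \<theta>) / of_real (cmv_rho \<alpha> n), 0)"

definition step_mat_deriv :: "(int \<Rightarrow> complex) \<Rightarrow> real \<Rightarrow> int \<Rightarrow> mat" where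
  "step_mat_deriv \<alpha> \<theta> k = mul (rot_mat_deriv \<alpha> \<theta> (2 * k)) (refl_mat \<alpha> (2 * k - 1))"

primrec transfer_mat_deriv :: "(int \<Rightarrow> complex) \<Rightarrow> real \<Rightarrow> int \<Rightarrow> nat \<Rightarrow> mat" where
  "transfer_mat_deriv \<alpha> \<theta> k 0 = (0, 0)"
| "transfer_mat_deriv \<alpha> \<theta> k (Suc n) =
     mul (step_mat_deriv \<alpha> \<theta> (k + int n)) (transfer_mat \<alpha> \<theta> k n) +
     mul (step_mat \<alpha> \<theta> (k + int n)) (transfer_mat_deriv \<alpha> \<theta> k n)"

section \<open>Differentiation with respect to the angle\<close>

lemma nrm_le_norm: "nrm v \<le> 2 * norm v"
  using norm_fst_le[of "fst v" "snd v"] norm_snd_le[of "snd v" "fst v"] by (simp add: nrm_def)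

lemma norm_le_nrm: "norm v \<le> nrm v"
  using norm_Pair_le[of "fst v" "snd v"] by (simp add: nrm_def)

lemma bounded_bilinear_mul: "bounded_bilinear mul"
proof
  fix S S' T T' :: mat and r :: real
  show "mul (S + S') T = mul S T + mul S' T" "mul S (T + T') = mul S T + mul S T'"
    "mul (r *\<^sub>R S) T = r *\<^sub>R mul S T" "mul S (r *\<^sub>R T) = r *\<^sub>R mul S T"
    by (simp_all add: mul_def prod_eq_iff algebra_simps scaleR_conv_of_real)
  have "norm (mul S T) \<le> norm S * norm T * 4" for S T
  proof -
    have "norm (mul S T) \<le> nrm S * nrm T"
      using norm_le_nrm nrm_mul_le order_trans by blast
    also have "\<dots> \<le> (2 * norm S) * (2 * norm T)"
      by (intro mult_mono nrm_le_norm nrm_nonneg) auto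
    finally show ?thesis by simp
  qed
  then show "\<exists>K. \<forall>S T. norm (mul S T) \<le> norm S * norm T * K" by blast
qed

lemma rot_mat_has_derivative:
  "((\<lambda>\<theta>. rot_mat \<alpha> \<theta> n) has_vector_derivative rot_mat_deriv \<alpha> \<theta> n) (at \<theta>)"
proof -
  have "((\<lambda>\<theta>. cis (- \<theta>)) has_vector_derivative - \<i> * cis (- \<theta>)) (at \<theta>)"
    unfolding has_vector_derivative_def
    by (auto intro!: derivative_eq_intros simp: scaleR_conv_of_real algebra_simps)
  then show ?thesis
    unfolding rot_mat_def rot_mat_deriv_def by (auto intro!: derivative_eq_intros)
qed

lemma step_mat_has_derivative:
  "((\<lambda>\<theta>. step_mat \<alpha> \<theta> k) has_vector_derivative step_mat_deriv \<alpha> \<theta> k) (at \<theta>)"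
proof -
  have z: "mul T 0 = 0" for T by (simp add: mul_def prod_eq_iff)
  show ?thesis
    using bounded_bilinear.has_vector_derivative[OF bounded_bilinear_mul rot_mat_has_derivative
        has_vector_derivative_const[of "refl_mat \<alpha> (2 * k - 1)"]]
    unfolding step_mat_def step_mat_deriv_def z by simp
qed

lemma transfer_mat_has_derivative:
  "((\<lambda>\<theta>. transfer_mat \<alpha> \<theta> k n) has_vector_derivative transfer_mat_deriv \<alpha> \<theta> k n) (at \<theta>)"
proof (induction n)
  case 0
  then show ?case by (simp add: has_vector_derivative_const flip: zero_prod_def)
next
  case (Suc n)
  show ?case
    using bounded_bilinear.has_vector_derivative[OF bounded_bilinear_mul step_mat_has_derivative Suc]
    by (simp add: add.commute)
qed

lemma act_add_left: "act (S + T) v = act S v + act T v"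
  by (simp add: act_def prod_eq_iff algebra_simps)

text \<open>Negativity in the sense of the indefinite form is additive under products, because the
  matrices in \<open>SU(1,1)\<close> preserve the form.\<close>

lemma jform_rot_mat_deriv:
  assumes "in_disk \<alpha>"
  shows "Re (jform (act (rot_mat \<alpha> \<theta> n) v) (act (rot_mat_deriv \<alpha> \<theta> n) v)) = 0"
    and "v \<noteq> (0, 0) \<Longrightarrow> Im (jform (act (rot_mat \<alpha> \<theta> n) v) (act (rot_mat_deriv \<alpha> \<theta> n) v)) < 0"
proof -
  define x y a z where "x = fst v" and "y = snd v" and "a = \<alpha> n" and "z = cis \<theta>"
  define \<rho> where "\<rho> = cmv_rho \<alpha> n"
  have \<rho>: "0 < \<rho>" using cmv_rho_pos[OF assms] by (simp add: \<rho>_def)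
  have z: "cis (- \<theta>) = cnj z" "z * cnj z = 1" by (simp_all add: z_def cis_cnj cis_mult)
  have "jform (act (rot_mat \<alpha> \<theta> n) v) (act (rot_mat_deriv \<alpha> \<theta> n) v)
    = - \<i> * ((z * cnj z) * (x * cnj x + y * cnj y) - (a * z * cnj x * y + cnj (a * z * cnj x * y))) / of_real (\<rho> * \<rho>)"
    unfolding jform_def act_def rot_mat_def rot_mat_deriv_def x_def[symmetric] y_def[symmetric]
      a_def[symmetric] \<rho>_def[symmetric] z(1)
    using \<rho> by (simp add: field_simps)
  also have "\<dots> = - \<i> * of_real (((cmod x)\<^sup>2 + (cmod y)\<^sup>2 - 2 * Re (a * z * cnj x * y)) / (\<rho> * \<rho>))"
    unfolding z(2) complex_add_cnj unfolding complex_norm_square[symmetric] by simp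
  finally have J: "jform (act (rot_mat \<alpha> \<theta> n) v) (act (rot_mat_deriv \<alpha> \<theta> n) v)
    = - \<i> * of_real (((cmod x)\<^sup>2 + (cmod y)\<^sup>2 - 2 * Re (a * z * cnj x * y)) / (\<rho> * \<rho>))" .
  then show "Re (jform (act (rot_mat \<alpha> \<theta> n) v) (act (rot_mat_deriv \<alpha> \<theta> n) v)) = 0" by simp
  assume v: "v \<noteq> (0, 0)"
  have a: "cmod a < 1" using assms by (simp add: a_def in_disk_def)
  have "2 * Re (a * z * cnj x * y) < (cmod x)\<^sup>2 + (cmod y)\<^sup>2"
  proof (cases "x = 0 \<or> y = 0")
    case True
    then show ?thesis using v by (auto simp: x_def y_def prod_eq_iff)
  next
    case False
    have "Re (a * z * cnj x * y) \<le> cmod (a * z * cnj x * y)" by (rule complex_Re_le_cmod)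
    also have "\<dots> = cmod a * (cmod x * cmod y)" by (simp add: norm_mult z_def)
    also have "\<dots> < 1 * (cmod x * cmod y)" using a False by (intro mult_strict_right_mono) auto
    finally show ?thesis using sum_squares_bound[of "cmod x" "cmod y"] by simp
  qed
  then have "0 < ((cmod x)\<^sup>2 + (cmod y)\<^sup>2 - 2 * Re (a * z * cnj x * y)) / (\<rho> * \<rho>)"
    using \<rho> by simp
  then show "Im (jform (act (rot_mat \<alpha> \<theta> n) v) (act (rot_mat_deriv \<alpha> \<theta> n) v)) < 0"
    unfolding J by simp
qed

lemma act_nonzero:
  assumes "su11 T" "v \<noteq> (0, 0)" shows "act T v \<noteq> (0, 0)"
proof
  assume "act T v = (0, 0)"
  then have "act (adj T) (act T v) = (0, 0)" by (simp add: act_def)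
  then show False using assms by (simp add: mul_adj flip: act_mul)
qed

lemma jform_step_mat_deriv:
  assumes "in_disk \<alpha>"
  shows "Re (jform (act (step_mat \<alpha> \<theta> n) v) (act (step_mat_deriv \<alpha> \<theta> n) v)) = 0"
    and "v \<noteq> (0, 0) \<Longrightarrow> Im (jform (act (step_mat \<alpha> \<theta> n) v) (act (step_mat_deriv \<alpha> \<theta> n) v)) < 0"
  using jform_rot_mat_deriv[OF assms] act_nonzero[OF su11_refl_mat[OF assms]]
  by (simp_all add: step_mat_def step_mat_deriv_def act_mul)

lemma jform_transfer_mat_Suc:
  assumes "in_disk \<alpha>"
  shows "jform (act (transfer_mat \<alpha> \<theta> k (Suc n)) v) (act (transfer_mat_deriv \<alpha> \<theta> k (Suc n)) v)
    = jform (act (step_mat \<alpha> \<theta> (k + int n)) (act (transfer_mat \<alpha> \<theta> k n) v))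
        (act (step_mat_deriv \<alpha> \<theta> (k + int n)) (act (transfer_mat \<alpha> \<theta> k n) v))
      + jform (act (transfer_mat \<alpha> \<theta> k n) v) (act (transfer_mat_deriv \<alpha> \<theta> k n) v)"
  by (simp add: act_mul act_add_left jform_add jform_act[OF su11_step_mat[OF assms]])

lemma jform_transfer_mat_deriv:
  assumes D: "in_disk \<alpha>"
  shows "Re (jform (act (transfer_mat \<alpha> \<theta> k n) v) (act (transfer_mat_deriv \<alpha> \<theta> k n) v)) = 0"
    and "0 < n \<Longrightarrow> v \<noteq> (0, 0) \<Longrightarrow>
      Im (jform (act (transfer_mat \<alpha> \<theta> k n) v) (act (transfer_mat_deriv \<alpha> \<theta> k n) v)) < 0"
proof -
  show "Re (jform (act (transfer_mat \<alpha> \<theta> k n) v) (act (transfer_mat_deriv \<alpha> \<theta> k n) v)) = 0"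
  proof (induction n)
    case 0
    show ?case by (simp add: jform_def act_def)
  next
    case (Suc n)
    then show ?case unfolding jform_transfer_mat_Suc[OF D] using jform_step_mat_deriv(1)[OF D] by simp
  qed
  have "v \<noteq> (0, 0) \<Longrightarrow> Im (jform (act (transfer_mat \<alpha> \<theta> k (Suc n)) v) (act (transfer_mat_deriv \<alpha> \<theta> k (Suc n)) v)) < 0" for n
  proof (induction n)
    case 0
    then show ?case
      unfolding jform_transfer_mat_Suc[OF D] using jform_step_mat_deriv(2)[OF D]
      by (simp add: act_def[of "(0, 0)"] jform_def[of _ "(0, 0)"])
  next
    case (Suc n)
    let ?T = "transfer_mat \<alpha> \<theta> k (Suc n)"
    have "act ?T v \<noteq> (0, 0)" using act_nonzero[OF su11_transfer_mat[OF D] Suc.prems] .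
    then show ?case
      unfolding jform_transfer_mat_Suc[OF D, of _ _ "Suc n"] plus_complex.sel
      by (intro add_neg_neg jform_step_mat_deriv(2)[OF D] Suc.IH Suc.prems)
  qed
  then show "0 < n \<Longrightarrow> v \<noteq> (0, 0) \<Longrightarrow>
      Im (jform (act (transfer_mat \<alpha> \<theta> k n) v) (act (transfer_mat_deriv \<alpha> \<theta> k n) v)) < 0"
    by (cases n) (blast, metis)
qed

text \<open>In terms of \<open>X = T\<^sup>-\<^sup>1 T'\<close>, which lies in the Lie algebra of \<open>SU(1,1)\<close>, negativity means that \<open>X\<close> is
  in the open light cone.\<close>

lemma light_cone:
  assumes T: "su11 T" and Re: "\<And>v. Re (jform (act T v) (act T' v)) = 0"
    and Im: "\<And>v. v \<noteq> (0, 0) \<Longrightarrow> Im (jform (act T v) (act T' v)) < 0"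
  defines "X \<equiv> mul (adj T) T'"
  shows "Re (fst X) = 0" "Im (fst X) < - cmod (snd X)"
proof -
  have J: "jform (act T v) (act T' v) = jform v (act X v)" for v
    using jform_act[OF su11_adj[OF T], of "act T v" "act T' v"]
    by (simp add: X_def mul_adj[OF T] flip: act_mul)
  have "Re (jform (1, 0) (act X (1, 0))) = 0" "Im (jform (1, 0) (act X (1, 0))) < 0"
    unfolding J[symmetric] using Re Im by auto
  then have R0: "Re (fst X) = 0" and I0: "Im (fst X) < 0" by (simp_all add: jform_def act_def)
  from R0 show "Re (fst X) = 0" .
  show "Im (fst X) < - cmod (snd X)"
  proof (cases "snd X = 0")
    case False
    define c where "c = complex_of_real (cmod (snd X))"
    have c: "snd X * cnj (snd X) = c * c" "c \<noteq> 0"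
      using False by (simp_all add: c_def complex_norm_square[symmetric] power2_eq_square)
    \<comment> \<open>The null vector \<open>(1, y)\<close> of the form whose phase is aligned with
      \<open>snd X\<close>, so that the off-diagonal entry contributes its full modulus.\<close>
    define y where "y = \<i> * cnj (snd X) / c"
    have "snd X * y = \<i> * (snd X * cnj (snd X)) / c" by (simp add: y_def)
    then have y: "snd X * y = \<i> * cmod (snd X)" using c by (simp add: c_def)
    have "(cmod y)\<^sup>2 = 1" using False by (simp add: y_def c_def norm_mult norm_divide)
    then have yy: "y * cnj y = 1" by (simp add: complex_norm_square[symmetric])
    have "jform (1, y) (act X (1, y)) = fst X - cnj (fst X) * (y * cnj y) + (snd X * y - cnj (snd X * y))"
      by (simp add: jform_def act_def algebra_simps)
    also have "Im \<dots> = 2 * Im (fst X) + 2 * cmod (snd X)" by (simp only: yy y) simp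
    finally show ?thesis using Im[of "(1, y)"] unfolding J by simp
  qed (use I0 in simp)
qed

lemma mul_adj_cancel: "su11 T \<Longrightarrow> mul T (mul (adj T) T') = T'"
  by (simp add: mul_adj flip: mul_assoc)

text \<open>Criticality says that \<open>Im a * Im (fst X)\<close> equals
  \<open>Re (b * cnj (snd X))\<close>. On \<open>\<bar>Re a\<bar> \<le> 1\<close> the determinant
  gives \<open>cmod b \<le> \<bar>Im a\<bar>\<close>, while \<open>X\<close> satisfies the strict
  inequality \<open>cmod (snd X) < \<bar>Im (fst X)\<bar>\<close>. Both together leave only
  \<open>Im a = 0\<close> and \<open>b = 0\<close>.\<close>

lemma critical_monodromy:
  assumes T: "su11 T" and X: "Re (fst (mul (adj T) T')) = 0" "Im (fst (mul (adj T) T')) < - cmod (snd (mul (adj T) T'))"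
    and h: "\<bar>Re (fst T)\<bar> \<le> 1" "Re (fst T') = 0"
  shows "\<bar>Re (fst T)\<bar> = 1" "Im (fst T) = 0" "snd T = 0"
proof -
  define X where "X = mul (adj T) T'"
  define a b where "a = fst T" and "b = snd T"
  have X': "Re (fst X) = 0" "Im (fst X) < - cmod (snd X)" using X by (simp_all add: X_def)
  have det: "(Re a)\<^sup>2 + (Im a)\<^sup>2 - (cmod b)\<^sup>2 = 1"
    using T unfolding cmod_power2 by (simp add: su11_def a_def b_def complex_eq_iff power2_eq_square)
  have "(Re a)\<^sup>2 \<le> 1" using h by (simp add: a_def abs_square_le_1)
  then have "(cmod b)\<^sup>2 \<le> \<bar>Im a\<bar>\<^sup>2" using det by simp
  then have b: "cmod b \<le> \<bar>Im a\<bar>" by (rule power2_le_imp_le) simp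
  have "0 = Re (fst (mul T X))" using h mul_adj_cancel[OF T] by (simp add: X_def)
  also have "\<dots> = - (Im a * Im (fst X)) + Re (b * cnj (snd X))"
    by (simp add: mul_def a_def b_def X'(1))
  finally have eq: "Im a * Im (fst X) = Re (b * cnj (snd X))" by simp
  have Im0: "Im a = 0"
  proof (rule ccontr)
    assume "Im a \<noteq> 0"
    have "\<bar>Im a\<bar> * \<bar>Im (fst X)\<bar> = \<bar>Re (b * cnj (snd X))\<bar>" by (simp only: abs_mult[symmetric] eq)
    also have "\<dots> \<le> cmod b * cmod (snd X)"
      by (metis abs_Re_le_cmod complex_mod_cnj norm_mult)
    also have "\<dots> \<le> \<bar>Im a\<bar> * cmod (snd X)" using b by (intro mult_right_mono) auto
    finally have "\<bar>Im (fst X)\<bar> \<le> cmod (snd X)" using \<open>Im a \<noteq> 0\<close> by simp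
    then show False using X'(2) by linarith
  qed
  then have "cmod b = 0" using b by simp
  with Im0 show "Im (fst T) = 0" "snd T = 0" by (simp_all add: a_def b_def)
  have "(Re a)\<^sup>2 = 1" using det Im0 \<open>cmod b = 0\<close> by simp
  then show "\<bar>Re (fst T)\<bar> = 1" by (simp add: a_def abs_square_eq_1)
qed

lemma half_trace_has_derivative:
  "(half_trace \<alpha> q has_real_derivative Re (fst (transfer_mat_deriv \<alpha> \<theta> 0 q))) (at \<theta>)"
  unfolding half_trace_def has_real_derivative_iff_has_vector_derivative
  by (intro bounded_linear.has_vector_derivative[OF bounded_linear_Re]
      bounded_linear.has_vector_derivative[OF bounded_linear_fst] transfer_mat_has_derivative)

text \<open>Where the monodromy is \<open>\<plusminus>1\<close>, its off-diagonal entry \<open>b\<close> and the imaginary part of its diagonal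
  entry \<open>a\<close> vanish, with derivatives satisfying \<open>|b'| < |Im a'|\<close>. So \<open>(Re a)\<^sup>2 = 1 + |b|\<^sup>2 - (Im a)\<^sup>2 < 1\<close>
  nearby; no second derivative is needed.\<close>

lemma half_trace_critical:
  assumes D: "in_disk \<alpha>" and q: "0 < q" and h: "\<bar>half_trace \<alpha> q \<theta>\<bar> \<le> 1"
    and crit: "Re (fst (transfer_mat_deriv \<alpha> \<theta> 0 q)) = 0"
  shows "\<bar>half_trace \<alpha> q \<theta>\<bar> = 1" "\<forall>\<^sub>F t in at \<theta>. \<bar>half_trace \<alpha> q t\<bar> < 1"
proof -
  define T T' where "T t = transfer_mat \<alpha> t 0 q" and "T' = transfer_mat_deriv \<alpha> \<theta> 0 q" for t
  have su: "su11 (T t)" for t by (simp add: T_def su11_transfer_mat D)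
  define X where "X = mul (adj (T \<theta>)) T'"
  have X: "Re (fst X) = 0" "Im (fst X) < - cmod (snd X)"
    using light_cone[OF su[of \<theta>], of T'] jform_transfer_mat_deriv[OF D] q unfolding X_def T_def T'_def by blast+
  have T1: "\<bar>Re (fst (T \<theta>))\<bar> = 1" "Im (fst (T \<theta>)) = 0" "snd (T \<theta>) = 0"
    using critical_monodromy[OF su[of \<theta>], of T'] X h crit by (simp_all add: X_def T_def T'_def half_trace_def)
  then show "\<bar>half_trace \<alpha> q \<theta>\<bar> = 1" by (simp add: half_trace_def T_def)
  define s where "s = Re (fst (T \<theta>))"
  have s: "\<bar>s\<bar> = 1" "T \<theta> = (of_real s, 0)" using T1 by (simp_all add: s_def prod_eq_iff complex_eq_iff)
  have T': "T' = (of_real s * fst X, of_real s * snd X)"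
    using mul_adj_cancel[OF su[of \<theta>], of T'] by (simp add: X_def[symmetric]) (simp add: s(2) mul_def)
  have der: "(T has_vector_derivative T') (at \<theta>)"
    unfolding T_def[abs_def] T'_def by (rule transfer_mat_has_derivative)
  note bl = bounded_linear.has_vector_derivative
  have d: "((\<lambda>t. Im (fst (T t))) has_real_derivative s * Im (fst X)) (at \<theta>)"
    "((\<lambda>t. Re (snd (T t))) has_real_derivative s * Re (snd X)) (at \<theta>)"
    "((\<lambda>t. Im (snd (T t))) has_real_derivative s * Im (snd X)) (at \<theta>)"
    using bl[OF bounded_linear_Im bl[OF bounded_linear_fst der]] bl[OF bounded_linear_Re bl[OF bounded_linear_snd der]]
      bl[OF bounded_linear_Im bl[OF bounded_linear_snd der]]
    by (simp_all add: has_real_derivative_iff_has_vector_derivative T')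
  \<comment> \<open>By the determinant, \<open>(Re a)\<^sup>2 = 1 - Q\<close>. All three squared
    entries vanish at \<theta>, so dividing by \<open>(t - \<theta>)\<^sup>2\<close> produces
    squares of difference quotients.\<close>
  define Q where "Q t = (Im (fst (T t)))\<^sup>2 - (Re (snd (T t)))\<^sup>2 - (Im (snd (T t)))\<^sup>2" for t
  have "((\<lambda>t. (Im (fst (T t)) / (t - \<theta>))\<^sup>2 - (Re (snd (T t)) / (t - \<theta>))\<^sup>2 - (Im (snd (T t)) / (t - \<theta>))\<^sup>2)
      \<longlongrightarrow> (s * Im (fst X))\<^sup>2 - (s * Re (snd X))\<^sup>2 - (s * Im (snd X))\<^sup>2) (at \<theta>)"
    using d unfolding has_field_derivative_iff by (intro tendsto_intros) (simp_all add: T1)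
  moreover have "(s * Im (fst X))\<^sup>2 - (s * Re (snd X))\<^sup>2 - (s * Im (snd X))\<^sup>2 = (Im (fst X))\<^sup>2 - (cmod (snd X))\<^sup>2"
  proof -
    have "s\<^sup>2 = 1" using s(1) by (simp add: abs_square_eq_1[symmetric])
    then show ?thesis by (simp add: power_mult_distrib cmod_power2)
  qed
  moreover have "(\<lambda>t. (Im (fst (T t)) / (t - \<theta>))\<^sup>2 - (Re (snd (T t)) / (t - \<theta>))\<^sup>2 - (Im (snd (T t)) / (t - \<theta>))\<^sup>2)
      = (\<lambda>t. Q t / (t - \<theta>)\<^sup>2)"
    by (simp add: Q_def power_divide diff_divide_distrib)
  ultimately have lim: "((\<lambda>t. Q t / (t - \<theta>)\<^sup>2) \<longlongrightarrow> (Im (fst X))\<^sup>2 - (cmod (snd X))\<^sup>2) (at \<theta>)" by simp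
  have "(cmod (snd X))\<^sup>2 < (- Im (fst X))\<^sup>2" using X(2) by (intro power_strict_mono) auto
  then have "0 < (Im (fst X))\<^sup>2 - (cmod (snd X))\<^sup>2" by simp
  with lim have "\<forall>\<^sub>F t in at \<theta>. 0 < Q t / (t - \<theta>)\<^sup>2" by (rule order_tendstoD(1))
  then show "\<forall>\<^sub>F t in at \<theta>. \<bar>half_trace \<alpha> q t\<bar> < 1"
  proof eventually_elim
    case (elim t)
    then have "0 < Q t" by (auto simp: zero_less_divide_iff)
    moreover have "(Re (fst (T t)))\<^sup>2 + (Im (fst (T t)))\<^sup>2 - (Re (snd (T t)))\<^sup>2 - (Im (snd (T t)))\<^sup>2 = 1"
      using su[of t] by (simp add: su11_def complex_eq_iff power2_eq_square)
    ultimately have "(Re (fst (T t)))\<^sup>2 < 1" by (simp add: Q_def)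
    then show ?case by (simp add: abs_square_less_1 half_trace_def T_def)
  qed
qed

section \<open>Uniform lower bound for the lengths of bands\<close>

lemma nrm_step_mat_deriv_le:
  assumes "\<And>n. cmod (\<alpha> n) \<le> r" "r < 1"
  shows "nrm (step_mat_deriv \<alpha> \<theta> k) \<le> 4 / (1 - r\<^sup>2)"
proof -
  have "nrm (rot_mat_deriv \<alpha> \<theta> (2 * k)) \<le> nrm (rot_mat \<alpha> \<theta> (2 * k))"
    by (simp add: nrm_def rot_mat_deriv_def rot_mat_def norm_divide norm_mult)
  then have "nrm (rot_mat_deriv \<alpha> \<theta> (2 * k)) * nrm (refl_mat \<alpha> (2 * k - 1))
      \<le> nrm (rot_mat \<alpha> \<theta> (2 * k)) * nrm (refl_mat \<alpha> (2 * k - 1))"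
    by (intro mult_right_mono nrm_nonneg)
  also have "\<dots> \<le> 4 / (1 - r\<^sup>2)" by (intro nrm_rot_refl_mat_le assms)
  finally show ?thesis
    unfolding step_mat_deriv_def by (rule order_trans[OF nrm_mul_le])
qed

text \<open>The point is the order of quantifiers: \<open>L\<close> depends on \<open>r\<close> and
  \<open>q\<close> and serves all sequences and all angles. The product rule produces
  \<open>q\<close> terms of size at most \<open>K ^ q\<close>.\<close>

lemma half_trace_deriv_bounded:
  assumes "r < 1"
  shows "\<exists>L>0. \<forall>\<alpha> \<theta>. (\<forall>n. cmod (\<alpha> n) \<le> r) \<longrightarrow> \<bar>Re (fst (transfer_mat_deriv \<alpha> \<theta> 0 q))\<bar> \<le> L"
proof -
  define K where "K = 4 / (1 - r\<^sup>2)"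
  have bound: "nrm (transfer_mat_deriv \<alpha> \<theta> 0 n) \<le> real n * K ^ n" if r: "\<And>n. cmod (\<alpha> n) \<le> r" for \<alpha> \<theta> n
  proof (induction n)
    case 0
    then show ?case by (simp add: nrm_def)
  next
    case (Suc n)
    have "0 \<le> K" unfolding K_def
      using order_trans[OF nrm_nonneg nrm_step_mat_le[of \<alpha> r, OF r assms]] .
    have "nrm (transfer_mat_deriv \<alpha> \<theta> 0 (Suc n)) \<le> K * K ^ n + K * (real n * K ^ n)"
      unfolding transfer_mat_deriv.simps K_def
      by (intro order_trans[OF nrm_triangle] add_mono order_trans[OF nrm_mul_le] mult_mono nrm_nonneg
          nrm_step_mat_deriv_le nrm_step_mat_le nrm_transfer_mat_le r assms Suc[unfolded K_def]
          \<open>0 \<le> K\<close>[unfolded K_def])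
    then show ?case by (simp add: algebra_simps)
  qed
  have "\<bar>Re (fst (transfer_mat_deriv \<alpha> \<theta> 0 q))\<bar> \<le> \<bar>real q * K ^ q\<bar> + 1" if "\<And>n. cmod (\<alpha> n) \<le> r" for \<alpha> \<theta>
  proof -
    have "\<bar>Re (fst (transfer_mat_deriv \<alpha> \<theta> 0 q))\<bar> \<le> nrm (transfer_mat_deriv \<alpha> \<theta> 0 q)"
      unfolding nrm_def by (rule order_trans[OF abs_Re_le_cmod]) simp
    then show ?thesis using bound[of \<alpha> \<theta> q, OF that] by linarith
  qed
  then show ?thesis by (intro exI[of _ "\<bar>real q * K ^ q\<bar> + 1"]) (auto simp: add_nonneg_pos)
qed

text \<open>Suppose \<open>\<bar>f\<bar>\<close> exceeds 1 within \<delta> on both sides. Over a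
  length of at most \<open>2 * \<delta> = 1 / L\<close> the function varies by at most 1, hence
  keeps its sign, say positive. Then it has an interior minimum with value in \<open>(0, 1]\<close>;
  by \<open>crit\<close> the value is 1 and nearby values are smaller, which is absurd.\<close>

lemma one_sided_band:
  fixes f f' :: "real \<Rightarrow> real"
  assumes der: "\<And>t. (f has_real_derivative f' t) (at t)" and L: "\<And>t. \<bar>f' t\<bar> \<le> L" "0 < L"
    and crit: "\<And>t. \<bar>f t\<bar> \<le> 1 \<Longrightarrow> f' t = 0 \<Longrightarrow> \<bar>f t\<bar> = 1 \<and> (\<forall>\<^sub>F s in at t. \<bar>f s\<bar> < 1)"
    and \<theta>: "\<bar>f \<theta>\<bar> \<le> 1" and \<delta>: "\<delta> = 1 / (2 * L)"
  shows "(\<forall>t\<in>{\<theta>..\<theta> + \<delta>}. \<bar>f t\<bar> \<le> 1) \<or> (\<forall>t\<in>{\<theta> - \<delta>..\<theta>}. \<bar>f t\<bar> \<le> 1)"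
proof (rule ccontr)
  assume "\<not> ?thesis"
  then obtain s t where st: "\<theta> - \<delta> \<le> s" "s \<le> \<theta>" "\<theta> \<le> t" "t \<le> \<theta> + \<delta>" "1 < \<bar>f s\<bar>" "1 < \<bar>f t\<bar>"
    by (auto simp: not_le)
  have False if der: "\<And>t. (g has_real_derivative g' t) (at t)" and L: "\<And>t. \<bar>g' t\<bar> \<le> L"
    and crit: "\<And>t. \<bar>g t\<bar> \<le> 1 \<Longrightarrow> g' t = 0 \<Longrightarrow> \<bar>g t\<bar> = 1 \<and> (\<forall>\<^sub>F s in at t. \<bar>g s\<bar> < 1)"
    and \<theta>: "\<bar>g \<theta>\<bar> \<le> 1" and gs: "1 < \<bar>g s\<bar>" and gt: "1 < g t" for g g' :: "real \<Rightarrow> real"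
  proof -
    have lip: "\<bar>g x - g t\<bar> \<le> 1" if "x \<in> {s..t}" for x
    proof -
      have "norm (g x - g t) \<le> L * norm (x - t)"
        by (rule field_differentiable_bound[of UNIV g g'])
           (use der L in \<open>auto intro: has_field_derivative_at_within\<close>)
      also have "\<dots> \<le> L * (2 * \<delta>)" using that st \<open>0 < L\<close> by (intro mult_left_mono) auto
      also have "\<dots> = 1" using \<open>0 < L\<close> by (simp add: \<delta>)
      finally show ?thesis by simp
    qed
    have pos: "0 < g x" if "x \<in> {s..t}" for x using lip[OF that] gt by linarith
    have cont: "continuous_on {s..t} g"
      using der by (meson DERIV_isCont continuous_at_imp_continuous_on)
    obtain m where m: "m \<in> {s..t}" "\<And>x. x \<in> {s..t} \<Longrightarrow> g m \<le> g x"
      using continuous_attains_inf[OF _ _ cont] st by auto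
    have "g m \<le> 1" using m(2)[of \<theta>] \<theta> st by simp
    moreover have "1 < g s" using gs pos[of s] st by simp
    ultimately have "s < m" "m < t" using m(1) gt by (auto simp: less_le)
    have gm: "\<bar>g m\<bar> \<le> 1" using \<open>g m \<le> 1\<close> pos[OF m(1)] by simp
    define d where "d = min (m - s) (t - m)"
    have d: "0 < d" using \<open>s < m\<close> \<open>m < t\<close> by (simp add: d_def)
    have "\<forall>y. \<bar>m - y\<bar> < d \<longrightarrow> g m \<le> g y"
    proof (intro allI impI)
      fix y assume "\<bar>m - y\<bar> < d"
      then have "y \<in> {s..t}" unfolding d_def atLeastAtMost_iff by linarith
      then show "g m \<le> g y" by (rule m(2))
    qed
    then have "g' m = 0" using DERIV_local_min[OF der d] by blast
    with crit[OF gm] have "\<bar>g m\<bar> = 1" and ev: "\<forall>\<^sub>F s in at m. \<bar>g s\<bar> < 1" by auto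
    then have "g m = 1" using pos[OF m(1)] by simp
    have "\<forall>\<^sub>F y in at m. y \<in> {s<..<t}"
      using \<open>s < m\<close> \<open>m < t\<close> by (intro eventually_at_in_open') auto
    then have "\<forall>\<^sub>F y in at m. 1 \<le> g y"
      by eventually_elim (use m(2) \<open>g m = 1\<close> in auto)
    with ev have "\<forall>\<^sub>F y in at m. False" by eventually_elim auto
    then show False by simp
  qed
  note * = this
  show False
  proof (cases "0 < f t")
    case True
    then show False using *[of f f'] der L crit \<theta> st by auto
  next
    case False
    show False
      by (rule *[of "\<lambda>t. - f t" "\<lambda>t. - f' t"])
         (use False der L crit \<theta> st in \<open>auto intro: DERIV_minus\<close>)
  qed
qed

subsection \<open>Opening gaps\<close>

text \<open>The Chebyshev formula for powers of a matrix of determinant 1 and trace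
  \<open>2 * cos \<phi>\<close>: its \<open>N\<close>-th power times \<open>sin \<phi>\<close> is
  \<open>sin (N \<phi>)\<close> times the matrix minus \<open>sin ((N - 1) \<phi>)\<close>. Keeping
  \<open>sin \<phi>\<close> on the left avoids a division at the band edges.\<close>

lemma transfer_mat_multiple:
  assumes D: "in_disk \<alpha>" and per: "\<And>n. \<alpha> (n + 2 * int q) = \<alpha> n" and \<phi>: "half_trace \<alpha> q \<theta> = cos \<phi>"
  shows "of_real (sin \<phi>) * fst (transfer_mat \<alpha> \<theta> 0 (N * q))
      = of_real (sin (real N * \<phi>)) * fst (transfer_mat \<alpha> \<theta> 0 q) - of_real (sin ((real N - 1) * \<phi>)) \<and>
    of_real (sin \<phi>) * snd (transfer_mat \<alpha> \<theta> 0 (N * q)) = of_real (sin (real N * \<phi>)) * snd (transfer_mat \<alpha> \<theta> 0 q)"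
proof (induction N)
  case 0
  then show ?case by simp
next
  case (Suc N)
  define a b where "a = fst (transfer_mat \<alpha> \<theta> 0 q)" and "b = snd (transfer_mat \<alpha> \<theta> 0 q)"
  define x y where "x = fst (transfer_mat \<alpha> \<theta> 0 (N * q))" and "y = snd (transfer_mat \<alpha> \<theta> 0 (N * q))"
  define s S S' where "s = complex_of_real (sin \<phi>)" and "S = complex_of_real (sin (real N * \<phi>))"
    and "S' = complex_of_real (sin ((real N - 1) * \<phi>))"
  have "transfer_mat \<alpha> \<theta> (int (N * q)) q = transfer_mat \<alpha> \<theta> 0 q" for N
  proof (induction N)
    case (Suc N)
    then show ?case
      using transfer_mat_periodic[of \<alpha> q \<theta> "int (N * q)" q, OF per] by (simp add: algebra_simps)
  qed simp
  then have T: "transfer_mat \<alpha> \<theta> 0 (Suc N * q) = mul (transfer_mat \<alpha> \<theta> 0 q) (transfer_mat \<alpha> \<theta> 0 (N * q))"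
    using transfer_mat_add[of \<alpha> \<theta> 0 "N * q" q] by (simp add: add.commute)
  have xy: "fst (transfer_mat \<alpha> \<theta> 0 (Suc N * q)) = a * x + b * cnj y"
    "snd (transfer_mat \<alpha> \<theta> 0 (Suc N * q)) = a * y + b * cnj x"
    unfolding T by (simp_all add: mul_def a_def b_def x_def y_def)
  have IH: "s * x = S * a - S'" "s * y = S * b"
    using Suc by (simp_all add: s_def S_def S'_def a_def b_def x_def y_def)
  then have "cnj (s * x) = cnj (S * a - S')" "cnj (s * y) = cnj (S * b)" by simp_all
  then have IH': "s * cnj x = S * cnj a - S'" "s * cnj y = S * cnj b"
    by (simp_all add: s_def S_def S'_def)
  have det: "a * cnj a - b * cnj b = 1"
    using su11_transfer_mat[OF D, of \<theta> 0 q] by (simp add: su11_def a_def b_def)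
  have tr: "a + cnj a = of_real (2 * cos \<phi>)"
    using \<phi> by (simp add: complex_add_cnj half_trace_def a_def)
  have rec: "of_real (2 * cos \<phi>) * S - S' = of_real (sin (real (Suc N) * \<phi>))"
  proof -
    have "sin (real (Suc N) * \<phi>) = sin (real N * \<phi> + \<phi>)" "sin ((real N - 1) * \<phi>) = sin (real N * \<phi> - \<phi>)"
      by (simp_all add: algebra_simps)
    then have "2 * cos \<phi> * sin (real N * \<phi>) - sin ((real N - 1) * \<phi>) = sin (real (Suc N) * \<phi>)"
      by (simp add: sin_add sin_diff)
    then show ?thesis unfolding S_def S'_def by (metis of_real_diff of_real_mult)
  qed
  have "s * (a * x + b * cnj y) = a * (s * x) + b * (s * cnj y)" by (simp add: algebra_simps)
  also have "\<dots> = a * (S * (a + cnj a) - S') - S * (a * cnj a - b * cnj b)"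
    unfolding IH IH' by (simp add: algebra_simps)
  also have "\<dots> = (of_real (2 * cos \<phi>) * S - S') * a - S" unfolding det tr by (simp add: algebra_simps)
  finally have 1: "s * (a * x + b * cnj y) = of_real (sin (real (Suc N) * \<phi>)) * a - S" unfolding rec .
  have "s * (a * y + b * cnj x) = a * (s * y) + b * (s * cnj x)" by (simp add: algebra_simps)
  also have "\<dots> = (S * (a + cnj a) - S') * b" unfolding IH IH' by (simp add: algebra_simps)
  also have "\<dots> = (of_real (2 * cos \<phi>) * S - S') * b" unfolding tr by (simp add: algebra_simps)
  finally have 2: "s * (a * y + b * cnj x) = of_real (sin (real (Suc N) * \<phi>)) * b" unfolding rec .
  have "(real (Suc N) - 1) * \<phi> = real N * \<phi>" by simp
  then show ?case
    unfolding xy using 1 2 by (simp add: s_def[symmetric] a_def[symmetric] b_def[symmetric] S_def)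
qed

text \<open>At these angles \<open>sin (N \<phi>) = 0\<close>, so only the scalar term of the
  Chebyshev formula survives. The bounds on \<open>j\<close> exclude \<open>sin \<phi> = 0\<close>,
  where the monodromy may be parabolic.\<close>

lemma transfer_mat_closed_gap:
  assumes D: "in_disk \<alpha>" and per: "\<And>n. \<alpha> (n + 2 * int q) = \<alpha> n"
    and h: "half_trace \<alpha> q \<theta> = cos (pi * real j / real N)" and j: "0 < j" "j < N"
  shows "\<exists>s. \<bar>s\<bar> = 1 \<and> transfer_mat \<alpha> \<theta> 0 (N * q) = (complex_of_real s, 0)"
proof -
  define \<phi> where "\<phi> = pi * real j / real N"
  have N\<phi>: "real N * \<phi> = pi * real j" using j by (simp add: \<phi>_def)
  have "0 < \<phi>" "\<phi> < pi" using j by (simp_all add: \<phi>_def field_simps)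
  then have s: "sin \<phi> \<noteq> 0" using sin_gt_zero by force
  have "sin (real N * \<phi>) = 0" unfolding N\<phi> by (simp add: mult.commute)
  moreover have "(real N - 1) * \<phi> = pi * real j - \<phi>" using N\<phi> by (simp add: algebra_simps)
  then have "sin ((real N - 1) * \<phi>) = - (cos (pi * real j) * sin \<phi>)"
    by (simp add: sin_diff mult.commute[of pi])
  ultimately have "of_real (sin \<phi>) * fst (transfer_mat \<alpha> \<theta> 0 (N * q)) = of_real (sin \<phi>) * of_real (cos (pi * real j))"
    "of_real (sin \<phi>) * snd (transfer_mat \<alpha> \<theta> 0 (N * q)) = 0"
    using transfer_mat_multiple[of \<alpha> q \<theta> \<phi> N, OF D per] h by (simp_all add: \<phi>_def[symmetric] mult.commute)
  then have "transfer_mat \<alpha> \<theta> 0 (N * q) = (of_real (cos (pi * real j)), 0)"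
    using s by (simp add: prod_eq_iff)
  moreover have "\<bar>cos (pi * real j)\<bar> = 1"
    using cos_npi2[of j] by (simp add: power_abs)
  ultimately show ?thesis by blast
qed

text \<open>The arithmetic-geometric mean inequality for the two square roots; half of
  \<open>(cmod (a - c))\<^sup>2\<close> is what makes it strict.\<close>

lemma rho_mult_less:
  fixes a c :: complex
  assumes "cmod a < 1" "cmod c < 1" "a \<noteq> c"
  shows "sqrt (1 - (cmod a)\<^sup>2) * sqrt (1 - (cmod c)\<^sup>2) < 1 - Re (a * cnj c)"
proof -
  define x y where "x = sqrt (1 - (cmod a)\<^sup>2)" and "y = sqrt (1 - (cmod c)\<^sup>2)"
  have "(cmod a)\<^sup>2 \<le> 1" "(cmod c)\<^sup>2 \<le> 1" using assms by (simp_all add: abs_square_le_1)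
  then have xy: "x\<^sup>2 = 1 - (cmod a)\<^sup>2" "y\<^sup>2 = 1 - (cmod c)\<^sup>2" by (simp_all add: x_def y_def)
  have "2 * x * y \<le> x\<^sup>2 + y\<^sup>2" by (rule sum_squares_bound)
  also have "\<dots> = 2 * (1 - Re (a * cnj c)) - (cmod (a - c))\<^sup>2"
    unfolding xy cmod_power2 by (simp add: power2_eq_square algebra_simps)
  also have "\<dots> < 2 * (1 - Re (a * cnj c))" using assms(3) by simp
  finally show ?thesis by (simp add: x_def y_def)
qed

text \<open>At a closed gap \<open>T = \<plusminus>1\<close>. Changing one coefficient multiplies \<open>T\<close> by a product of two distinct
  positive definite matrices of determinant 1, whose trace exceeds 2.\<close>

lemma gap_opens:
  assumes D: "in_disk \<alpha>" "in_disk \<beta>" and Q: "0 < Q"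
    and same: "\<And>n. 0 \<le> n \<Longrightarrow> n < 2 * int Q - 1 \<Longrightarrow> \<beta> n = \<alpha> n" and diff: "\<beta> (-1) \<noteq> \<alpha> (-1)"
    and T: "transfer_mat \<alpha> \<theta> 0 Q = (of_real s, 0)" "\<bar>s\<bar> = 1"
  shows "1 < \<bar>half_trace \<beta> Q \<theta>\<bar>"
proof -
  obtain m where m: "Q = Suc m" using Q by (cases Q) auto
  have "transfer_mat \<beta> \<theta> 1 n = transfer_mat \<alpha> \<theta> 1 n" if "n \<le> m" for n
    using that
  proof (induction n)
    case (Suc n)
    then have "\<beta> (2 * (1 + int n)) = \<alpha> (2 * (1 + int n))" "\<beta> (2 * (1 + int n) - 1) = \<alpha> (2 * (1 + int n) - 1)"
      using m by (intro same; simp)+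
    with Suc show ?case by (simp add: step_mat_def rot_mat_def refl_mat_def cmv_rho_def)
  qed simp
  then have R: "transfer_mat \<beta> \<theta> 1 m = transfer_mat \<alpha> \<theta> 1 m" by simp
  have rot: "rot_mat \<beta> \<theta> 0 = rot_mat \<alpha> \<theta> 0"
    using same[of 0] Q by (simp add: rot_mat_def cmv_rho_def)
  \<comment> \<open>The matrix over \<open>Q\<close> steps uses the sites from -1 to
    \<open>2 * Q - 2\<close>, and the coefficient at -1 occurs only in the rightmost factor.
    Everything to its left is common to both sequences and is determined by the closed gap.\<close>
  define P where "P = mul (transfer_mat \<alpha> \<theta> 1 m) (rot_mat \<alpha> \<theta> 0)"
  have T\<alpha>: "transfer_mat \<alpha> \<theta> 0 Q = mul P (refl_mat \<alpha> (-1))"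
    using transfer_mat_add[of \<alpha> \<theta> 0 1 m] by (simp add: m P_def step_mat_def mul_assoc)
  have T\<beta>: "transfer_mat \<beta> \<theta> 0 Q = mul P (refl_mat \<beta> (-1))"
    using transfer_mat_add[of \<beta> \<theta> 0 1 m] by (simp add: m P_def step_mat_def mul_assoc R rot)
  have "mul (mul P (refl_mat \<alpha> (-1))) (adj (refl_mat \<alpha> (-1))) = P"
    by (simp add: mul_assoc mul_adj su11_refl_mat D)
  then have P: "P = mul (of_real s, 0) (adj (refl_mat \<alpha> (-1)))" by (simp add: T(1) flip: T\<alpha>)
  define x y where "x = cmv_rho \<alpha> (-1)" and "y = cmv_rho \<beta> (-1)"
  have xy: "0 < x" "0 < y" using cmv_rho_pos D by (simp_all add: x_def y_def)
  have "half_trace \<beta> Q \<theta> = s * ((1 - Re (\<alpha> (-1) * cnj (\<beta> (-1)))) / (x * y))"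
    unfolding half_trace_def T\<beta> P using xy
    by (simp add: mul_def adj_def refl_mat_def x_def[symmetric] y_def[symmetric] diff_divide_distrib
        add_divide_distrib right_diff_distrib distrib_left flip: of_real_mult)
  moreover have "x * y < 1 - Re (\<alpha> (-1) * cnj (\<beta> (-1)))"
    unfolding x_def y_def cmv_rho_def using D diff by (intro rho_mult_less) (auto simp: in_disk_def)
  then have "1 < (1 - Re (\<alpha> (-1) * cnj (\<beta> (-1)))) / (x * y)" using xy by simp
  ultimately show ?thesis using T(2) by (metis abs_ge_self abs_mult less_le_trans mult_1)
qed

section \<open>Opening gaps in all arcs of a grid\<close>

lemma half_trace_tendsto:
  assumes D: "in_disk \<alpha>" and lim: "\<And>n. (\<lambda>j. \<beta> j n) \<longlonglongrightarrow> \<alpha> n"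
  shows "(\<lambda>j. half_trace (\<beta> j) q \<theta>) \<longlonglongrightarrow> half_trace \<alpha> q \<theta>"
proof -
  have rho: "(\<lambda>j. complex_of_real (cmv_rho (\<beta> j) n)) \<longlonglongrightarrow> of_real (cmv_rho \<alpha> n)" for n
    unfolding cmv_rho_def by (intro tendsto_intros lim)
  have mul: "(\<lambda>j. mul (S j) (T j)) \<longlonglongrightarrow> mul S' T'" if "S \<longlonglongrightarrow> S'" "T \<longlonglongrightarrow> T'" for S T S' T'
    using bounded_bilinear.tendsto[OF bounded_bilinear_mul that] .
  have step: "(\<lambda>j. step_mat (\<beta> j) \<theta> k) \<longlonglongrightarrow> step_mat \<alpha> \<theta> k" for k
    unfolding step_mat_def rot_mat_def refl_mat_def
    by (intro mul tendsto_intros rho lim rho_nz D)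
  have "(\<lambda>j. transfer_mat (\<beta> j) \<theta> 0 n) \<longlonglongrightarrow> transfer_mat \<alpha> \<theta> 0 n" for n
    by (induction n) (auto intro!: mul step)
  then show ?thesis unfolding half_trace_def by (intro tendsto_intros)
qed

text \<open>On an interval of the spectrum the half trace cannot be constant: every interior point
  would be critical, hence of modulus 1, yet have modulus below 1 at its neighbours. So its range
  contains an interval, and the values at which the \<open>N\<close>-fold monodromy is
  \<open>\<plusminus>1\<close> become dense as \<open>N\<close> grows.\<close>

lemma half_trace_hits_cosines:
  assumes D: "in_disk \<alpha>" and q: "0 < q" and st: "s < t" and le: "\<And>x. x \<in> {s..t} \<Longrightarrow> \<bar>half_trace \<alpha> q x\<bar> \<le> 1"
  shows "\<exists>N\<^sub>0. \<forall>N\<ge>N\<^sub>0. \<exists>x\<in>{s..t}. \<exists>j. 0 < j \<and> j < N \<and> half_trace \<alpha> q x = cos (pi * real j / real N)"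
proof -
  define f where "f = half_trace \<alpha> q"
  define f' where "f' \<theta> = Re (fst (transfer_mat_deriv \<alpha> \<theta> 0 q))" for \<theta>
  have der: "(f has_real_derivative f' x) (at x)" for x
    unfolding f_def f'_def by (rule half_trace_has_derivative)
  have le: "\<bar>f x\<bar> \<le> 1" if "x \<in> {s..t}" for x using le[OF that] by (simp add: f_def)
  have crit: "\<bar>f x\<bar> = 1 \<and> (\<forall>\<^sub>F y in at x. \<bar>f y\<bar> < 1)" if "\<bar>f x\<bar> \<le> 1" "f' x = 0" for x
    using half_trace_critical[OF D q, of x] that unfolding f_def f'_def by blast
  have "\<exists>x\<in>{s..t}. \<exists>y\<in>{s..t}. f x < f y"
  proof (rule ccontr)
    assume "\<not> ?thesis"
    then have const: "f x = f s" if "x \<in> {s..t}" for x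
      using that st by (meson antisym_conv3 atLeastAtMost_iff less_imp_le order_refl)
    have d0: "f' x = 0" if "s < x" "x < t" for x
    proof (rule DERIV_local_const[OF der])
      show "0 < min (x - s) (t - x)" using that by simp
      show "\<forall>y. \<bar>x - y\<bar> < min (x - s) (t - x) \<longrightarrow> f x = f y"
        using that const by (smt (verit) atLeastAtMost_iff min_less_iff_conj)
    qed
    define m where "m = (s + t) / 2"
    have m: "s < m" "m < t" using st by (simp_all add: m_def)
    have "\<forall>\<^sub>F y in at m. \<bar>f y\<bar> < 1" using crit[of m] d0[OF m] le[of m] m by auto
    moreover have "\<forall>\<^sub>F y in at m. y \<in> {s<..<t}"
      using m by (intro eventually_at_in_open') auto
    ultimately have "\<forall>\<^sub>F y in at m. False"
    proof eventually_elim
      case (elim y)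
      then show False using crit[of y] d0[of y] le[of y] by auto
    qed
    then show False by simp
  qed
  then obtain x y where xy: "x \<in> {s..t}" "y \<in> {s..t}" "f x < f y" by blast
  define u v where "u = f x" and "v = f y"
  have uv: "-1 \<le> u" "u < v" "v \<le> 1" using le[OF xy(1)] le[OF xy(2)] xy(3) by (auto simp: u_def v_def)
  define w where "w = arccos u - arccos v"
  have "arccos v < arccos u" using uv by (intro arccos_less_arccos) auto
  then have w: "0 < w" by (simp add: w_def)
  \<comment> \<open>From here on the angular mesh \<open>pi / N\<close> is smaller than the width
    \<open>w\<close> of the range in the variable \<open>arccos\<close>.\<close>
  obtain N\<^sub>0 :: nat where N\<^sub>0: "pi / w < real N\<^sub>0" using reals_Archimedean2 by blast
  show ?thesis
  proof (intro exI[of _ N\<^sub>0] allI impI)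
    fix N assume "N \<ge> N\<^sub>0"
    then have N: "pi / w < real N" using N\<^sub>0 by linarith
    then have N0: "0 < real N" using w by (meson divide_pos_pos less_trans pi_gt_zero)
    define X where "X = real N * arccos v / pi"
    have av: "0 \<le> arccos v" "arccos u \<le> pi" using uv by (auto intro: arccos_lbound arccos_ubound)
    have X0: "0 \<le> X" using av N0 by (simp add: X_def)
    \<comment> \<open>The first mesh point strictly above \<open>arccos v\<close>; strictness
      ensures \<open>0 < j\<close>.\<close>
    define j where "j = nat \<lfloor>X\<rfloor> + 1"
    have j: "X < real j" "real j \<le> X + 1" using X0 by (simp_all add: j_def) linarith+
    define \<phi> where "\<phi> = pi * real j / real N"
    have \<phi>: "arccos v < \<phi>" "\<phi> \<le> arccos v + pi / real N"
    proof -
      have "pi * X / real N = arccos v" using N0 by (simp add: X_def)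
      moreover have "pi * X / real N < \<phi>" "\<phi> \<le> pi * (X + 1) / real N"
        unfolding \<phi>_def using j N0 by (auto intro!: divide_strict_right_mono divide_right_mono)
      ultimately show "arccos v < \<phi>" "\<phi> \<le> arccos v + pi / real N"
        by (simp_all add: algebra_simps add_divide_distrib)
    qed
    have "pi / real N < w" using N N0 w by (simp add: field_simps)
    then have \<phi>u: "\<phi> < arccos u" using \<phi> by (simp add: w_def)
    have "0 < j" using X0 j(1) by linarith
    moreover have "j < N"
    proof -
      have "pi * real j / real N < pi * 1" using \<phi>u av(2) by (simp add: \<phi>_def)
      then have "real j / real N < 1" by (simp only: times_divide_eq_right[symmetric] mult_less_cancel_left_pos[OF pi_gt_zero])
      then show ?thesis using N0 by (simp add: field_simps)
    qed
    moreover have "\<exists>z\<in>{s..t}. f z = cos \<phi>"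
    proof -
      have "cos \<phi> \<in> {u..v}"
      proof -
        have "cos (arccos u) < cos \<phi>" "cos \<phi> < cos (arccos v)"
          using \<phi>(1) \<phi>u av by (intro cos_monotone_0_pi; simp)+
        then show ?thesis using uv by (simp add: cos_arccos)
      qed
      moreover have "connected (f ` {s..t})"
        using der by (intro connected_continuous_image) (auto intro: DERIV_isCont continuous_at_imp_continuous_on)
      ultimately have "cos \<phi> \<in> f ` {s..t}"
        using connected_contains_Icc[of "f ` {s..t}" u v] xy by (auto simp: u_def v_def)
      then show ?thesis by force
    qed
    ultimately show "\<exists>x\<in>{s..t}. \<exists>j. 0 < j \<and> j < N \<and> half_trace \<alpha> q x = cos (pi * real j / real N)"
      unfolding f_def \<phi>_def by blast
  qed
qed

text \<open>Total disconnectedness split into finitely many conditions for each scale. For a closed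
  set each of them survives small perturbations, so they can be secured one scale at a time. For
  \<open>M = 0\<close> the condition is vacuous.\<close>

definition gridded :: "nat \<Rightarrow> complex set \<Rightarrow> bool" where
  "gridded M K \<longleftrightarrow> (\<forall>i<M. \<exists>s\<in>{2 * pi * real i / real M..2 * pi * real (Suc i) / real M}. cis s \<notin> K)"

text \<open>An arc inside the spectrum contains a closed gap of the \<open>N\<close>-fold period,
  which any change of the coefficient at -1 opens. An arc already meeting the complement keeps doing
  so under small changes. The closed gaps exist for all large \<open>N\<close>, so one
  \<open>N\<close> serves all arcs.\<close>

lemma gap_opening:
  assumes r: "\<And>n. cmod (\<alpha> n) \<le> r" "r < 1" and per: "\<And>n. \<alpha> (n + 2 * int q) = \<alpha> n" and q: "0 < q" and M: "0 < M"
  shows "\<exists>Q \<beta>. 0 < Q \<and> (\<forall>n. \<alpha> (n + 2 * int Q) = \<alpha> n) \<and>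
    (\<forall>j n. \<beta> j (n + 2 * int Q) = \<beta> j n) \<and> (\<forall>j n. cmod (\<beta> j n) \<le> (1 + r) / 2) \<and>
    (\<forall>j n. cmod (\<beta> j n - \<alpha> n) \<le> 1 / real (Suc j)) \<and> (\<forall>\<^sub>F j in sequentially. gridded M (cmv_spectrum (\<beta> j)))"
proof -
  have D: "in_disk \<alpha>" using r by (rule in_diskI)
  define I where "I i = {2 * pi * real i / real M..2 * pi * real (Suc i) / real M}" for i
  define full where "full i \<longleftrightarrow> (\<forall>x\<in>I i. \<bar>half_trace \<alpha> q x\<bar> \<le> 1)" for i
  have "\<exists>N\<^sub>0. \<forall>N\<ge>N\<^sub>0. \<exists>x\<in>I i. \<exists>j. 0 < j \<and> j < N \<and> half_trace \<alpha> q x = cos (pi * real j / real N)" if "full i" for i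
  proof -
    have "2 * pi * real i / real M < 2 * pi * real (Suc i) / real M"
      using M by (intro divide_strict_right_mono mult_strict_left_mono) auto
    then show ?thesis
      unfolding I_def using that half_trace_hits_cosines[OF D q] by (auto simp: full_def I_def)
  qed
  then obtain N\<^sub>0 where N\<^sub>0: "\<And>i N. full i \<Longrightarrow> N\<^sub>0 i \<le> N \<Longrightarrow>
      \<exists>x\<in>I i. \<exists>j. 0 < j \<and> j < N \<and> half_trace \<alpha> q x = cos (pi * real j / real N)"
    by metis
  \<comment> \<open>The sum dominates every threshold, and the successor makes \<open>N\<close>
    positive.\<close>
  define N where "N = Suc (\<Sum>i<M. N\<^sub>0 i)"
  have N: "N\<^sub>0 i \<le> N" if "i < M" for i
  proof -
    have "N\<^sub>0 i \<le> (\<Sum>i<M. N\<^sub>0 i)" using that by (intro member_le_sum) auto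
    then show ?thesis by (simp add: N_def)
  qed
  define Q where "Q = N * q"
  have Q: "0 < Q" using q by (simp add: Q_def N_def)
  have per_Q: "\<alpha> (n + 2 * int Q) = \<alpha> n" for n
    using periodic_multiple[of \<alpha> "2 * int q" n "int N", OF per] by (simp add: Q_def mult.commute mult.left_commute)
  have "0 \<le> r" using order_trans[OF norm_ge_zero r(1)] .
  \<comment> \<open>The factor \<open>(1 - r) / 2\<close> keeps the perturbed coefficients below
    \<open>(1 + r) / 2\<close>.\<close>
  define \<epsilon> where "\<epsilon> j = (1 - r) / 2 / real (Suc j)" for j
  have \<epsilon>: "0 < \<epsilon> j" "\<epsilon> j \<le> (1 - r) / 2" "\<epsilon> j \<le> 1 / real (Suc j)" for j
  proof -
    have "(1 - r) / 2 / real (Suc j) \<le> (1 - r) / 2 / 1" using r(2) by (intro divide_left_mono) auto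
    then show "0 < \<epsilon> j" "\<epsilon> j \<le> (1 - r) / 2" using r(2) by (simp_all add: \<epsilon>_def)
    show "\<epsilon> j \<le> 1 / real (Suc j)"
      unfolding \<epsilon>_def using r(2) \<open>0 \<le> r\<close> by (intro divide_right_mono) auto
  qed
  \<comment> \<open>The sites congruent to -1 modulo the period \<open>2 * Q\<close> are changed, in
    accordance with \<open>gap_opens\<close>.\<close>
  define \<beta> where "\<beta> j n = (if (n + 1) mod (2 * int Q) = 0 then \<alpha> n + of_real (\<epsilon> j) else \<alpha> n)" for j n
  have \<beta>_dist: "cmod (\<beta> j n - \<alpha> n) \<le> \<epsilon> j" for j n using \<epsilon>(1)[of j] by (simp add: \<beta>_def)
  have \<beta>_le: "cmod (\<beta> j n) \<le> (1 + r) / 2" for j n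
  proof -
    have "cmod (\<beta> j n) \<le> cmod (\<alpha> n) + cmod (\<beta> j n - \<alpha> n)" by (rule norm_triangle_sub)
    also have "\<dots> \<le> r + (1 - r) / 2" using r(1)[of n] \<beta>_dist[of j n] \<epsilon>(2)[of j] by linarith
    finally show ?thesis by (simp add: field_simps)
  qed
  have D\<beta>: "in_disk (\<beta> j)" for j by (rule in_diskI[OF \<beta>_le]) (use r in simp)
  have \<beta>_per: "\<beta> j (n + 2 * int Q) = \<beta> j n" for j n
  proof -
    have "n + 2 * int Q + 1 = (n + 1) + 2 * int Q" by simp
    then have "(n + 2 * int Q + 1) mod (2 * int Q) = (n + 1) mod (2 * int Q)" by (metis mod_add_self2)
    then show ?thesis by (simp add: \<beta>_def per_Q)
  qed
  have r': "(1 + r) / 2 < 1" using r(2) by simp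
  have \<beta>_spec: "cis \<theta> \<in> cmv_spectrum (\<beta> j) \<longleftrightarrow> \<bar>half_trace (\<beta> j) Q \<theta>\<bar> \<le> 1" for \<theta> j
    using cmv_spectrum_periodic[of "\<beta> j" "(1 + r) / 2" Q \<theta>] \<beta>_le r' \<beta>_per Q by blast
  have lim: "(\<lambda>j. half_trace (\<beta> j) Q \<theta>) \<longlonglongrightarrow> half_trace \<alpha> Q \<theta>" for \<theta>
  proof (rule half_trace_tendsto[OF D])
    fix n
    have "norm (\<beta> j n - \<alpha> n) \<le> inverse (real (Suc j))" for j
      using order_trans[OF \<beta>_dist \<epsilon>(3)] by (simp add: inverse_eq_divide)
    then have "(\<lambda>j. \<beta> j n - \<alpha> n) \<longlonglongrightarrow> 0"
      by (intro Lim_null_comparison[OF _ LIMSEQ_inverse_real_of_nat] always_eventually) auto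
    then show "(\<lambda>j. \<beta> j n) \<longlonglongrightarrow> \<alpha> n" by (simp add: LIM_zero_iff)
  qed
  have "\<forall>\<^sub>F j in sequentially. \<exists>s\<in>I i. cis s \<notin> cmv_spectrum (\<beta> j)" if i: "i < M" for i
  proof (cases "full i")
    case True
    then obtain x k where x: "x \<in> I i" "0 < k" "k < N" "half_trace \<alpha> q x = cos (pi * real k / real N)"
      using N\<^sub>0[OF True N[OF i]] by blast
    obtain s where s: "\<bar>s\<bar> = 1" "transfer_mat \<alpha> x 0 Q = (complex_of_real s, 0)"
      using transfer_mat_closed_gap[of \<alpha> q x k N, OF D per x(4,2,3)] unfolding Q_def by blast
    have "1 < \<bar>half_trace (\<beta> j) Q x\<bar>" for j
    proof (rule gap_opens[OF D D\<beta> Q _ _ s(2,1)])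
      fix n assume "0 \<le> n" "n < 2 * int Q - 1"
      then show "\<beta> j n = \<alpha> n" by (simp add: \<beta>_def)
    next
      show "\<beta> j (-1) \<noteq> \<alpha> (-1)" using \<epsilon>(1)[of j] by (simp add: \<beta>_def)
    qed
    then show ?thesis using x(1) \<beta>_spec by (intro always_eventually) (meson not_le)
  next
    case False
    then obtain x where x: "x \<in> I i" "1 < \<bar>half_trace \<alpha> q x\<bar>" by (auto simp: full_def not_le)
    then have "cis x \<notin> cmv_spectrum \<alpha>"
      using cmv_spectrum_periodic[of \<alpha> r q x, OF r per q] by simp
    \<comment> \<open>The spectrum does not depend on which period describes it; reading the
      criterion for \<open>q\<close> and then for \<open>Q\<close> transfers the inequality.\<close>
    then have "1 < \<bar>half_trace \<alpha> Q x\<bar>"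
      using cmv_spectrum_periodic[of \<alpha> r Q x, OF r per_Q Q] by simp
    with tendsto_rabs[OF lim] have "\<forall>\<^sub>F j in sequentially. 1 < \<bar>half_trace (\<beta> j) Q x\<bar>"
      by (rule order_tendstoD(1))
    then show ?thesis
      by eventually_elim (use x(1) \<beta>_spec in \<open>meson not_le\<close>)
  qed
  then have "\<forall>\<^sub>F j in sequentially. \<forall>i\<in>{..<M}. \<exists>s\<in>I i. cis s \<notin> cmv_spectrum (\<beta> j)"
    by (intro eventually_ball_finite) auto
  then have "\<forall>\<^sub>F j in sequentially. gridded M (cmv_spectrum (\<beta> j))"
    by eventually_elim (auto simp: gridded_def I_def)
  then show ?thesis
    using Q per_Q \<beta>_per \<beta>_le \<beta>_dist \<epsilon>(3) by (intro exI[of _ Q] exI[of _ \<beta>]) (meson order_trans)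
qed

subsection \<open>Homogeneous sets\<close>

lemma sets_arc_length [measurable_cong, simp]: "sets arc_length = sets borel"
  and space_arc_length [simp]: "space arc_length = UNIV"
  by (simp_all add: arc_length_def)

interpretation arc_length: finite_measure arc_length
  by standard (simp add: emeasure_arc_length_UNIV)

lemma measure_arc_length:
  assumes "A \<in> sets borel"
  shows "measure arc_length A = measure lborel {t \<in> {0..<2 * pi}. cis t \<in> A}"
  by (simp add: measure_def emeasure_arc_length[OF assms])

lemma cis_borel_measurable [measurable]: "cis \<in> borel_measurable borel"
  by (rule borel_measurable_continuous_onI) (intro continuous_intros)

text \<open>Two intervals, because an arc may wrap around the end of the parameter range.\<close>

lemma measure_lborel_ge:
  fixes B :: "real set"
  assumes "B \<subseteq> {0..<2 * pi}" "B \<in> sets borel" "{a..<b} \<union> {c..<d} \<subseteq> B" "b \<le> c \<or> d \<le> a" "a \<le> b" "c \<le> d"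
  shows "(b - a) + (d - c) \<le> measure lborel B"
proof -
  have fin: "B \<in> fmeasurable lborel"
  proof (rule fmeasurableI2)
    show "{0..<2 * pi} \<in> fmeasurable lborel" by (rule fmeasurableI) (auto simp: emeasure_lborel_Ico)
  qed (use assms in auto)
  have "measure lborel ({a..<b} \<union> {c..<d}) = measure lborel {a..<b} + measure lborel {c..<d}"
    by (rule measure_Union) (use assms in auto)
  also have "\<dots> = (b - a) + (d - c)" using assms by simp
  finally show ?thesis
    using measure_mono_fmeasurable[OF assms(3) _ fin] by simp
qed

lemma arc_length_ge_arc:
  assumes A: "A \<in> sets borel" and \<delta>: "0 \<le> \<delta>" "\<delta> \<le> 2 * pi" and arc: "\<And>t. s \<le> t \<Longrightarrow> t < s + \<delta> \<Longrightarrow> cis t \<in> A"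
  shows "\<delta> \<le> measure arc_length A"
proof -
  define n where "n = \<lfloor>s / (2 * pi)\<rfloor>"
  define s' where "s' = s - 2 * pi * of_int n"
  have "of_int n \<le> s / (2 * pi)" "s / (2 * pi) < of_int n + 1" by (simp_all add: n_def)
  then have s': "0 \<le> s'" "s' < 2 * pi"
    by (simp_all add: s'_def pos_le_divide_eq pos_divide_less_eq algebra_simps)
  have per: "cis (t + 2 * pi * of_int k) = cis t" for t and k :: int
    by (simp add: cis_mult[symmetric])
  have arc': "cis t \<in> A" if "s' \<le> t" "t < s' + \<delta>" for t
  proof -
    have "cis (t + 2 * pi * of_int n) \<in> A" using that by (intro arc) (simp_all add: s'_def)
    then show ?thesis by (simp add: per)
  qed
  define B where "B = {t \<in> {0..<2 * pi}. cis t \<in> A}"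
  have "B = {0..<2 * pi} \<inter> (cis -` A \<inter> space borel)" by (auto simp: B_def)
  then have B: "B \<subseteq> {0..<2 * pi}" "B \<in> sets borel"
    using measurable_sets[OF cis_borel_measurable A] by auto
  \<comment> \<open>The arc is cut at \<open>2 * pi\<close>: \<open>{s'..<m}\<close> is the part
    before the cut, and \<open>{0..<e}\<close> is the rest moved back by a full turn. They are
    disjoint since \<delta> is at most a full turn.\<close>
  define m where "m = min (s' + \<delta>) (2 * pi)"
  define e where "e = max 0 (s' + \<delta> - 2 * pi)"
  have "{s'..<m} \<subseteq> B" using s' arc' by (auto simp: B_def m_def)
  moreover have "{0..<e} \<subseteq> B"
  proof
    fix t assume t: "t \<in> {0..<e}"
    then have "t < s' + \<delta> - 2 * pi" by (auto simp: e_def)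
    then have "cis (t + 2 * pi) \<in> A" using t s' by (intro arc') auto
    then have "cis t \<in> A" using per[of t 1] by simp
    moreover have "t < 2 * pi" using \<open>t < s' + \<delta> - 2 * pi\<close> \<delta> s' by simp
    ultimately show "t \<in> B" using t by (simp add: B_def)
  qed
  ultimately have "(m - s') + (e - 0) \<le> measure lborel B"
    using s' \<delta> by (intro measure_lborel_ge B) (auto simp: m_def e_def)
  moreover have "(m - s') + (e - 0) = \<delta>" by (auto simp: m_def e_def)
  ultimately show ?thesis by (simp add: measure_arc_length[OF A] B_def)
qed

lemma cis_chord_le: "cmod (cis s - cis t) \<le> \<bar>s - t\<bar>"
proof -
  have "(cmod (cis s - cis t))\<^sup>2 = 2 - 2 * cos (s - t)"
  proof -
    have "(cmod (cis s - cis t))\<^sup>2 = ((cos s)\<^sup>2 + (sin s)\<^sup>2) + ((cos t)\<^sup>2 + (sin t)\<^sup>2) - 2 * (cos s * cos t + sin s * sin t)"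
      by (simp add: cmod_power2 power2_diff algebra_simps)
    then show ?thesis by (simp add: cos_diff)
  qed
  also have "\<dots> = (2 * \<bar>sin ((s - t) / 2)\<bar>)\<^sup>2"
  proof -
    have "2 * ((s - t) / 2) = s - t" by simp
    then have "cos (s - t) = 1 - 2 * (sin ((s - t) / 2))\<^sup>2" by (metis cos_double_sin)
    then show ?thesis by (simp add: power_mult_distrib)
  qed
  also have "\<dots> \<le> (2 * \<bar>(s - t) / 2\<bar>)\<^sup>2"
    by (intro power_mono mult_left_mono abs_sin_x_le_abs_x) auto
  finally have "(cmod (cis s - cis t))\<^sup>2 \<le> \<bar>s - t\<bar>\<^sup>2" by (simp add: abs_mult)
  then show ?thesis by (rule power2_le_imp_le) simp
qed

text \<open>Homogeneity with the scale made explicit, because the limit argument needs one and the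
  same \<open>\<delta>\<^sub>0\<close> for all approximating sets.\<close>

definition hom_below :: "real \<Rightarrow> real \<Rightarrow> complex set \<Rightarrow> bool" where
  "hom_below \<tau> \<delta>\<^sub>0 K \<longleftrightarrow> (\<forall>x\<in>K. \<forall>\<delta>. 0 < \<delta> \<longrightarrow> \<delta> \<le> \<delta>\<^sub>0 \<longrightarrow> \<tau> * \<delta> \<le> measure arc_length (ball x \<delta> \<inter> K))"

lemma hom_below_mono:
  assumes "hom_below \<tau> \<delta>\<^sub>0 K" "\<tau>' \<le> \<tau>" shows "hom_below \<tau>' \<delta>\<^sub>0 K"
  unfolding hom_below_def
proof (intro ballI allI impI)
  fix x and \<delta> :: real assume x: "x \<in> K" and \<delta>: "0 < \<delta>" "\<delta> \<le> \<delta>\<^sub>0"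
  have "\<tau>' * \<delta> \<le> \<tau> * \<delta>" using assms(2) \<delta> by (intro mult_right_mono) auto
  also have "\<dots> \<le> measure arc_length (ball x \<delta> \<inter> K)" using assms(1) x \<delta> by (simp add: hom_below_def)
  finally show "\<tau>' * \<delta> \<le> measure arc_length (ball x \<delta> \<inter> K)" .
qed

definition one_sided :: "real \<Rightarrow> complex set \<Rightarrow> bool" where
  "one_sided \<delta> K \<longleftrightarrow> (\<forall>\<theta>. cis \<theta> \<in> K \<longrightarrow>
     (\<forall>t\<in>{\<theta>..\<theta> + \<delta>}. cis t \<in> K) \<or> (\<forall>t\<in>{\<theta> - \<delta>..\<theta>}. cis t \<in> K))"

lemma circle_cis: "x \<in> sphere 0 1 \<Longrightarrow> \<exists>\<theta>. x = cis \<theta>"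
  by (metis cis_Arg dist_0_norm mem_sphere norm_zero sgn_div_norm zero_neq_one inverse_1 scaleR_one)

text \<open>Chords are shorter than arcs, so a ball of radius \<delta> contains the arc of length
  \<delta> on the good side. This is the origin of the constant 1.\<close>

lemma one_sided_imp_measure_ge:
  assumes K: "closed K" "K \<subseteq> sphere 0 1" and os: "one_sided \<delta>\<^sub>1 K" and x: "x \<in> K"
    and \<delta>: "0 < \<delta>" "\<delta> \<le> \<delta>\<^sub>1" "\<delta> \<le> 2 * pi"
  shows "\<delta> \<le> measure arc_length (ball x \<delta> \<inter> K)"
proof -
  obtain \<theta> where \<theta>: "x = cis \<theta>" using circle_cis K x by blast
  have A: "ball x \<delta> \<inter> K \<in> sets borel" using K by auto
  have near: "cis t \<in> ball x \<delta>" if "\<bar>\<theta> - t\<bar> < \<delta>" for t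
    using cis_chord_le[of \<theta> t] that by (simp add: \<theta> dist_norm)
  from os x consider "\<forall>t\<in>{\<theta>..\<theta> + \<delta>\<^sub>1}. cis t \<in> K" | "\<forall>t\<in>{\<theta> - \<delta>\<^sub>1..\<theta>}. cis t \<in> K"
    unfolding one_sided_def \<theta> by blast
  then show ?thesis
  proof cases
    case 1
    show ?thesis
    proof (rule arc_length_ge_arc[OF A, where s = \<theta>])
      fix t assume t: "\<theta> \<le> t" "t < \<theta> + \<delta>"
      then show "cis t \<in> ball x \<delta> \<inter> K" using 1 \<delta> by (intro IntI near) auto
    qed (use \<delta> in auto)
  next
    case 2
    show ?thesis
    \<comment> \<open>\<open>arc_length_ge_arc\<close> wants the left endpoint in the set, but the
      point at angular distance exactly \<delta> need not be known to lie in the open ball; shorter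
      arcs are used instead.\<close>
    proof (rule dense_le_bounded[of 0])
      fix d :: real assume d: "0 < d" "d < \<delta>"
      show "d \<le> measure arc_length (ball x \<delta> \<inter> K)"
      proof (rule arc_length_ge_arc[OF A, where s = "\<theta> - d"])
        fix t assume t: "\<theta> - d \<le> t" "t < \<theta> - d + d"
        then show "cis t \<in> ball x \<delta> \<inter> K" using 2 \<delta> d by (intro IntI near) auto
      qed (use \<delta> d in auto)
    qed (use \<delta> in auto)
  qed
qed

text \<open>The length depends on \<open>r\<close> and \<open>q\<close> only, so it is available
  before the perturbation is selected.\<close>

lemma one_sided_cmv_spectrum:
  assumes "r < 1" "0 < q"
  obtains \<delta> where "0 < \<delta>"
    and "\<And>\<alpha>. (\<And>n. cmod (\<alpha> n) \<le> r) \<Longrightarrow> (\<And>n. \<alpha> (n + 2 * int q) = \<alpha> n) \<Longrightarrow> one_sided \<delta> (cmv_spectrum \<alpha>)"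
proof -
  obtain L where L: "0 < L" "\<And>\<alpha> \<theta>. (\<And>n. cmod (\<alpha> n) \<le> r) \<Longrightarrow> \<bar>Re (fst (transfer_mat_deriv \<alpha> \<theta> 0 q))\<bar> \<le> L"
    using half_trace_deriv_bounded[OF assms(1), of q] by blast
  have *: "one_sided (1 / (2 * L)) (cmv_spectrum \<alpha>)"
    if r: "\<And>n. cmod (\<alpha> n) \<le> r" and per: "\<And>n. \<alpha> (n + 2 * int q) = \<alpha> n" for \<alpha>
  proof -
    have D: "in_disk \<alpha>" using r assms(1) by (rule in_diskI)
    have spec: "cis \<theta> \<in> cmv_spectrum \<alpha> \<longleftrightarrow> \<bar>half_trace \<alpha> q \<theta>\<bar> \<le> 1" for \<theta>
      using cmv_spectrum_periodic[of \<alpha> r q \<theta>] r per assms by blast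
    show ?thesis
      unfolding one_sided_def spec
    proof (intro allI impI)
      fix \<theta> assume "\<bar>half_trace \<alpha> q \<theta>\<bar> \<le> 1"
      then show "(\<forall>t\<in>{\<theta>..\<theta> + 1 / (2 * L)}. \<bar>half_trace \<alpha> q t\<bar> \<le> 1) \<or>
          (\<forall>t\<in>{\<theta> - 1 / (2 * L)..\<theta>}. \<bar>half_trace \<alpha> q t\<bar> \<le> 1)"
        using half_trace_critical[OF D assms(2)] L(1) L(2)[of \<alpha>] r
        by (intro one_sided_band[OF half_trace_has_derivative, where L = L]) auto
    qed
  qed
  have "0 < 1 / (2 * L)" using L(1) by simp
  then show thesis using * by (rule that)
qed

section \<open>Loss of arc length under perturbation\<close>

lemma cis_inj: "inj_on cis {0..<2 * pi}"
proof (rule inj_onI)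
  fix s t assume st: "s \<in> {0..<2 * pi}" "t \<in> {0..<2 * pi}" and "cis s = cis t"
  then have "sin s = sin t \<and> cos s = cos t" by (simp add: complex_eq_iff)
  then obtain n :: int where n: "s = t + 2 * pi * n" using sin_cos_eq_iff by blast
  have "\<bar>2 * pi * of_int n\<bar> < 2 * pi" using st n by auto
  then have "\<bar>of_int n :: real\<bar> < 1" by (simp add: abs_mult)
  then have "n = 0" by linarith
  then show "s = t" using n by simp
qed

lemma finite_null_arc_length:
  assumes "finite F" shows "F \<in> null_sets arc_length"
proof -
  have "finite {t \<in> {0..<2 * pi}. cis t \<in> F}"
  proof (rule finite_imageD)
    show "finite (cis ` {t \<in> {0..<2 * pi}. cis t \<in> F})"
      by (rule finite_subset[OF _ assms]) auto
    show "inj_on cis {t \<in> {0..<2 * pi}. cis t \<in> F}"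
      using cis_inj by (rule inj_on_subset) auto
  qed
  moreover have "F \<in> sets borel" using assms by (simp add: finite_imp_closed)
  ultimately show ?thesis
    by (simp add: null_sets_def emeasure_arc_length emeasure_lborel_countable countable_finite)
qed

text \<open>The set is compact and discrete. A noncritical edge is isolated because the derivative
  is nonzero, a critical one because nearby values have modulus below 1.\<close>

lemma finite_band_edges:
  assumes D: "in_disk \<alpha>" and q: "0 < q"
  shows "finite {t \<in> {0..2 * pi}. \<bar>half_trace \<alpha> q t\<bar> = 1}"
proof -
  define f where "f = half_trace \<alpha> q"
  define S where "S = {t \<in> {0..2 * pi}. \<bar>f t\<bar> = 1}"
  have der: "(f has_real_derivative Re (fst (transfer_mat_deriv \<alpha> t 0 q))) (at t)" for t
    unfolding f_def by (rule half_trace_has_derivative)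
  have cont: "continuous_on UNIV f"
    using der by (auto intro: DERIV_isCont continuous_at_imp_continuous_on)
  have "closed {t. \<bar>f t\<bar> = 1}"
    by (intro closed_Collect_eq continuous_intros cont)
  then have "compact ({0..2 * pi} \<inter> {t. \<bar>f t\<bar> = 1})" by (intro compact_Int_closed) auto
  moreover have "{0..2 * pi} \<inter> {t. \<bar>f t\<bar> = 1} = S" by (auto simp: S_def)
  ultimately have "compact S" by simp
  moreover have "discrete S"
    unfolding discrete_altdef
  proof
    fix t assume "t \<in> S"
    then have ft: "\<bar>f t\<bar> = 1" by (simp add: S_def)
    have "\<forall>\<^sub>F s in at t. \<bar>f s\<bar> \<noteq> 1"
    proof (cases "Re (fst (transfer_mat_deriv \<alpha> t 0 q)) = 0")
      case True
      then have "\<forall>\<^sub>F s in at t. \<bar>f s\<bar> < 1"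
        using half_trace_critical(2)[OF D q, of t] ft by (simp add: f_def)
      then show ?thesis by eventually_elim simp
    next
      case False
      have "((\<lambda>s. (f s - f t) / (s - t)) \<longlongrightarrow> Re (fst (transfer_mat_deriv \<alpha> t 0 q))) (at t)"
        using der[of t] by (simp add: has_field_derivative_iff)
      then have 1: "\<forall>\<^sub>F s in at t. (f s - f t) / (s - t) \<noteq> 0"
        using False by (rule tendsto_imp_eventually_ne)
      have "(f \<longlongrightarrow> f t) (at t)" using DERIV_isCont[OF der] by (simp add: isCont_def)
      \<comment> \<open>Excludes a passage from the level 1 to the level -1, which a nonzero
        difference quotient alone would allow.\<close>
      then have "\<forall>\<^sub>F s in at t. dist (f s) (f t) < 1" by (rule tendstoD) simp
      with 1 show ?thesis
        by eventually_elim (use ft in \<open>auto simp: dist_real_def abs_if split: if_splits\<close>)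
    qed
    then show "\<forall>\<^sub>F s in at t. s \<notin> S" by eventually_elim (simp add: S_def)
  qed
  ultimately show ?thesis using discrete_compact_finite_iff by (auto simp: S_def f_def)
qed

text \<open>Where the half trace has modulus below 1, it stays below 1 for large \<open>j\<close>,
  so such a point is eventually not lost. Only the finitely many band edges remain, and dominated
  convergence applies.\<close>

lemma measure_lost_spectrum_tendsto_0:
  assumes r: "\<And>n. cmod (\<alpha> n) \<le> r" "\<And>j n. cmod (\<beta> j n) \<le> r" "r < 1" and Q: "0 < Q"
    and per: "\<And>n. \<alpha> (n + 2 * int Q) = \<alpha> n" "\<And>j n. \<beta> j (n + 2 * int Q) = \<beta> j n"
    and lim: "\<And>n. (\<lambda>j. \<beta> j n) \<longlonglongrightarrow> \<alpha> n"
  shows "(\<lambda>j. measure arc_length (cmv_spectrum \<alpha> - cmv_spectrum (\<beta> j))) \<longlonglongrightarrow> 0"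
proof -
  have D: "in_disk \<alpha>" using r(1,3) by (rule in_diskI)
  have D\<beta>: "in_disk (\<beta> j)" for j using r(2,3) by (rule in_diskI)
  define A where "A j = cmv_spectrum \<alpha> - cmv_spectrum (\<beta> j)" for j
  have A: "A j \<in> sets borel" for j using closed_cmv_spectrum[OF D] closed_cmv_spectrum[OF D\<beta>] by (auto simp: A_def)
  have spec: "cis \<theta> \<in> cmv_spectrum \<alpha> \<longleftrightarrow> \<bar>half_trace \<alpha> Q \<theta>\<bar> \<le> 1"
    "cis \<theta> \<in> cmv_spectrum (\<beta> j) \<longleftrightarrow> \<bar>half_trace (\<beta> j) Q \<theta>\<bar> \<le> 1" for \<theta> j
    using cmv_spectrum_periodic[of \<alpha> r Q \<theta>] cmv_spectrum_periodic[of "\<beta> j" r Q \<theta>] r per Q by blast+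
  define F where "F = cis ` {t \<in> {0..2 * pi}. \<bar>half_trace \<alpha> Q t\<bar> = 1}"
  have F: "F \<in> null_sets arc_length"
    unfolding F_def by (intro finite_null_arc_length finite_imageI finite_band_edges D Q)
  have "AE x in arc_length. (\<lambda>j. indicator (A j) x :: real) \<longlonglongrightarrow> 0"
  proof (rule AE_I'[OF F], safe)
    fix x assume not: "\<not> (\<lambda>j. indicator (A j) x :: real) \<longlonglongrightarrow> 0"
    have "x \<in> cmv_spectrum \<alpha>"
    proof (rule ccontr)
      assume "x \<notin> cmv_spectrum \<alpha>"
      then have "(\<lambda>j. indicator (A j) x :: real) = (\<lambda>_. 0)" by (auto simp: A_def)
      then show False using not by simp
    qed
    then have "cmod x = 1" using cmv_spectrum_subset_circle[OF D] by auto
    then obtain t where t: "t \<in> {0..2 * pi}" "x = cis t"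
      by (metis Arg2pi_eq Arg2pi_ge_0 Arg2pi_lt_2pi atLeastAtMost_iff cis_conv_exp less_imp_le mult.commute
          mult_1 of_real_1)
    then have le: "\<bar>half_trace \<alpha> Q t\<bar> \<le> 1" using \<open>x \<in> cmv_spectrum \<alpha>\<close> spec(1) by simp
    have "\<not> \<bar>half_trace \<alpha> Q t\<bar> < 1"
    proof
      assume less: "\<bar>half_trace \<alpha> Q t\<bar> < 1"
      have "\<forall>\<^sub>F j in sequentially. \<bar>half_trace (\<beta> j) Q t\<bar> < 1"
        by (rule order_tendstoD(2)[OF _ less]) (intro tendsto_intros half_trace_tendsto D lim)
      then have "\<forall>\<^sub>F j in sequentially. indicator (A j) x = (0 :: real)"
        by eventually_elim (simp add: A_def t(2) spec)
      then show False using not by (simp add: tendsto_eventually)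
    qed
    then have "\<bar>half_trace \<alpha> Q t\<bar> = 1" using le by simp
    then show "x \<in> F" using t by (auto simp: F_def)
  qed
  then have "(\<lambda>j. integral\<^sup>L arc_length (indicator (A j) :: _ \<Rightarrow> real)) \<longlonglongrightarrow> integral\<^sup>L arc_length (\<lambda>_. 0)"
    by (intro integral_dominated_convergence[where w = "\<lambda>_. 1"])
       (use A in \<open>auto intro!: borel_measurable_indicator simp: indicator_def\<close>)
  then show ?thesis
    using A by (simp add: A_def)
qed

text \<open>Up to scale \<open>d\<close> the one-sided arcs give constant 1. Above \<open>d\<close>
  the centre is moved to a point of \<open>K\<close> and the radius shrunk by \<kappa>; the total
  loss \<open>\<tau>\<^sub>1 * \<kappa> + \<kappa>'\<close> is absorbed by
  \<open>(\<tau>\<^sub>1 - \<tau>\<^sub>2) * d\<close>.\<close>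

lemma hom_below_perturb:
  assumes K: "closed K" and K': "closed K'" "K' \<subseteq> sphere 0 1" and os: "one_sided \<delta>\<^sub>1 K'"
    and d: "0 < d" "d \<le> \<delta>\<^sub>1" "d \<le> 2 * pi" and hom: "hom_below \<tau>\<^sub>1 \<delta>\<^sub>0 K" and \<tau>: "0 < \<tau>\<^sub>1" "\<tau>\<^sub>2 < \<tau>\<^sub>1" "\<tau>\<^sub>2 \<le> 1"
    and near: "\<And>x'. x' \<in> K' \<Longrightarrow> \<exists>x\<in>K. dist x x' \<le> \<kappa>" and lost: "measure arc_length (K - K') \<le> \<kappa>'"
    and \<kappa>: "\<kappa> < d" "\<tau>\<^sub>1 * \<kappa> + \<kappa>' \<le> (\<tau>\<^sub>1 - \<tau>\<^sub>2) * d"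
  shows "hom_below \<tau>\<^sub>2 \<delta>\<^sub>0 K'"
  unfolding hom_below_def
proof (intro ballI allI impI)
  fix x' and \<delta> :: real assume x': "x' \<in> K'" and \<delta>: "0 < \<delta>" "\<delta> \<le> \<delta>\<^sub>0"
  show "\<tau>\<^sub>2 * \<delta> \<le> measure arc_length (ball x' \<delta> \<inter> K')"
  proof (cases "\<delta> \<le> d")
    case True
    have "\<tau>\<^sub>2 * \<delta> \<le> 1 * \<delta>" using \<tau> \<delta> by (intro mult_right_mono) auto
    also have "\<dots> \<le> measure arc_length (ball x' \<delta> \<inter> K')"
      using one_sided_imp_measure_ge[OF K' os x' \<delta>(1)] True d by simp
    finally show ?thesis .
  next
    case False
    obtain x where x: "x \<in> K" "dist x x' \<le> \<kappa>" using near[OF x'] by blast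
    have "0 \<le> \<kappa>" using x(2) zero_le_dist order_trans by blast
    have "\<tau>\<^sub>1 * (\<delta> - \<kappa>) \<le> measure arc_length (ball x (\<delta> - \<kappa>) \<inter> K)"
      using hom x(1) False \<kappa>(1) \<delta> \<open>0 \<le> \<kappa>\<close> by (simp add: hom_below_def)
    also have "\<dots> \<le> measure arc_length ((ball x' \<delta> \<inter> K') \<union> (K - K'))"
    proof (rule arc_length.finite_measure_mono)
      show "ball x (\<delta> - \<kappa>) \<inter> K \<subseteq> (ball x' \<delta> \<inter> K') \<union> (K - K')"
      proof
        fix y assume y: "y \<in> ball x (\<delta> - \<kappa>) \<inter> K"
        then have "dist x' y < \<delta>" using x(2) dist_triangle[of x' y x] by (auto simp: dist_commute)
        then show "y \<in> (ball x' \<delta> \<inter> K') \<union> (K - K')" using y by auto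
      qed
      show "(ball x' \<delta> \<inter> K') \<union> (K - K') \<in> sets arc_length" using K K' by auto
    qed
    also have "\<dots> \<le> measure arc_length (ball x' \<delta> \<inter> K') + measure arc_length (K - K')"
      using K K' by (intro measure_Un_le) auto
    finally have "\<tau>\<^sub>1 * (\<delta> - \<kappa>) - \<kappa>' \<le> measure arc_length (ball x' \<delta> \<inter> K')" using lost by linarith
    moreover have "(\<tau>\<^sub>1 - \<tau>\<^sub>2) * d \<le> (\<tau>\<^sub>1 - \<tau>\<^sub>2) * \<delta>" using \<tau> False by (intro mult_left_mono) auto
    ultimately show ?thesis using \<kappa>(2) by (simp add: algebra_simps)
  qed
qed

text \<open>Upper semicontinuity of arc length: shrinking closed neighbourhoods of \<open>K\<close> contain the
  approximating sets, and their arc length tends to that of \<open>K\<close>.\<close>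

lemma hom_below_limit:
  assumes K: "closed K" and Kn: "\<And>n. closed (L n)" and hom: "\<And>n. hom_below \<tau> \<delta>\<^sub>0 (L n)"
    and 1: "\<And>e. 0 < e \<Longrightarrow> \<exists>n. (\<forall>x\<in>K. \<exists>y\<in>L n. dist x y \<le> e) \<and> (\<forall>y\<in>L n. \<exists>x\<in>K. dist x y \<le> e)"
  shows "hom_below \<tau> \<delta>\<^sub>0 K"
  unfolding hom_below_def
proof (intro ballI allI impI)
  fix x and \<delta> :: real assume x: "x \<in> K" and \<delta>: "0 < \<delta>" "\<delta> \<le> \<delta>\<^sub>0"
  \<comment> \<open>A radius below \<delta> leaves room for closed balls, for which the sets
    decrease to a closed intersection inside the open ball of radius \<delta>.\<close>
  have le: "\<tau> * d \<le> measure arc_length (ball x \<delta> \<inter> K)" if d: "0 < d" "d < \<delta>" for d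
  proof -
    define e where "e m = 1 / real (Suc m)" for m
    have e: "0 < e m" for m by (simp add: e_def)
    have e_lim: "e \<longlonglongrightarrow> 0" unfolding e_def by (rule LIMSEQ_Suc[OF lim_1_over_n])
    have e_mono: "e n \<le> e m" if "m \<le> n" for m n using that by (simp add: e_def frac_le)
    define C where "C m = cball x (d + e m) \<inter> {y. infdist y K \<le> e m}" for m
    have closed_C: "closed (C m)" for m
      unfolding C_def by (intro closed_Int closed_cball closed_Collect_le continuous_intros)
    have dec: "decseq C"
      unfolding decseq_def
    proof (intro allI impI)
      fix m n :: nat assume "m \<le> n"
      then have "e n \<le> e m" by (rule e_mono)
      then show "C n \<subseteq> C m" by (auto simp: C_def)
    qed
    have Int: "(\<Inter>m. C m) = cball x d \<inter> K"
    proof (intro equalityI subsetI)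
      fix y assume y: "y \<in> (\<Inter>m. C m)"
      have "(\<lambda>m. d + e m) \<longlonglongrightarrow> d + 0" by (intro tendsto_intros e_lim)
      then have "dist x y \<le> d + 0"
        by (rule LIMSEQ_le_const) (use y in \<open>auto simp: C_def\<close>)
      moreover have "infdist y K \<le> 0"
        by (rule LIMSEQ_le_const[OF e_lim]) (use y in \<open>auto simp: C_def\<close>)
      then have "y \<in> K"
        using in_closed_iff_infdist_zero[OF K] x infdist_nonneg[of y K] by force
      ultimately show "y \<in> cball x d \<inter> K" by simp
    next
      fix y assume "y \<in> cball x d \<inter> K"
      then show "y \<in> (\<Inter>m. C m)" using e by (auto simp: C_def less_imp_le add_increasing2)
    qed
    have "(\<lambda>m. measure arc_length (C m)) \<longlonglongrightarrow> measure arc_length (\<Inter>m. C m)"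
      by (rule arc_length.finite_Lim_measure_decseq) (use closed_C dec in auto)
    moreover have "\<tau> * d \<le> measure arc_length (C m)" for m
    proof -
      obtain n where n: "\<forall>x\<in>K. \<exists>y\<in>L n. dist x y \<le> e m" "\<forall>y\<in>L n. \<exists>x\<in>K. dist x y \<le> e m"
        using 1[OF e] by blast
      then obtain z where z: "z \<in> L n" "dist x z \<le> e m" using x by blast
      have "\<tau> * d \<le> measure arc_length (ball z d \<inter> L n)"
        using hom[of n] z(1) d \<delta> by (simp add: hom_below_def)
      also have "\<dots> \<le> measure arc_length (C m)"
      proof (rule arc_length.finite_measure_mono)
        show "ball z d \<inter> L n \<subseteq> C m"
        proof
          fix y assume y: "y \<in> ball z d \<inter> L n"
          then obtain w where w: "w \<in> K" "dist w y \<le> e m" using n(2) by blast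
          have "infdist y K \<le> e m"
            using infdist_le[OF w(1), of y] w(2) by (simp add: dist_commute)
          moreover have "dist x y \<le> d + e m" using y z(2) dist_triangle[of x y z] by auto
          ultimately show "y \<in> C m" by (simp add: C_def)
        qed
      qed (use closed_C in auto)
      finally show ?thesis .
    qed
    ultimately have "\<tau> * d \<le> measure arc_length (cball x d \<inter> K)"
      unfolding Int by (intro LIMSEQ_le_const) auto
    also have "\<dots> \<le> measure arc_length (ball x \<delta> \<inter> K)"
      using d K by (intro arc_length.finite_measure_mono) auto
    finally show ?thesis .
  qed
  show "\<tau> * \<delta> \<le> measure arc_length (ball x \<delta> \<inter> K)"
  proof (rule tendsto_upperbound)
    show "((\<lambda>d. \<tau> * d) \<longlongrightarrow> \<tau> * \<delta>) (at_left \<delta>)" by (intro tendsto_intros)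
    show "\<forall>\<^sub>F d in at_left \<delta>. \<tau> * d \<le> measure arc_length (ball x \<delta> \<inter> K)"
      using eventually_at_left[OF \<delta>(1)] le \<delta>(1) by blast
  qed simp
qed

text \<open>The finitely many witnesses lie in the open complement of \<open>K\<close>, hence have a
  common distance from \<open>K\<close>.\<close>

lemma gridded_stable:
  assumes "gridded M K" "closed K"
  shows "\<exists>e>0. \<forall>K'. (\<forall>z\<in>K'. \<exists>w\<in>K. dist w z \<le> e) \<longrightarrow> gridded M K'"
proof -
  have "\<exists>s\<in>{2 * pi * real i / real M..2 * pi * real (Suc i) / real M}. \<exists>e>0. ball (cis s) e \<inter> K = {}" if "i < M" for i
  proof -
    obtain s where s: "s \<in> {2 * pi * real i / real M..2 * pi * real (Suc i) / real M}" "cis s \<in> - K"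
      using assms(1) \<open>i < M\<close> by (auto simp: gridded_def)
    have "open (- K)" using assms(2) by auto
    then obtain e where "0 < e" "ball (cis s) e \<subseteq> - K" using s(2) openE by blast
    then show ?thesis using s(1) by blast
  qed
  then obtain s e where se: "\<And>i. i < M \<Longrightarrow> s i \<in> {2 * pi * real i / real M..2 * pi * real (Suc i) / real M} \<and>
      0 < e i \<and> ball (cis (s i)) (e i) \<inter> K = {}"
    by metis
  have ev: "\<forall>\<^sub>F x in at_right 0. \<forall>i\<in>{..<M}. x < e i"
    using se by (intro eventually_ball_finite ballI) (auto simp: eventually_at_right_field intro: exI)
  have ev0: "\<forall>\<^sub>F x :: real in at_right 0. 0 < x"
    by (rule eventually_at_right_less)
  have "\<forall>\<^sub>F x :: real in at_right 0. 0 < x \<and> (\<forall>i\<in>{..<M}. x < e i)"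
    using ev0 ev by (rule eventually_conj)
  then obtain \<epsilon> where \<epsilon>: "0 < \<epsilon>" "\<And>i. i < M \<Longrightarrow> \<epsilon> < e i"
    using eventually_happens'[OF trivial_limit_at_right_real] by blast
  have "gridded M K'" if near: "\<forall>z\<in>K'. \<exists>w\<in>K. dist w z \<le> \<epsilon>" for K'
    unfolding gridded_def
  proof (intro allI impI bexI)
    fix i assume i: "i < M"
    show "cis (s i) \<notin> K'"
    proof
      assume "cis (s i) \<in> K'"
      then obtain w where "w \<in> K" "dist w (cis (s i)) \<le> \<epsilon>" using near by blast
      then have "w \<in> ball (cis (s i)) (e i) \<inter> K" using \<epsilon>(2)[OF i] by (simp add: dist_commute)
      then show False using se[OF i] by blast
    qed
    show "s i \<in> {2 * pi * real i / real M..2 * pi * real (Suc i) / real M}" using se[OF i] by blast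
  qed
  then show ?thesis using \<epsilon>(1) by blast
qed

text \<open>An interval of two cell lengths contains a whole cell of the periodic grid, wherever it
  begins.\<close>

lemma gridded_hits:
  assumes g: "gridded k K" and k: "0 < k" and B: "A + 4 * pi / real k \<le> B"
  shows "\<exists>u\<in>{A..B}. cis u \<notin> K"
proof -
  define n where "n = \<lfloor>A / (2 * pi)\<rfloor>"
  define A' where "A' = A - 2 * pi * of_int n"
  have "of_int n \<le> A / (2 * pi)" "A / (2 * pi) < of_int n + 1" by (simp_all add: n_def)
  then have A': "0 \<le> A'" "A' < 2 * pi"
    by (simp_all add: A'_def pos_le_divide_eq pos_divide_less_eq algebra_simps)
  define X where "X = A' * real k / (2 * pi)"
  have X: "0 \<le> X" "X < real k" using A' k by (simp_all add: X_def field_simps)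
  define i where "i = nat \<lceil>X\<rceil>"
  have i: "X \<le> real i" "real i < X + 1" using X by (simp_all add: i_def) linarith+
  then have "i \<le> k" using X by linarith
  \<comment> \<open>Rounding up may produce the index \<open>k\<close>, which is cell 0 one turn
    later; \<open>m\<close> records that turn.\<close>
  define i' m :: nat where "i' = (if i = k then 0 else i)" and "m = (if i = k then 1 else 0)"
  have "i' < k" using \<open>i \<le> k\<close> k by (auto simp: i'_def)
  then obtain s where s: "s \<in> {2 * pi * real i' / real k..2 * pi * real (Suc i') / real k}" "cis s \<notin> K"
    using g by (auto simp: gridded_def)
  define u where "u = s + 2 * pi * real m + 2 * pi * of_int n"
  have shift: "2 * pi * real i / real k \<le> s + 2 * pi * real m" "s + 2 * pi * real m \<le> 2 * pi * (real i + 1) / real k"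
    using s(1) k by (auto simp: i'_def m_def field_simps split: if_splits)
  have X': "2 * pi * X / real k = A'" using k by (simp add: X_def)
  have "A' \<le> 2 * pi * real i / real k"
    unfolding X'[symmetric] using i(1) by (intro divide_right_mono mult_left_mono) auto
  moreover have "2 * pi * (real i + 1) / real k \<le> 2 * pi * (X + 2) / real k"
    using i(2) by (intro divide_right_mono mult_left_mono) auto
  moreover have "2 * pi * (X + 2) / real k = A' + 4 * pi / real k"
    unfolding X'[symmetric] by (simp add: algebra_simps add_divide_distrib)
  ultimately have "A' \<le> s + 2 * pi * real m" "s + 2 * pi * real m \<le> A' + 4 * pi / real k"
    using shift by linarith+
  then have "u \<in> {A..B}" using B unfolding u_def A'_def by auto
  moreover have "cis u = cis s"
    by (simp add: u_def cis_mult[symmetric])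
  ultimately show ?thesis using s(2) by metis
qed

text \<open>An isolated point would have a neighbourhood of arc length zero in \<open>K\<close>,
  against homogeneity. A component has a continuous angle once the circle is cut at a point outside
  \<open>K\<close>; its image is an interval, and gaps at all scales reduce it to a point.\<close>

lemma cantor_setI:
  assumes K: "closed K" "K \<subseteq> sphere 0 1" "K \<noteq> {}" and grid: "\<And>k. 0 < k \<Longrightarrow> gridded k K"
    and hom: "hom_below \<tau> \<delta>\<^sub>0 K" "0 < \<tau>" "0 < \<delta>\<^sub>0"
  shows "cantor_set K"
  unfolding cantor_set_def
proof (intro conjI ballI)
  show "compact K" using K by (meson bounded_sphere bounded_subset compact_eq_bounded_closed)
  show "\<not> (\<exists>x. x isolated_in K)"
  proof
    assume "\<exists>x. x isolated_in K"
    then obtain x e where x: "x \<in> K" "0 < e" "\<And>y. y \<in> K \<Longrightarrow> dist x y < e \<Longrightarrow> y = x"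
      by (meson isolated_inE_dist isolated_in_islimpt_iff)
    define \<delta> where "\<delta> = min e \<delta>\<^sub>0"
    have "0 < \<delta>" "\<delta> \<le> \<delta>\<^sub>0" using x(2) hom by (simp_all add: \<delta>_def)
    then have "\<tau> * \<delta> \<le> measure arc_length (ball x \<delta> \<inter> K)" using hom(1) x(1) by (simp add: hom_below_def)
    also have "ball x \<delta> \<inter> K = {x}" using x \<open>0 < \<delta>\<close> by (auto simp: \<delta>_def)
    also have "measure arc_length {x} = 0"
      using finite_null_arc_length[of "{x}"] by (simp add: measure_eq_0_null_sets)
    finally show False using \<open>0 < \<delta>\<close> hom(2) by (simp add: mult_le_0_iff)
  qed
  fix x assume x: "x \<in> K"
  define C where "C = connected_component_set K x"
  have C: "connected C" "C \<subseteq> K" "x \<in> C"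
    using x by (simp_all add: C_def connected_component_subset)
  obtain s where s: "cis s \<notin> K" using grid[of 1] by (auto simp: gridded_def)
  \<comment> \<open>The rotation puts the branch cut of \<open>Arg\<close>, the negative real axis,
    at the missing point \<open>cis s\<close>.\<close>
  define g where "g w = Arg (- w / cis s)" for w
  have w_eq: "w = cis (s + pi + g w)" if "w \<in> C" for w
  proof -
    have "cmod w = 1" using that C(2) K(2) by auto
    moreover from this have "w \<noteq> 0" by auto
    ultimately have "cis (g w) = - w / cis s"
      using cis_Arg[of "- w / cis s"] by (auto simp: g_def sgn_div_norm norm_divide)
    then have "- w = cis (g w) * cis s" by (metis cis_neq_zero nonzero_eq_divide_eq)
    then have "w = - cis (g w) * cis s" by (metis minus_mult_left minus_minus)
    also have "\<dots> = cis (s + pi + g w)" by (simp add: cis_mult[symmetric])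
    finally show ?thesis .
  qed
  have "continuous_on C g"
    unfolding g_def
  proof (rule continuous_on_compose2[where t = "- \<real>\<^sub>\<le>\<^sub>0" and g = Arg])
    show "continuous_on (- \<real>\<^sub>\<le>\<^sub>0) Arg"
      by (intro continuous_at_imp_continuous_on ballI continuous_at_Arg) auto
    show "continuous_on C (\<lambda>w. - w / cis s)" by (intro continuous_intros) auto
    show "(\<lambda>w. - w / cis s) ` C \<subseteq> - \<real>\<^sub>\<le>\<^sub>0"
    proof safe
      fix w assume w: "w \<in> C" "- w / cis s \<in> \<real>\<^sub>\<le>\<^sub>0"
      from w(2) obtain a where a: "- w / cis s = of_real a" "a \<le> 0" by (rule nonpos_Reals_cases)
      have "cmod w = 1" using w(1) C(2) K(2) by auto
      then have "cmod (- w / cis s) = 1" by (simp add: norm_divide)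
      then have "\<bar>a\<bar> = 1" unfolding a(1) by simp
      then have "a = -1" using a(2) by simp
      then have "w = cis s" using a(1) by (simp add: field_simps)
      then show False using s w(1) C(2) by auto
    qed
  qed
  then have conn: "connected (g ` C)" using C(1) by (rule connected_continuous_image)
  have no_gap: False if "a \<in> g ` C" "b \<in> g ` C" "a < b" for a b
  proof -
    obtain k :: nat where k: "4 * pi / (b - a) < real k" using reals_Archimedean2 by blast
    then have k0: "0 < real k" using \<open>a < b\<close> by (meson diff_gt_0_iff_gt divide_pos_pos less_trans mult_pos_pos pi_gt_zero zero_less_numeral)
    then have "4 * pi / real k \<le> b - a" using k \<open>a < b\<close> by (simp add: field_simps)
    then obtain u where u: "u \<in> {s + pi + a..s + pi + b}" "cis u \<notin> K"
      using gridded_hits[OF grid[of k], of "s + pi + a" "s + pi + b"] k0 by auto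
    then have "u - s - pi \<in> g ` C" using connected_contains_Icc[OF conn that(1,2)] by auto
    then obtain w where w: "w \<in> C" "g w = u - s - pi" by auto
    then have "w = cis u" using w_eq[OF w(1)] by simp
    then show False using u(2) w(1) C(2) by auto
  qed
  have "y = x" if y: "y \<in> C" for y
  proof -
    have "g y = g x" using no_gap[of "g x" "g y"] no_gap[of "g y" "g x"] y C(3) by (cases "g x" "g y" rule: linorder_cases) auto
    then show ?thesis using w_eq[OF y] w_eq[OF C(3)] by metis
  qed
  then show "connected_component_set K x = {x}" using C(3) unfolding C_def[symmetric] by blast
qed (use K in auto)

subsection \<open>The inductive step\<close>

text \<open>The period \<open>Q\<close> and the family \<open>\<beta>\<close> come first; they
  determine the band length \<open>d\<close>, with respect to which \<open>j\<close> is then taken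
  large. The scale \<open>\<delta>\<^sub>0\<close> is unchanged.\<close>

lemma inductive_step:
  assumes r: "\<And>n. cmod (\<alpha> n) \<le> r" "r < 1" and per: "\<And>n. \<alpha> (n + 2 * int q) = \<alpha> n" and q: "0 < q"
    and hom: "hom_below \<tau>\<^sub>1 \<delta>\<^sub>0 (cmv_spectrum \<alpha>)" and \<tau>: "0 < \<tau>\<^sub>1" "\<tau>\<^sub>2 < \<tau>\<^sub>1" "\<tau>\<^sub>2 \<le> 1"
    and M: "0 < M" and \<eta>: "0 < \<eta>"
  shows "\<exists>Q \<beta>. 0 < Q \<and> (\<forall>n. \<beta> (n + 2 * int Q) = \<beta> n) \<and> (\<forall>n. cmod (\<beta> n - \<alpha> n) \<le> \<eta>) \<and>
    hom_below \<tau>\<^sub>2 \<delta>\<^sub>0 (cmv_spectrum \<beta>) \<and> gridded M (cmv_spectrum \<beta>)"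
proof -
  define r' where "r' = (1 + r) / 2"
  have r': "r < r'" "r' < 1" using r(2) by (simp_all add: r'_def)
  obtain Q \<beta> where Q: "0 < Q" and per_Q: "\<And>n. \<alpha> (n + 2 * int Q) = \<alpha> n" "\<And>j n. \<beta> j (n + 2 * int Q) = \<beta> j n"
    and \<beta>: "\<And>j n. cmod (\<beta> j n) \<le> r'" "\<And>j n. cmod (\<beta> j n - \<alpha> n) \<le> 1 / real (Suc j)"
    and grid: "\<forall>\<^sub>F j in sequentially. gridded M (cmv_spectrum (\<beta> j))"
    using gap_opening[of \<alpha> r q M, OF r per q M] unfolding r'_def by blast
  have \<alpha>: "cmod (\<alpha> n) \<le> r'" for n using r(1)[of n] r'(1) by linarith
  have D: "in_disk \<alpha>" using \<alpha> r'(2) by (rule in_diskI)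
  have D\<beta>: "in_disk (\<beta> j)" for j using \<beta>(1) r'(2) by (rule in_diskI)
  obtain \<delta>\<^sub>1 where \<delta>\<^sub>1: "0 < \<delta>\<^sub>1" and "\<And>\<alpha>. (\<And>n. cmod (\<alpha> n) \<le> r') \<Longrightarrow>
      (\<And>n. \<alpha> (n + 2 * int Q) = \<alpha> n) \<Longrightarrow> one_sided \<delta>\<^sub>1 (cmv_spectrum \<alpha>)"
    by (rule one_sided_cmv_spectrum[OF r'(2) Q]) (rule that, assumption, blast)
  then have os: "one_sided \<delta>\<^sub>1 (cmv_spectrum (\<beta> j))" for j using \<beta>(1) per_Q(2) by metis
  obtain C where C: "0 < C" "\<And>\<alpha> \<beta> d z. (\<And>n. cmod (\<alpha> n) \<le> r') \<Longrightarrow> (\<And>n. cmod (\<beta> n) \<le> r') \<Longrightarrow>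
      (\<And>n. cmod (\<alpha> n - \<beta> n) \<le> d) \<Longrightarrow> z \<in> cmv_spectrum \<alpha> \<Longrightarrow> \<exists>w\<in>cmv_spectrum \<beta>. cmod (w - z) \<le> C * d"
    by (rule cmv_spectrum_perturbation[OF r'(2)]) (rule that, assumption, blast)
  have near: "\<exists>w\<in>cmv_spectrum \<alpha>. cmod (w - z) \<le> C * (1 / real (Suc j))" if "z \<in> cmv_spectrum (\<beta> j)" for j z
    by (rule C(2)[OF \<beta>(1) \<alpha> \<beta>(2) that])
  define d where "d = min \<delta>\<^sub>1 (2 * pi)"
  have d: "0 < d" "d \<le> \<delta>\<^sub>1" "d \<le> 2 * pi" using \<delta>\<^sub>1 by (simp_all add: d_def)
  define lost where "lost j = measure arc_length (cmv_spectrum \<alpha> - cmv_spectrum (\<beta> j))" for j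
  have inv0: "(\<lambda>j. 1 / real (Suc j)) \<longlonglongrightarrow> 0" by (rule LIMSEQ_Suc[OF lim_1_over_n])
  have lim: "(\<lambda>j. \<beta> j n) \<longlonglongrightarrow> \<alpha> n" for n
  proof -
    have "(\<lambda>j. \<beta> j n - \<alpha> n) \<longlonglongrightarrow> 0"
      using \<beta>(2) by (intro Lim_null_comparison[OF _ inv0] always_eventually) auto
    then show ?thesis by (simp add: LIM_zero_iff)
  qed
  have lost0: "lost \<longlonglongrightarrow> 0"
    unfolding lost_def
    using measure_lost_spectrum_tendsto_0[of \<alpha> r' \<beta> Q] \<alpha> \<beta>(1) r'(2) Q per_Q lim by blast
  have k0: "(\<lambda>j. C * (1 / real (Suc j))) \<longlonglongrightarrow> 0"
    using tendsto_mult[OF tendsto_const[of C] inv0] by simp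
  have "(\<lambda>j. \<tau>\<^sub>1 * (C * (1 / real (Suc j))) + lost j) \<longlonglongrightarrow> \<tau>\<^sub>1 * 0 + 0"
    by (intro tendsto_intros k0 lost0)
  moreover have "\<tau>\<^sub>1 * 0 + 0 < (\<tau>\<^sub>1 - \<tau>\<^sub>2) * d" using \<tau> d by simp
  ultimately have "\<forall>\<^sub>F j in sequentially. \<tau>\<^sub>1 * (C * (1 / real (Suc j))) + lost j < (\<tau>\<^sub>1 - \<tau>\<^sub>2) * d"
    by (rule order_tendstoD(2))
  then have "\<forall>\<^sub>F j in sequentially. \<tau>\<^sub>1 * (C * (1 / real (Suc j))) + lost j < (\<tau>\<^sub>1 - \<tau>\<^sub>2) * d \<and>
      C * (1 / real (Suc j)) < d \<and> 1 / real (Suc j) < \<eta> \<and> gridded M (cmv_spectrum (\<beta> j))"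
    using order_tendstoD(2)[OF k0 d(1)] order_tendstoD(2)[OF inv0 \<eta>] grid
    by eventually_elim blast
  then obtain j where j: "\<tau>\<^sub>1 * (C * (1 / real (Suc j))) + lost j < (\<tau>\<^sub>1 - \<tau>\<^sub>2) * d" "C * (1 / real (Suc j)) < d"
    "1 / real (Suc j) < \<eta>" "gridded M (cmv_spectrum (\<beta> j))"
    using eventually_happens'[OF sequentially_bot] by blast
  have "hom_below \<tau>\<^sub>2 \<delta>\<^sub>0 (cmv_spectrum (\<beta> j))"
  proof (rule hom_below_perturb[OF closed_cmv_spectrum[OF D] closed_cmv_spectrum[OF D\<beta>]
        cmv_spectrum_subset_circle[OF D\<beta>] os d hom \<tau>])
    show "\<exists>x\<in>cmv_spectrum \<alpha>. dist x x' \<le> C * (1 / real (Suc j))" if "x' \<in> cmv_spectrum (\<beta> j)" for x'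
      using near[OF that] by (simp add: dist_norm)
    show "measure arc_length (cmv_spectrum \<alpha> - cmv_spectrum (\<beta> j)) \<le> lost j" by (simp add: lost_def)
    show "C * (1 / real (Suc j)) < d" by (rule j(2))
    show "\<tau>\<^sub>1 * (C * (1 / real (Suc j))) + lost j \<le> (\<tau>\<^sub>1 - \<tau>\<^sub>2) * d" using j(1) by simp
  qed
  moreover have "\<forall>n. cmod (\<beta> j n - \<alpha> n) \<le> \<eta>" using \<beta>(2)[of j] j(3) by (meson less_imp_le order_trans)
  ultimately show ?thesis using Q per_Q(2) j(4) by blast
qed

text \<open>The number \<open>e\<close> is the remaining budget: all later sequences stay within
  \<open>e\<close> of \<beta>, hence in the disk by the bound \<open>R\<close>, and every sequence
  that close, including the limit, is gridded at level \<open>k\<close>. The constant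
  \<open>\<tau>' > \<tau>\<close> leaves room for further losses.\<close>

definition stage :: "real \<Rightarrow> real \<Rightarrow> real \<Rightarrow> nat \<Rightarrow> (int \<Rightarrow> complex) \<times> real \<Rightarrow> bool" where
  "stage \<tau> \<delta>\<^sub>0 R k = (\<lambda>(\<beta>, e). 0 < e \<and> (\<exists>q>0. \<forall>n. \<beta> (n + 2 * int q) = \<beta> n) \<and> (\<forall>n. cmod (\<beta> n) + e \<le> R) \<and>
     (\<exists>\<tau>'>\<tau>. \<tau>' \<le> 1 \<and> hom_below \<tau>' \<delta>\<^sub>0 (cmv_spectrum \<beta>)) \<and>
     (\<forall>\<gamma>. (\<forall>n. cmod (\<gamma> n - \<beta> n) \<le> e) \<longrightarrow> gridded k (cmv_spectrum \<gamma>)))"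

lemma stage_Suc:
  assumes \<tau>: "0 < \<tau>" and R: "R < 1" and st: "stage \<tau> \<delta>\<^sub>0 R k (\<beta>, e)"
  shows "\<exists>\<beta>' e'. stage \<tau> \<delta>\<^sub>0 R (Suc k) (\<beta>', e') \<and> (\<forall>n. cmod (\<beta>' n - \<beta> n) \<le> e / 2) \<and> e' \<le> e / 2"
proof -
  from st obtain q \<tau>' where e: "0 < e" and q: "0 < q" "\<And>n. \<beta> (n + 2 * int q) = \<beta> n"
    and \<beta>: "\<And>n. cmod (\<beta> n) + e \<le> R" and \<tau>': "\<tau> < \<tau>'" "\<tau>' \<le> 1" "hom_below \<tau>' \<delta>\<^sub>0 (cmv_spectrum \<beta>)"
    by (auto simp: stage_def)
  \<comment> \<open>The midpoint spends half of the remaining margin above \<tau>.\<close>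
  define \<tau>'' where "\<tau>'' = (\<tau> + \<tau>') / 2"
  have \<tau>'': "\<tau> < \<tau>''" "\<tau>'' < \<tau>'" "\<tau>'' \<le> 1" using \<tau>' by (simp_all add: \<tau>''_def)
  have \<beta>R: "cmod (\<beta> n) \<le> R" for n using \<beta>[of n] e by linarith
  have "0 < \<tau>'" "0 < Suc k" "0 < e / 2" using \<tau> \<tau>' e by auto
  then obtain Q \<beta>' where Q: "0 < Q" "\<And>n. \<beta>' (n + 2 * int Q) = \<beta>' n" and near: "\<And>n. cmod (\<beta>' n - \<beta> n) \<le> e / 2"
    and hom: "hom_below \<tau>'' \<delta>\<^sub>0 (cmv_spectrum \<beta>')" and grid: "gridded (Suc k) (cmv_spectrum \<beta>')"
    using inductive_step[of \<beta> R q \<tau>' \<delta>\<^sub>0 \<tau>'' "Suc k" "e / 2", OF \<beta>R R q(2,1) \<tau>'(3) _ \<tau>''(2,3)] by blast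
  have \<beta>'_le: "cmod (\<beta>' n) + e / 2 \<le> R" for n
    using norm_triangle_sub[of "\<beta>' n" "\<beta> n"] near[of n] \<beta>[of n] by linarith
  have \<beta>'R: "cmod (\<beta>' n) \<le> R" for n using \<beta>'_le[of n] e by linarith
  have D: "in_disk \<beta>'" using \<beta>'R R by (rule in_diskI)
  obtain \<epsilon> where \<epsilon>: "0 < \<epsilon>" "\<And>K'. (\<forall>z\<in>K'. \<exists>w\<in>cmv_spectrum \<beta>'. dist w z \<le> \<epsilon>) \<Longrightarrow> gridded (Suc k) K'"
    using gridded_stable[OF grid closed_cmv_spectrum[OF D]] by blast
  obtain C where C: "0 < C" "\<And>\<alpha> \<beta> d z. (\<And>n. cmod (\<alpha> n) \<le> R) \<Longrightarrow> (\<And>n. cmod (\<beta> n) \<le> R) \<Longrightarrow>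
      (\<And>n. cmod (\<alpha> n - \<beta> n) \<le> d) \<Longrightarrow> z \<in> cmv_spectrum \<alpha> \<Longrightarrow> \<exists>w\<in>cmv_spectrum \<beta>. cmod (w - z) \<le> C * d"
    by (rule cmv_spectrum_perturbation[OF R]) (rule that, assumption, blast)
  \<comment> \<open>Half of the budget was spent on the move to \<open>\<beta>'\<close>. The
    quotient by \<open>C\<close> converts the tolerance of the grid into one for
    coefficients.\<close>
  define e' where "e' = min (e / 2) (\<epsilon> / C)"
  have e': "0 < e'" "e' \<le> e / 2" "C * e' \<le> \<epsilon>"
    using e \<epsilon>(1) C(1) by (auto simp: e'_def min_def field_simps)
  have "gridded (Suc k) (cmv_spectrum \<gamma>)" if \<gamma>: "\<forall>n. cmod (\<gamma> n - \<beta>' n) \<le> e'" for \<gamma>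
  proof (rule \<epsilon>(2), rule ballI)
    fix z assume z: "z \<in> cmv_spectrum \<gamma>"
    have "cmod (\<gamma> n) \<le> R" for n
      using norm_triangle_sub[of "\<gamma> n" "\<beta>' n"] \<gamma>[rule_format, of n] \<beta>'_le[of n] e'(2) by linarith
    then obtain w where "w \<in> cmv_spectrum \<beta>'" "cmod (w - z) \<le> C * e'"
      using C(2)[of \<gamma> \<beta>' e' z] \<gamma> z \<beta>'R by blast
    then show "\<exists>w\<in>cmv_spectrum \<beta>'. dist w z \<le> \<epsilon>" using e'(3) by (force simp: dist_norm)
  qed
  moreover have "\<forall>n. cmod (\<beta>' n) + e' \<le> R" using \<beta>'_le e'(2) by (meson add_left_mono order_trans)
  ultimately have "stage \<tau> \<delta>\<^sub>0 R (Suc k) (\<beta>', e')"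
    unfolding stage_def using e'(1) Q hom \<tau>'' by auto
  then show ?thesis using near e'(2) by blast
qed

text \<open>The periodic approximants \<open>b\<close> are part of the conclusion because they
  certify that the limit is limit-periodic.\<close>

lemma homogeneous_limit_exists:
  assumes \<tau>: "0 < \<tau>" "\<tau> < 1" and r: "\<And>n. cmod (\<beta> n) \<le> r" "r < 1"
    and per: "\<And>n. \<beta> (n + 2 * int q) = \<beta> n" and q: "0 < q" and \<epsilon>: "0 < \<epsilon>"
  shows "\<exists>\<alpha> (b :: nat \<Rightarrow> int \<Rightarrow> complex). (\<forall>n. cmod (\<alpha> n - \<beta> n) \<le> \<epsilon>) \<and> in_disk \<alpha> \<and>
    (\<forall>e>0. \<exists>k. \<forall>n. cmod (b k n - \<alpha> n) \<le> e) \<and> (\<forall>k. \<exists>p>0. \<forall>n. b k (n + 2 * int p) = b k n) \<and>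
    tau_homogeneous \<tau> (cmv_spectrum \<alpha>) \<and> cantor_set (cmv_spectrum \<alpha>)"
proof -
  have D: "in_disk \<beta>" using r by (rule in_diskI)
  define R where "R = (1 + r) / 2"
  have R: "R < 1" using r(2) by (simp add: R_def)
  define e\<^sub>0 where "e\<^sub>0 = min \<epsilon> ((1 - r) / 2)"
  have e\<^sub>0: "0 < e\<^sub>0" "e\<^sub>0 \<le> \<epsilon>" "r + e\<^sub>0 \<le> R" using r(2) \<epsilon> by (auto simp: e\<^sub>0_def R_def min_def field_simps)
  obtain \<delta>\<^sub>1 where \<delta>\<^sub>1: "0 < \<delta>\<^sub>1" and "\<And>\<alpha>. (\<And>n. cmod (\<alpha> n) \<le> r) \<Longrightarrow>
      (\<And>n. \<alpha> (n + 2 * int q) = \<alpha> n) \<Longrightarrow> one_sided \<delta>\<^sub>1 (cmv_spectrum \<alpha>)"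
    by (rule one_sided_cmv_spectrum[OF r(2) q]) (rule that, assumption, blast)
  then have os: "one_sided \<delta>\<^sub>1 (cmv_spectrum \<beta>)" using r(1) per by metis
  define \<delta>\<^sub>0 where "\<delta>\<^sub>0 = min \<delta>\<^sub>1 (2 * pi)"
  have \<delta>\<^sub>0: "0 < \<delta>\<^sub>0" using \<delta>\<^sub>1 by (simp add: \<delta>\<^sub>0_def)
  have "hom_below 1 \<delta>\<^sub>0 (cmv_spectrum \<beta>)"
    unfolding hom_below_def \<delta>\<^sub>0_def
    using one_sided_imp_measure_ge[OF closed_cmv_spectrum[OF D] cmv_spectrum_subset_circle[OF D] os] by simp
  moreover have "\<forall>n. cmod (\<beta> n) + e\<^sub>0 \<le> R" using r(1) e\<^sub>0(3) by (meson add_right_mono order_trans)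
  \<comment> \<open>At level 0 the grid condition is vacuous, and homogeneity holds with constant 1,
    which exceeds \<tau>.\<close>
  ultimately have st0: "stage \<tau> \<delta>\<^sub>0 R 0 (\<beta>, e\<^sub>0)"
    unfolding stage_def using e\<^sub>0(1) per q \<tau>(2) by (auto simp: gridded_def)
  have "\<exists>f. \<forall>k. (stage \<tau> \<delta>\<^sub>0 R k (f k) \<and> (k = 0 \<longrightarrow> f k = (\<beta>, e\<^sub>0))) \<and>
      ((\<forall>n. cmod (fst (f (Suc k)) n - fst (f k) n) \<le> snd (f k) / 2) \<and> snd (f (Suc k)) \<le> snd (f k) / 2)"
  proof (rule dependent_nat_choice)
    show "\<exists>x. stage \<tau> \<delta>\<^sub>0 R 0 x \<and> (0 = (0 :: nat) \<longrightarrow> x = (\<beta>, e\<^sub>0))" using st0 by blast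
  next
    fix x :: "(int \<Rightarrow> complex) \<times> real" and k
    assume "stage \<tau> \<delta>\<^sub>0 R k x \<and> (k = 0 \<longrightarrow> x = (\<beta>, e\<^sub>0))"
    then obtain \<beta>' e' where "stage \<tau> \<delta>\<^sub>0 R (Suc k) (\<beta>', e')" "\<forall>n. cmod (\<beta>' n - fst x n) \<le> snd x / 2" "e' \<le> snd x / 2"
      using stage_Suc[OF \<tau>(1) R, of \<delta>\<^sub>0 k "fst x" "snd x"] by auto
    then show "\<exists>y. (stage \<tau> \<delta>\<^sub>0 R (Suc k) y \<and> (Suc k = 0 \<longrightarrow> y = (\<beta>, e\<^sub>0))) \<and>
        ((\<forall>n. cmod (fst y n - fst x n) \<le> snd x / 2) \<and> snd y \<le> snd x / 2)"
      by (intro exI[of _ "(\<beta>', e')"]) auto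
  qed
  then obtain f where f: "\<And>k. stage \<tau> \<delta>\<^sub>0 R k (f k)" "f 0 = (\<beta>, e\<^sub>0)"
    "\<And>k n. cmod (fst (f (Suc k)) n - fst (f k) n) \<le> snd (f k) / 2" "\<And>k. snd (f (Suc k)) \<le> snd (f k) / 2"
    by metis
  define b e where "b k = fst (f k)" and "e k = snd (f k)" for k
  have st: "stage \<tau> \<delta>\<^sub>0 R k (b k, e k)" for k using f(1)[of k] by (simp add: b_def e_def)
  have b0: "b 0 = \<beta>" "e 0 = e\<^sub>0" by (simp_all add: b_def e_def f(2))
  have b_step: "cmod (b (Suc k) n - b k n) \<le> e k / 2" and e_step: "e (Suc k) \<le> e k / 2" for k n
    using f(3,4) by (simp_all add: b_def e_def)
  have e_pos: "0 < e k" for k using st[of k] by (simp add: stage_def)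
  \<comment> \<open>Each move costs at most half of the current budget and the budget at least
    halves, so the distances telescope and the limit stays within \<open>e k\<close> of
    \<open>b k\<close>.\<close>
  have b_dist: "cmod (b (k + m) n - b k n) \<le> e k - e (k + m)" for k m n
  proof (induction m)
    case (Suc m)
    have "cmod (b (k + Suc m) n - b k n) \<le> cmod (b (Suc (k + m)) n - b (k + m) n) + cmod (b (k + m) n - b k n)"
      using norm_triangle_ineq[of "b (Suc (k + m)) n - b (k + m) n" "b (k + m) n - b k n"] by simp
    then show ?case using Suc b_step[of "k + m" n] e_step[of "k + m"] by simp
  qed simp
  have e_le: "e k \<le> e\<^sub>0 / 2 ^ k" for k
  proof (induction k)
    case (Suc k)
    then show ?case using e_step[of k] by simp
  qed (simp add: b0)
  have e_lim: "e \<longlonglongrightarrow> 0"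
  proof (rule tendsto_sandwich[OF _ _ tendsto_const])
    show "(\<lambda>k. e\<^sub>0 / 2 ^ k) \<longlonglongrightarrow> 0" by (rule LIMSEQ_divide_realpow_zero) simp
  qed (intro always_eventually allI less_imp_le e_pos e_le)+
  have "Cauchy (\<lambda>k. b k n)" for n
  proof (rule metric_CauchyI)
    fix \<epsilon> :: real assume "0 < \<epsilon>"
    then have "\<forall>\<^sub>F k in sequentially. e k < \<epsilon> / 2" by (intro order_tendstoD(2)[OF e_lim]) simp
    then obtain N where N: "e N < \<epsilon> / 2" by (auto simp: eventually_sequentially)
    have near: "dist (b k n) (b N n) < \<epsilon> / 2" if "k \<ge> N" for k
      using b_dist[of N "k - N" n] that N e_pos[of k] by (simp add: dist_norm)
    have "dist (b k n) (b l n) < \<epsilon>" if "k \<ge> N" "l \<ge> N" for k l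
      using near[OF that(1)] near[OF that(2)] by (rule dist_triangle_half_l)
    then show "\<exists>N. \<forall>k\<ge>N. \<forall>l\<ge>N. dist (b k n) (b l n) < \<epsilon>" by blast
  qed
  then have "\<exists>\<alpha>. \<forall>n. (\<lambda>k. b k n) \<longlonglongrightarrow> \<alpha> n" by (meson Cauchy_convergent convergent_def)
  then obtain \<alpha> where \<alpha>: "\<And>n. (\<lambda>k. b k n) \<longlonglongrightarrow> \<alpha> n" by blast
  have \<alpha>_dist: "cmod (\<alpha> n - b k n) \<le> e k" for n k
  proof (rule tendsto_upperbound)
    show "(\<lambda>m. cmod (b m n - b k n)) \<longlonglongrightarrow> cmod (\<alpha> n - b k n)" by (intro tendsto_intros \<alpha>)
    show "\<forall>\<^sub>F m in sequentially. cmod (b m n - b k n) \<le> e k"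
    proof (rule eventually_sequentiallyI)
      fix m assume "k \<le> m"
      then show "cmod (b m n - b k n) \<le> e k" using b_dist[of k "m - k" n] e_pos[of m] by simp
    qed
  qed simp
  have bR: "cmod (b k n) + e k \<le> R" for k n using st[of k] by (simp add: stage_def)
  have bR': "cmod (b k n) \<le> R" for k n using bR[of k n] e_pos[of k] by linarith
  have \<alpha>R: "cmod (\<alpha> n) \<le> R" for n
    using norm_triangle_sub[of "\<alpha> n" "b 0 n"] \<alpha>_dist[of n 0] bR[of 0 n] by linarith
  have D\<alpha>: "in_disk \<alpha>" using \<alpha>R R by (rule in_diskI)
  have Db: "in_disk (b k)" for k using bR' R by (rule in_diskI)
  define K where "K = cmv_spectrum \<alpha>"
  have K: "closed K" "K \<subseteq> sphere 0 1" "K \<noteq> {}"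
    using closed_cmv_spectrum cmv_spectrum_subset_circle cmv_spectrum_nonempty D\<alpha> by (simp_all add: K_def)
  have grid: "gridded k K" for k
    using st[of k] \<alpha>_dist[of _ k] unfolding stage_def K_def by auto
  have hom: "hom_below \<tau> \<delta>\<^sub>0 K"
  proof (rule hom_below_limit[OF K(1), where L = "\<lambda>k. cmv_spectrum (b k)"])
    show "closed (cmv_spectrum (b k))" for k by (rule closed_cmv_spectrum[OF Db])
    show "hom_below \<tau> \<delta>\<^sub>0 (cmv_spectrum (b k))" for k
      using st[of k] hom_below_mono unfolding stage_def by fastforce
    obtain C where C: "0 < C" "\<And>\<alpha> \<beta> d z. (\<And>n. cmod (\<alpha> n) \<le> R) \<Longrightarrow> (\<And>n. cmod (\<beta> n) \<le> R) \<Longrightarrow>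
        (\<And>n. cmod (\<alpha> n - \<beta> n) \<le> d) \<Longrightarrow> z \<in> cmv_spectrum \<alpha> \<Longrightarrow> \<exists>w\<in>cmv_spectrum \<beta>. cmod (w - z) \<le> C * d"
      by (rule cmv_spectrum_perturbation[OF R]) (rule that, assumption, blast)
    fix \<epsilon> :: real assume "0 < \<epsilon>"
    then have "\<forall>\<^sub>F k in sequentially. e k < \<epsilon> / C" using C(1) by (intro order_tendstoD(2)[OF e_lim]) simp
    then obtain k where "e k < \<epsilon> / C" by (auto simp: eventually_sequentially)
    then have k: "C * e k \<le> \<epsilon>" using C(1) by (simp add: field_simps)
    have "\<exists>y\<in>cmv_spectrum (b k). dist x y \<le> \<epsilon>" if "x \<in> K" for x
      using C(2)[of \<alpha> "b k" "e k" x] \<alpha>R bR' \<alpha>_dist that k unfolding K_def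
      by (force simp: dist_norm norm_minus_commute)
    moreover have "\<exists>x\<in>K. dist x y \<le> \<epsilon>" if "y \<in> cmv_spectrum (b k)" for y
      using C(2)[of "b k" \<alpha> "e k" y] \<alpha>R bR' \<alpha>_dist that k unfolding K_def
      by (force simp: dist_norm norm_minus_commute)
    ultimately show "\<exists>k. (\<forall>x\<in>K. \<exists>y\<in>cmv_spectrum (b k). dist x y \<le> \<epsilon>) \<and>
        (\<forall>y\<in>cmv_spectrum (b k). \<exists>x\<in>K. dist x y \<le> \<epsilon>)" by blast
  qed
  have "cantor_set K" by (rule cantor_setI[OF K grid hom \<tau>(1) \<delta>\<^sub>0])
  moreover have "tau_homogeneous \<tau> K"
    unfolding tau_homogeneous_def using K(1,2) hom \<delta>\<^sub>0 by (auto simp: hom_below_def)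
  moreover have "\<forall>n. cmod (\<alpha> n - \<beta> n) \<le> \<epsilon>" using \<alpha>_dist[of _ 0] e\<^sub>0(2) by (auto simp: b0 intro: order_trans)
  moreover have "\<forall>\<epsilon>>0. \<exists>k. \<forall>n. cmod (b k n - \<alpha> n) \<le> \<epsilon>"
  proof (intro allI impI)
    fix \<epsilon> :: real assume "0 < \<epsilon>"
    then have "\<forall>\<^sub>F k in sequentially. e k < \<epsilon>" by (intro order_tendstoD(2)[OF e_lim])
    then obtain k where "e k < \<epsilon>" by (auto simp: eventually_sequentially)
    then have "cmod (b k n - \<alpha> n) \<le> \<epsilon>" for n
      using \<alpha>_dist[of n k] by (simp add: norm_minus_commute)
    then show "\<exists>k. \<forall>n. cmod (b k n - \<alpha> n) \<le> \<epsilon>" by blast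
  qed
  moreover have "\<forall>k. \<exists>p>0. \<forall>n. b k (n + 2 * int p) = b k n" using st by (auto simp: stage_def)
  ultimately show ?thesis using D\<alpha> unfolding K_def by blast
qed

section \<open>Passage to the space of bounded sequences\<close>

lemma bcontfun_int:
  fixes f :: "int \<Rightarrow> complex"
  assumes "\<And>n. cmod (f n) \<le> B"
  shows "apply_bcontfun (Bcontfun f) = f"
  by (rule Bcontfun_inverse) (use assms in \<open>auto simp: bcontfun_def intro!: boundedI\<close>)

text \<open>A periodic approximant may leave the disk and is scaled back into it. Having finitely
  many values, it then has modulus bounded by some \<open>r < 1\<close>. Doubling the period makes
  it even.\<close>

lemma periodic_in_disk_approx:
  assumes \<alpha>: "\<alpha> \<in> limit_periodic_disk" and \<epsilon>: "0 < \<epsilon>"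
  shows "\<exists>\<beta> q r. 0 < q \<and> (\<forall>n. \<beta> (n + 2 * int q) = \<beta> n) \<and> (\<forall>n. cmod (\<beta> n) \<le> r) \<and> r < 1 \<and>
    (\<forall>n. cmod (\<beta> n - apply_bcontfun \<alpha> n) \<le> \<epsilon>)"
proof -
  define d where "d = \<epsilon> / 2"
  have d: "0 < d" using \<epsilon> by (simp add: d_def)
  obtain g where g: "g \<in> periodic_seqs" "dist g \<alpha> < d"
    using \<alpha> d unfolding limit_periodic_disk_def limit_periodic_seqs_def closure_approachable by blast
  then obtain p where p: "0 < p" "\<And>n. apply_bcontfun g (n + p) = apply_bcontfun g n"
    by (auto simp: periodic_seqs_def)
  have dist: "cmod (apply_bcontfun g n - apply_bcontfun \<alpha> n) < d" for n
    using dist_bounded[of g n \<alpha>] g(2) by (simp add: dist_norm)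
  have \<alpha>1: "cmod (apply_bcontfun \<alpha> n) < 1" for n using \<alpha> by (simp add: limit_periodic_disk_def)
  have g1: "cmod (apply_bcontfun g n) < 1 + d" for n
    using norm_triangle_sub[of "apply_bcontfun g n" "apply_bcontfun \<alpha> n"] dist[of n] \<alpha>1[of n] by linarith
  \<comment> \<open>All values of \<open>g\<close> have modulus below \<open>1 + d\<close>, and the
    scaling moves each of them by at most \<open>d\<close>.\<close>
  define \<beta> where "\<beta> n = apply_bcontfun g n / of_real (1 + d)" for n
  have \<beta>1: "cmod (\<beta> n) < 1" for n
    using g1[of n] d by (simp add: \<beta>_def norm_divide flip: of_real_add)
  define q where "q = nat p"
  have q: "0 < q" "int q = p" using p(1) by (simp_all add: q_def)
  have per: "\<beta> (n + 2 * int q) = \<beta> n" for n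
    using p(2)[of "n + p"] p(2)[of n] by (simp add: \<beta>_def q(2) algebra_simps)
  have per_j: "\<beta> (n + 2 * int q * j) = \<beta> n" for n j
    by (rule periodic_multiple) (rule per)
  define r where "r = Max ((\<lambda>n. cmod (\<beta> n)) ` {0..<2 * int q})"
  have ne: "{0..<2 * int q} \<noteq> {}" using q by simp
  have "r < 1" unfolding r_def using ne \<beta>1 by (subst Max_less_iff) auto
  moreover have "cmod (\<beta> n) \<le> r" for n
  proof -
    have "\<beta> n = \<beta> (n mod (2 * int q))"
      using per_j[of "n mod (2 * int q)" "n div (2 * int q)"] by simp
    then show ?thesis unfolding r_def using q by (auto intro!: Max_ge)
  qed
  moreover have "cmod (\<beta> n - apply_bcontfun \<alpha> n) \<le> \<epsilon>" for n
  proof -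
    have "apply_bcontfun g n = of_real (1 + d) * \<beta> n" using d by (simp add: \<beta>_def flip: of_real_add)
    then have "\<beta> n - apply_bcontfun \<alpha> n = (apply_bcontfun g n - apply_bcontfun \<alpha> n) - of_real d * \<beta> n"
      by (simp add: algebra_simps)
    also have "cmod \<dots> \<le> cmod (apply_bcontfun g n - apply_bcontfun \<alpha> n) + cmod (of_real d * \<beta> n)"
      by (rule norm_triangle_ineq4)
    also have "cmod (of_real d * \<beta> n) \<le> d * 1"
      using d \<beta>1[of n] unfolding norm_mult norm_of_real by (intro mult_mono) auto
    finally show ?thesis using dist[of n] by (simp add: d_def)
  qed
  ultimately show ?thesis using q(1) per by blast
qed

theorem theorem1p4:
  fixes \<tau> :: real
  assumes "0 < \<tau>" and "\<tau> < 1"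
  shows "limit_periodic_disk \<subseteq> closure (homogeneous_cmv \<tau>)"
proof
  fix x assume x: "x \<in> limit_periodic_disk"
  show "x \<in> closure (homogeneous_cmv \<tau>)"
    unfolding closure_approachable
  proof (intro allI impI)
    fix \<epsilon> :: real assume "0 < \<epsilon>"
    \<comment> \<open>Two errors of a third each, one for the periodic approximation and one for the
      limit construction, keep the sum strictly below the tolerance.\<close>
    then have \<epsilon>: "0 < \<epsilon> / 3" by simp
    obtain \<beta> q r where \<beta>: "0 < q" "\<And>n. \<beta> (n + 2 * int q) = \<beta> n" "\<And>n. cmod (\<beta> n) \<le> r" "r < 1"
      "\<And>n. cmod (\<beta> n - apply_bcontfun x n) \<le> \<epsilon> / 3"
      using periodic_in_disk_approx[OF x \<epsilon>] by blast
    have "\<exists>\<alpha> (b :: nat \<Rightarrow> int \<Rightarrow> complex). (\<forall>n. cmod (\<alpha> n - \<beta> n) \<le> \<epsilon> / 3) \<and> in_disk \<alpha> \<and>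
      (\<forall>e>0. \<exists>k. \<forall>n. cmod (b k n - \<alpha> n) \<le> e) \<and> (\<forall>k. \<exists>p>0. \<forall>n. b k (n + 2 * int p) = b k n) \<and>
      tau_homogeneous \<tau> (cmv_spectrum \<alpha>) \<and> cantor_set (cmv_spectrum \<alpha>)"
      by (rule homogeneous_limit_exists[of \<tau> \<beta> r q, OF assms \<beta>(3,4,2,1) \<epsilon>])
    then obtain \<alpha> and b :: "nat \<Rightarrow> int \<Rightarrow> complex" where \<alpha>: "\<forall>n. cmod (\<alpha> n - \<beta> n) \<le> \<epsilon> / 3" "in_disk \<alpha>"
      and b: "\<forall>e>0. \<exists>k. \<forall>n. cmod (b k n - \<alpha> n) \<le> e" "\<forall>k. \<exists>p>0. \<forall>n. b k (n + 2 * int p) = b k n"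
      and hom: "tau_homogeneous \<tau> (cmv_spectrum \<alpha>)" "cantor_set (cmv_spectrum \<alpha>)"
      by (elim exE conjE) (rule that)
    have \<alpha>1: "cmod (\<alpha> n) \<le> 1" for n using \<alpha>(2) by (simp add: in_disk_def less_imp_le)
    define y where "y = Bcontfun \<alpha>"
    have y: "apply_bcontfun y = \<alpha>" unfolding y_def by (rule bcontfun_int[OF \<alpha>1])
    have "y \<in> closure periodic_seqs"
      unfolding closure_approachable
    proof (intro allI impI)
      fix e :: real assume "0 < e"
      then obtain k where k: "\<And>n. cmod (b k n - \<alpha> n) \<le> e / 2" using b(1)[rule_format, of "e / 2"] by auto
      have "cmod (b k n) \<le> 1 + e / 2" for n
        using norm_triangle_sub[of "b k n" "\<alpha> n"] k[of n] \<alpha>1[of n] by linarith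
      then have bk: "apply_bcontfun (Bcontfun (b k)) = b k" by (rule bcontfun_int)
      obtain p where "0 < p" "\<forall>n. b k (n + 2 * int p) = b k n" using b(2) by blast
      then have "Bcontfun (b k) \<in> periodic_seqs"
        unfolding periodic_seqs_def by (intro CollectI exI[of _ "2 * int p"]) (simp add: bk)
      moreover have "dist (Bcontfun (b k)) y \<le> e / 2"
        by (rule dist_bound) (simp only: bk y dist_norm k)
      ultimately show "\<exists>z\<in>periodic_seqs. dist z y < e" using \<open>0 < e\<close> by force
    qed
    then have "y \<in> homogeneous_cmv \<tau>"
      using hom \<alpha>(2) by (simp add: homogeneous_cmv_def limit_periodic_disk_def limit_periodic_seqs_def y in_disk_def)
    moreover have "dist y x \<le> 2 * \<epsilon> / 3"
    proof (rule dist_bound)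
      fix n
      have "cmod (\<alpha> n - apply_bcontfun x n) \<le> cmod (\<alpha> n - \<beta> n) + cmod (\<beta> n - apply_bcontfun x n)"
        using norm_triangle_ineq[of "\<alpha> n - \<beta> n" "\<beta> n - apply_bcontfun x n"] by simp
      then show "dist (apply_bcontfun y n) (apply_bcontfun x n) \<le> 2 * \<epsilon> / 3"
        using \<alpha>(1)[rule_format, of n] \<beta>(5)[of n] by (simp add: y dist_norm)
    qed
    ultimately show "\<exists>y\<in>homogeneous_cmv \<tau>. dist y x < \<epsilon>" using \<open>0 < \<epsilon>\<close> by force
  qed
qed

end
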